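(* Let $p$ be a prime number and $\Gamma\subseteq\mathbb{F}_p^*$ be a multiplicative subgroup. Then $$\mathsf{E}(\Gamma)\ll\max\left\{|\Gamma|^{\frac{22}{9}}\log|\Gamma|,\ |\Gamma|^{3}p^{-\frac13}\log^{\frac43}|\Gamma|\right\}.$$ More precisely, $$\mathsf{E}(\Gamma)\ll|\Gamma|^{\frac{22}{9}}\log^{\frac23}|\Gamma|$$ provided that $|\Gamma|\ll p^{\frac35}\log^{-\frac65}p$. Moreover, if $|\Gamma|<\sqrt p$ and $k\ge2$, then $$\mathsf{T}_k(\Gamma)\ll_k|\Gamma|^{2k-\frac{17}{9}+\frac{16}{3}2^{-2k}}\log^{\frac23}|\Gamma|.$$
   Context: $\mathbb{F}_p=\mathbb{Z}/p\mathbb{Z}$ and $\mathbb{F}_p^*=\mathbb{F}_p\setminus\{0\}$. For a finite subset $A$ of an abelian group, $\mathsf{E}(A)=|\{(a_1,a_2,a_3,a_4)\in A^4: a_1+a_2=a_3+a_4\}|$ is the additive energy, and, for a positive integer $k$, $\mathsf{T}_k(A)=|\{(a_1,\dots,a_k,a_1',\dots,a_k')\in A^{2k}: a_1+\dots+a_k=a_1'+\dots+a_k'\}|$. Logarithms are to base $2$. The symbol $\ll$ is the usual Vinogradov symbol ($X\ll Y$ means $X\le CY$ for some absolute constant $C>0$); in $\ll_k$ the constant may depend on $k$.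
   Formalization: The first bound is proved for |Γ| ≪ p^{2/3} log^{4/3}|Γ| (constant depending on the implied one), since it fails for Γ = F_p^*, where E(Γ) ≥ |Γ|^4/p ~ p^3; the trivial subgroup |Γ| = 1, where log|Γ| = 0, is excluded in all three bounds. *)

theory Defs
  imports Complex_Main "HOL-Number_Theory.Residues"
begin

text \<open>
  An abelian group in additive notation is the additive part of a ring record, as in the locale
  \<^locale>\<open>abelian_group\<close>; the multiplicative fields are not used in the two definitions below.
\<close>

definition additive_energy :: "('a, 'b) ring_scheme \<Rightarrow> 'a set \<Rightarrow> nat" where
  "additive_energy R A =
     card {(a1, a2, a3, a4). a1 \<in> A \<and> a2 \<in> A \<and> a3 \<in> A \<and> a4 \<in> A \<and>
                             a1 \<oplus>\<^bsub>R\<^esub> a2 = a3 \<oplus>\<^bsub>R\<^esub> a4}"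

text \<open>A \<open>k\<close>-tuple over \<open>A\<close> is an extensional function on \<open>{..<k}\<close>.\<close>

definition higher_energy :: "('a, 'b) ring_scheme \<Rightarrow> nat \<Rightarrow> 'a set \<Rightarrow> nat" where
  "higher_energy R k A =
     card {(a, a'). a \<in> {..<k} \<rightarrow>\<^sub>E A \<and> a' \<in> {..<k} \<rightarrow>\<^sub>E A \<and>
                    (\<Oplus>\<^bsub>R\<^esub>i\<in>{..<k}. a i) = (\<Oplus>\<^bsub>R\<^esub>i\<in>{..<k}. a' i)}"

text \<open>
  Conventions for the bounds on a subgroup \<open>\<Gamma>\<close> of the units modulo \<open>p\<close>:

  \<^item> \<open>X \<lless> Y\<close> in a conclusion is \<open>X \<le> C * Y\<close> with \<open>C\<close> chosen before \<open>p\<close> and \<open>\<Gamma>\<close>; in a size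
    hypothesis it is \<open>X \<le> c * Y\<close> for an arbitrary \<open>c\<close>, on which \<open>C\<close> may depend.
  \<^item> \<open>1 < card \<Gamma>\<close> is assumed, since for the trivial subgroup \<open>log 2 (card \<Gamma>) = 0\<close> and the bounds
    would read \<open>1 \<le> 0\<close>.
  \<^item> The bound by the maximum of two terms is false for arbitrary \<open>\<Gamma>\<close>: by Cauchy-Schwarz the energy
    is at least \<open>(card \<Gamma>)^4 / p\<close>, which for the full unit group has order \<open>p^3\<close> and exceeds
    both terms. It is stated under the hypothesis
    \<open>card \<Gamma> \<lless> p powr (2/3) * log 2 (card \<Gamma>) powr (4/3)\<close>. This says exactly
    that \<open>(card \<Gamma>)^4 / p\<close> is \<open>\<lless>\<close> the second term, and it holds (for a suitable \<open>c\<close>) for every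
    \<open>\<Gamma>\<close> satisfying the bound with a given \<open>C\<close>, so no weaker hypothesis is possible.
\<close>

end

theory Submission
  imports Defs "HOL-Computational_Algebra.Polynomial" "HOL-Library.Cardinality"
    "HOL-Analysis.Convex" "HOL-Analysis.Harmonic_Numbers"
begin

text \<open>
  Let \<open>n = |\<Gamma>|\<close>, let \<open>\<rho>(x)\<close> be the number of representations \<open>x = a - b\<close> in \<open>\<Gamma>\<close>, and \<open>E = \<Sum> \<rho>\<^sup>2\<close>.
  Stepanov's method bounds the number of \<open>x\<close> for which \<open>(x, 1 - x)\<close> lies in one of \<open>T\<close> given pairs of
  cosets of \<open>\<Gamma>\<close> by \<open>O((n T)^(2/3))\<close>; hence the level sets of \<open>\<rho>\<close> satisfy \<open>|{\<rho> \<ge> i}| = O(n^3 / i^3)\<close>.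
  Jensen's inequality over the dilations by \<open>\<Gamma>\<close> shows
  \<open>E^3 / n^4 \<le> \<Sum> \<rho>(1 - y) \<rho>(1 - z) \<rho>(z - y)\<close>, summed over \<open>y, z \<in> \<Gamma>\<close>.
  The ratio \<open>(1 - z) / (1 - y)\<close> of a pair \<open>(y, z)\<close> determines a pair of cosets \<open>\<theta>\<close>, and the number of pairs
  over \<open>\<theta>\<close> is a product of two numbers bounded by Stepanov's method. So at most
  \<open>O(n^(4/3) T^(1/3))\<close> pairs \<open>(y, z)\<close> lie over \<open>T\<close> given values of \<open>\<theta>\<close>, and decomposing \<open>\<rho>\<close> into its level
  sets bounds the triple sum by \<open>n^(10/3)\<close> up to logarithms, which is the exponent \<open>22/9\<close>.
  Values \<open>\<theta>\<close> below the range of Stepanov's method give rise to the term with \<open>p^(-1/3)\<close>. For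
  \<open>n^3 > p^2\<close> the second moment over all slopes gives \<open>E \<le> n^4 / p + n p\<close>, which suffices.
  The same argument with the number of representations \<open>x = a + b - c - d\<close> in place of \<open>\<rho>\<close> bounds \<open>T_3\<close>
  by \<open>n^(25/6)\<close> up to logarithms; the level sets of this function also bound \<open>T_4\<close>, and
  \<open>T_(k+1) \<le> n^2 T_k\<close> gives the remaining \<open>k\<close>.
\<close>

section \<open>Polynomials in positive characteristic\<close>

text \<open>The exponents rest on a cube root. A level set of \<open>\<rho>\<close> at height i
  consists of O(n^2 / i^3) cosets, so heights i, j, k allow O(n^6 / (i j k)^3) values \<theta>; a
  count of pairs growing like the cube root of the number of values makes the sum over heights
  merely logarithmic. That growth comes from a second moment: the T largest numbers of solutions
  have typical size (n^2 / T)^(1/3), and T squares of this size add up to n^(4/3) T^(1/3). The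
  obstacle is that Stepanov's method compares an auxiliary degree with p. Once n exceeds sqrt p, the
  average number of solutions is about n^2 / p, and no bound of this type can hold for
  multiplicities below it. For the pairs concerned, the Cauchy-Schwarz inequality against the third
  moment of \<open>\<rho>\<close> gives an estimate that again contains E; solving it for E yields
  E^3 = O(n^9 / p) up to a logarithm, whose cube root is the term with p^(-1/3).\<close>

lemma pderiv_linear_power_mult:
  fixes q :: "'a::field poly"
  shows "pderiv ([:c, 1:] ^ Suc k * q) = [:c, 1:] ^ k * (smult (of_nat (Suc k)) q + [:c, 1:] * pderiv q)"
proof -
  define l where "l = [:c, 1:]"
  have "pderiv l = 1" by (simp add: l_def pderiv_pCons)
  then have "pderiv (l ^ Suc k * q) = l ^ k * (smult (of_nat (Suc k)) q + l * pderiv q)"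
    unfolding pderiv_mult pderiv_power_Suc by (simp add: algebra_simps)
  then show ?thesis by (simp add: l_def)
qed

text \<open>The operator X f' - m f removes the term of degree m and keeps all others, since
  exponents below p stay distinct in the field, and it costs at most one order of vanishing at 1.
  The induction ends with a single monomial, which does not vanish at 1. This is what keeps the
  auxiliary polynomial of Stepanov's method from being zero.\<close>

lemma fewnomial_root_order:
  fixes f :: "'a::field poly"
  assumes char: "\<And>k. 0 < k \<Longrightarrow> k < p \<Longrightarrow> of_nat k \<noteq> (0::'a)"
  shows "f \<noteq> 0 \<Longrightarrow> degree f < p \<Longrightarrow> card {i. coeff f i \<noteq> 0} \<le> k \<Longrightarrow> \<not> [:-1, 1:] ^ k dvd f"
proof (induction k arbitrary: f)
  case 0
  have "finite {i. coeff f i \<noteq> 0}"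
    by (rule finite_subset[of _ "{..degree f}"]) (auto intro: le_degree)
  with 0 show ?case by (auto simp: poly_eq_iff)
next
  case (Suc k)
  have fin: "finite {i. coeff f i \<noteq> 0}"
    by (rule finite_subset[of _ "{..degree f}"]) (auto intro: le_degree)
  obtain m where m: "coeff f m \<noteq> 0" using Suc.prems(1) by (auto simp: poly_eq_iff)
  show ?case
  proof
    assume dvd: "[:-1, 1:] ^ Suc k dvd f"
    define g where "g = pCons 0 (pderiv f) - smult (of_nat m) f"
    have cg: "coeff g i = (of_nat i - of_nat m) * coeff f i" for i
      by (cases i) (simp_all add: g_def coeff_pderiv left_diff_distrib)
    have nz: "(of_nat i - of_nat m :: 'a) \<noteq> 0" if "coeff f i \<noteq> 0" "i \<noteq> m" for i
    proof -
      have im: "i < p" "m < p" using that m le_degree Suc.prems(2) by (meson order.strict_trans1)+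
      show ?thesis
      proof (cases "i < m")
        case True
        then have "of_nat m - of_nat i = (of_nat (m - i) :: 'a)" by (simp add: of_nat_diff)
        moreover have "(of_nat (m - i) :: 'a) \<noteq> 0" using True im by (intro char) auto
        ultimately show ?thesis by (metis eq_iff_diff_eq_0)
      next
        case False
        then have "of_nat i - of_nat m = (of_nat (i - m) :: 'a)" by (simp add: of_nat_diff)
        moreover have "(of_nat (i - m) :: 'a) \<noteq> 0" using False im that by (intro char) auto
        ultimately show ?thesis by (metis eq_iff_diff_eq_0)
      qed
    qed
    have supp: "{i. coeff g i \<noteq> 0} = {i. coeff f i \<noteq> 0} - {m}"
      using nz by (auto simp: cg)
    have dvd': "[:-1, 1:] ^ k dvd g"
    proof -
      obtain q where q: "f = [:-1, 1:] ^ Suc k * q" using dvd by auto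
      have "pderiv f = [:-1, 1:] ^ k * (smult (of_nat (Suc k)) q + [:-1,1:] * pderiv q)"
        unfolding q by (rule pderiv_linear_power_mult)
      then have a: "[:-1, 1:] ^ k dvd pderiv f" by auto
      have "[:-1, 1:] ^ k dvd f" by (rule dvd_trans[OF le_imp_power_dvd dvd]) simp
      moreover have "pCons 0 (pderiv f) = [:0,1:] * pderiv f" by simp
      ultimately show ?thesis using a unfolding g_def by (metis dvd_diff dvd_mult dvd_smult)
    qed
    show False
    proof (cases "g = 0")
      case True
      then have "f = monom (coeff f m) m"
        using supp by (auto simp: poly_eq_iff)
      then have "poly f 1 = coeff f m" by (metis mult.right_neutral poly_monom power_one)
      moreover have "poly f 1 = 0"
      proof -
        have "[:-1, 1:] dvd f" using dvd by (metis dvd_mult_left power_Suc)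
        then show ?thesis by (auto simp: poly_eq_0_iff_dvd)
      qed
      ultimately show False using m by simp
    next
      case False
      have "degree g \<le> degree f" by (intro degree_le) (auto simp: cg coeff_eq_0)
      moreover have "card {i. coeff g i \<noteq> 0} \<le> k"
        using Suc.prems(3) m fin by (simp add: supp)
      ultimately show False using Suc.IH[of g] False dvd' Suc.prems(2) by auto
    qed
  qed
qed

text \<open>
  Up to a factor, \<open>X (1 - X) d/dX\<close> maps \<open>X^s (1 - X)^t h\<close> to \<open>X^s (1 - X)^t\<close> times a polynomial of
  degree at most \<open>deg h + 1\<close>. Iterating this operator instead of the derivative makes the vanishing
  conditions at \<open>x\<close> depend on the large powers only through \<open>x^n\<close> and \<open>(1 - x)^n\<close>.
\<close>

lemma root_order_by_operator:
  fixes f :: "'a::field poly" and x :: 'a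
  assumes char: "\<And>k. 0 < k \<Longrightarrow> k < p \<Longrightarrow> of_nat k \<noteq> (0::'a)"
    and x: "x \<noteq> 0" "x \<noteq> 1" and D: "D \<le> p"
    and van: "\<And>k. k < D \<Longrightarrow> poly (((\<lambda>h. [:0, 1, -1:] * pderiv h) ^^ k) f) x = 0"
  shows "[:-x, 1:] ^ D dvd f"
proof (cases "f = 0")
  case False
  \<comment> \<open>Each application lowers the order of a zero at x by exactly one as long as that
    order is less than p: the new cofactor at x is multiplied by x (1 - x) times the order, which is
    nonzero. So an order e below \<open>D\<close> would contradict \<open>van\<close> at e.\<close>
  have ex: "poly (((\<lambda>h. [:0, 1, -1:] * pderiv h) ^^ e) ([:-x, 1:] ^ e * h)) x \<noteq> 0"
    if "e < p" "poly h x \<noteq> 0" for e h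
    using that
  proof (induction e arbitrary: h)
    case (Suc e)
    define h1 where "h1 = [:0, 1, -1:] * (smult (of_nat (Suc e)) h + [:-x, 1:] * pderiv h)"
    have "[:0, 1, -1:] * pderiv ([:-x, 1:] ^ Suc e * h) = [:-x, 1:] ^ e * h1"
      unfolding h1_def pderiv_linear_power_mult by (simp only: mult.left_commute)
    moreover have "poly h1 x = x * (1 - x) * of_nat (Suc e) * poly h x"
      unfolding h1_def by (simp add: algebra_simps)
    then have "poly h1 x \<noteq> 0" using char[of "Suc e"] Suc.prems x by (simp del: of_nat_Suc)
    ultimately show ?case
      using Suc.IH[of h1] Suc.prems by (simp only: funpow_Suc_right o_apply Suc_lessD simp_thms)
  qed simp
  define e where "e = order x f"
  obtain h where h: "f = [:-x, 1:] ^ e * h" using order_1[of x f] unfolding e_def by auto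
  have "\<not> [:-x, 1:] dvd h"
  proof
    assume "[:-x, 1:] dvd h"
    then have "[:-x, 1:] ^ Suc e dvd f" unfolding h by (metis dvd_refl mult_dvd_mono power_Suc2)
    then show False using order_2[OF False, of x] unfolding e_def by simp
  qed
  then have "poly h x \<noteq> 0" by (simp add: poly_eq_0_iff_dvd)
  then have "D \<le> e" using ex[of e h] van[of e] D h by force
  then show ?thesis unfolding e_def using order_divides by blast
qed simp

text \<open>Over a finite field this is the pigeonhole principle.\<close>

lemma nontrivial_solution:
  fixes M :: "'j \<Rightarrow> 'i \<Rightarrow> 'a::{field,finite}"
  assumes "finite I" "finite J" "card J < card I"
  obtains l where "\<exists>i\<in>I. l i \<noteq> 0" "\<And>j. j \<in> J \<Longrightarrow> (\<Sum>i\<in>I. l i * M j i) = 0"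
proof -
  define F where "F l = restrict (\<lambda>j. \<Sum>i\<in>I. l i * M j i) J" for l
  have "F ` (I \<rightarrow>\<^sub>E UNIV) \<subseteq> J \<rightarrow>\<^sub>E UNIV" by (auto simp: F_def)
  moreover have "card (J \<rightarrow>\<^sub>E (UNIV :: 'a set)) < card (I \<rightarrow>\<^sub>E (UNIV :: 'a set))"
  proof -
    have "card {0::'a, 1} \<le> CARD('a)" by (rule card_mono) auto
    then have "1 < CARD('a)" by simp
    then show ?thesis using assms by (simp add: card_PiE)
  qed
  ultimately have "\<not> inj_on F (I \<rightarrow>\<^sub>E UNIV)"
    using assms by (meson card_inj_on_le finite_PiE finite linorder_not_le)
  then obtain l l' where l: "l \<in> I \<rightarrow>\<^sub>E UNIV" "l' \<in> I \<rightarrow>\<^sub>E UNIV" "F l = F l'" "l \<noteq> l'"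
    by (auto simp: inj_on_def)
  show thesis
  proof (rule that[of "\<lambda>i. l i - l' i"])
    show "\<exists>i\<in>I. l i - l' i \<noteq> 0" using l by (metis PiE_ext eq_iff_diff_eq_0)
    fix j assume "j \<in> J"
    then have "(\<Sum>i\<in>I. l i * M j i) = (\<Sum>i\<in>I. l' i * M j i)"
      using fun_cong[OF l(3), of j] by (simp add: F_def)
    then show "(\<Sum>i\<in>I. (l i - l' i) * M j i) = 0"
      by (simp add: left_diff_distrib sum_subtractf)
  qed
qed

section \<open>Stepanov's method\<close>

text \<open>
  For nonzero arguments, \<open>x^n\<close> determines the coset of \<open>x\<close> modulo the group of \<open>n\<close>-th roots of unity;
  a pair \<open>\<theta>\<close> thus stands for two cosets, and \<open>sols n \<theta>\<close> collects the \<open>x\<close> such that \<open>x\<close> and \<open>1 - x\<close> lie in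
  these cosets.
\<close>

definition sols :: "nat \<Rightarrow> 'a::{field,finite} \<times> 'a \<Rightarrow> 'a set" where
  "sols n \<theta> = {x. x ^ n = fst \<theta> \<and> (1 - x) ^ n = snd \<theta>}"

definition nsols :: "nat \<Rightarrow> 'a::{field,finite} \<times> 'a \<Rightarrow> nat" where
  "nsols n \<theta> = card (sols n \<theta>)"

text \<open>Let H_m be the first nonzero coefficient in the expansion by powers of (1 - X)^n. If the
  sum were zero, cancelling (1 - X)^(n m) would make H_m divisible by (1 - X)^n. But H_m has at most
  \<open>A * B \<le> n\<close> terms and degree below \<open>n * B \<le> p\<close>, which
  \<open>fewnomial_root_order\<close> excludes.\<close>

lemma auxiliary_nonzero:
  fixes l :: "nat \<Rightarrow> nat \<Rightarrow> nat \<Rightarrow> 'a::field"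
  assumes char: "\<And>k. 0 < k \<Longrightarrow> k < p \<Longrightarrow> of_nat k \<noteq> (0::'a)"
    and AB: "A * B \<le> n" and nB: "n * B \<le> p"
    and ne: "a0 < A" "b0 < B" "c0 < B" "l a0 b0 c0 \<noteq> 0"
  shows "(\<Sum>c<B. [:1, -1:] ^ (n * c) * (\<Sum>b<B. \<Sum>a<A. monom (l a b c) (a + n * b))) \<noteq> 0"
proof
  define H where "H c = (\<Sum>b<B. \<Sum>a<A. monom (l a b c) (a + n * b))" for c
  assume *: "(\<Sum>c<B. [:1, -1:] ^ (n * c) * (\<Sum>b<B. \<Sum>a<A. monom (l a b c) (a + n * b))) = 0"
  have B: "B > 0" using ne by simp
  then have An: "A \<le> n" using AB by (metis le_trans mult.right_neutral mult_le_mono2 One_nat_def Suc_leI)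
  have inj: "inj_on (\<lambda>(a, b). a + n * b) ({..<A} \<times> {..<B})"
  proof (rule inj_onI, clarify)
    fix a b a' b' assume "a < A" "a' < A" and eq: "a + n * b = a' + n * b'"
    then have "a < n" "a' < n" using An by auto
    with eq have "a = a'" "b = b'"
      by (metis mod_less mod_mult_self2, metis \<open>a < n\<close> \<open>a' < n\<close> div_less div_mult_self2 add_0_right less_nat_zero_code add.commute add_0)
    then show "a = a' \<and> b = b'" by simp
  qed
  have cH: "coeff (H c) k = (\<Sum>(a, b)\<in>{..<A} \<times> {..<B}. if a + n * b = k then l a b c else 0)" for c k
    unfolding H_def
    by (subst sum.swap) (auto simp: coeff_sum sum.cartesian_product intro!: sum.cong)
  have H0: "H c0 \<noteq> 0"
  proof
    assume "H c0 = 0"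
    have "coeff (H c0) (a0 + n * b0) =
      (\<Sum>x\<in>{..<A} \<times> {..<B}. if x = (a0, b0) then l a0 b0 c0 else 0)"
      unfolding cH
    proof (rule sum.cong[OF refl])
      fix x assume x: "x \<in> {..<A} \<times> {..<B}"
      obtain a b where ab: "x = (a, b)" by (cases x)
      have "(a, b) = (a0, b0)" if "a + n * b = a0 + n * b0"
        by (rule inj_onD[OF inj]) (use x ab ne that in auto)
      then show "(case x of (a, b) \<Rightarrow> if a + n * b = a0 + n * b0 then l a b c0 else 0) =
        (if x = (a0, b0) then l a0 b0 c0 else 0)"
        using ab by auto
    qed
    also have "\<dots> = l a0 b0 c0" using ne by simp
    finally show False using \<open>H c0 = 0\<close> ne by simp
  qed
  define m where "m = (LEAST c. H c \<noteq> 0)"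
  have m: "H m \<noteq> 0" "\<And>c. c < m \<Longrightarrow> H c = 0" "m \<le> c0"
    unfolding m_def using H0 LeastI[of "\<lambda>c. H c \<noteq> 0", OF H0] Least_le[of "\<lambda>c. H c \<noteq> 0", OF H0]
    by (auto dest: not_less_Least)
  have "(\<Sum>c<B. [:1, -1:] ^ (n * c) * H c) = (\<Sum>c\<in>{m..<B}. [:1, -1:] ^ (n * c) * H c)"
    by (rule sum.mono_neutral_right) (use m in auto)
  also have "\<dots> = (\<Sum>c\<in>{m..<B}. [:1, -1:] ^ (n * m) * ([:1, -1:] ^ (n * (c - m)) * H c))"
  proof (rule sum.cong[OF refl])
    fix c assume "c \<in> {m..<B}"
    then have "n * c = n * m + n * (c - m)" by (simp flip: distrib_left)
    then show "[:1, -1:] ^ (n * c) * H c = [:1, -1:] ^ (n * m) * ([:1, -1:] ^ (n * (c - m)) * H c)"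
      by (simp add: power_add mult.assoc)
  qed
  also have "\<dots> = [:1, -1:] ^ (n * m) * (\<Sum>c\<in>{m..<B}. [:1, -1:] ^ (n * (c - m)) * H c)"
    by (simp add: sum_distrib_left)
  finally have "(\<Sum>c\<in>{m..<B}. [:1, -1:] ^ (n * (c - m)) * H c) = 0"
    using * unfolding H_def by simp
  moreover have "(\<Sum>c\<in>{m..<B}. [:1, -1:] ^ (n * (c - m)) * H c)
    = H m + (\<Sum>c\<in>{Suc m..<B}. [:1, -1:] ^ (n * (c - m)) * H c)"
    using m(3) ne(3) by (subst sum.atLeast_Suc_lessThan) auto
  ultimately have Hm: "H m = - (\<Sum>c\<in>{Suc m..<B}. [:1, -1:] ^ (n * (c - m)) * H c)"
    by (simp add: eq_neg_iff_add_eq_0)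
  have "[:1, -1:] ^ n dvd H m"
    unfolding Hm dvd_minus_iff
  proof (intro dvd_sum dvd_mult2 le_imp_power_dvd)
    fix c assume "c \<in> {Suc m..<B}"
    then have "1 \<le> c - m" by auto
    then show "n \<le> n * (c - m)" by (metis mult.right_neutral mult_le_mono2)
  qed
  moreover have "[:-1, 1:] ^ n dvd ([:1, -1:] :: 'a poly) ^ n"
  proof (rule dvd_power_same)
    have "[:1, -1:] = - [:-1, 1::'a:]" by simp
    then show "[:-1, 1::'a:] dvd [:1, -1:]" by (simp only: dvd_minus_iff dvd_refl)
  qed
  ultimately have "[:-1, 1:] ^ n dvd H m" by (rule dvd_trans[rotated])
  moreover have "\<not> [:-1, 1:] ^ n dvd H m"
  proof (rule fewnomial_root_order[OF char m(1)])
    have nz: "coeff (H m) k \<noteq> 0 \<Longrightarrow> k \<in> (\<lambda>(a, b). a + n * b) ` ({..<A} \<times> {..<B})" for k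
      unfolding cH by (erule sum.not_neutral_contains_not_neutral) (auto split: if_splits)
    have "card {i. coeff (H m) i \<noteq> 0} \<le> card ((\<lambda>(a, b). a + n * b) ` ({..<A} \<times> {..<B}))"
      by (rule card_mono) (use nz in auto)
    also have "\<dots> \<le> A * B" using card_image_le[of "{..<A} \<times> {..<B}" "\<lambda>(a, b). a + n * b"] by simp
    finally show "card {i. coeff (H m) i \<noteq> 0} \<le> n" using AB by simp
    have "k < p" if k: "coeff (H m) k \<noteq> 0" for k
    proof -
      obtain a b where "a < A" "b < B" "k = a + n * b" using nz[OF k] by auto
      then have "k < n * Suc b" using An by simp
      also have "\<dots> \<le> n * B" using \<open>b < B\<close> by (intro mult_le_mono2) simp
      finally have "k < n * B" .
      then show ?thesis using nB by simp
    qed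
    then show "degree (H m) < p" using m(1) by (metis leading_coeff_0_iff)
  qed
  ultimately show False by simp
qed

text \<open>The unknowns are the A B^2 coefficients of a combination of X^(a + n b) (1 - X)^(n c).
  Vanishing to order A at all solutions for one \<theta> costs 2 A^2 linear conditions, because on
  these solutions the large powers are constants. Hypothesis \<open>T\<close> says that unknowns
  outnumber conditions; counting zeros with multiplicity against the degree gives the bound.\<close>

lemma stepanov_linear:
  fixes \<Theta> :: "('a::{field,finite} \<times> 'a) set"
  assumes char: "\<And>k. 0 < k \<Longrightarrow> k < p \<Longrightarrow> of_nat k \<noteq> (0::'a)"
    and nz: "\<And>\<theta>. \<theta> \<in> \<Theta> \<Longrightarrow> fst \<theta> \<noteq> 0 \<and> snd \<theta> \<noteq> 0"
    and AB: "A * B \<le> n" and nB: "n * B \<le> p" and A: "A > 0" and n: "n > 0"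
    and T: "2 * card \<Theta> * A < B\<^sup>2"
  shows "A * (\<Sum>\<theta>\<in>\<Theta>. nsols n \<theta>) \<le> 2 * n * B"
proof -
  define Dop where "Dop = (\<lambda>h::'a poly. [:0, 1, -1:] * pderiv h)"
  \<comment> \<open>This is \<open>Dop\<close> conjugated by X^u (1 - X)^v: the logarithmic
    derivative of that factor, times X (1 - X), is u (1 - X) - v X.\<close>
  define Lop where "Lop u v = (\<lambda>h::'a poly. [:0, 1, -1:] * pderiv h + [:u, -u - v:] * h)" for u v
  define R where "R b c k a = (Lop (of_nat (n * b)) (of_nat (n * c)) ^^ k) (monom 1 a)" for b c k a
  define I where "I = {..<A} \<times> {..<B} \<times> {..<B}"
  \<comment> \<open>One condition for each \<theta>, each order of vanishing k, and each coefficient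
    d of the small cofactor \<open>R b c k a\<close>, whose degree is at most \<open>a + k\<close>
    and hence below \<open>2 * A\<close>.\<close>
  define J where "J = \<Theta> \<times> {..<A} \<times> {..<2 * A}"
  define M where "M = (\<lambda>(\<theta>, k, d) (a, b, c). fst \<theta> ^ b * snd \<theta> ^ c * coeff (R b c k a) d)"
  have B: "B > 0" using T by (cases B) auto
  have "card J < card I"
    using T A B unfolding I_def J_def card_cartesian_product
    by (simp add: power2_eq_square)
  then obtain l where l: "\<exists>i\<in>I. l i \<noteq> (0::'a)" "\<And>j. j \<in> J \<Longrightarrow> (\<Sum>i\<in>I. l i * M j i) = 0"
    by (rule nontrivial_solution[of I J M, rotated 2]) (auto simp: I_def J_def)
  define F where "F = (\<Sum>i\<in>I. smult (l i) (case i of (a, b, c) \<Rightarrow>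
     [:0, 1:] ^ (n * b) * [:1, -1:] ^ (n * c) * monom 1 a))"
  have F_eq: "F = (\<Sum>c<B. [:1, -1:] ^ (n * c) * (\<Sum>b<B. \<Sum>a<A. monom (l (a, b, c)) (a + n * b)))"
  proof -
    have "F = (\<Sum>a<A. \<Sum>b<B. \<Sum>c<B. smult (l (a, b, c)) ([:0, 1:] ^ (n * b) * [:1, -1:] ^ (n * c) * monom 1 a))"
      unfolding F_def I_def sum.cartesian_product by (intro sum.cong) auto
    also have "\<dots> = (\<Sum>a<A. \<Sum>b<B. \<Sum>c<B. [:1, -1:] ^ (n * c) * monom (l (a, b, c)) (a + n * b))"
    proof (intro sum.cong refl)
      fix a b c
      have "[:0, 1:] ^ (n * b) = (monom 1 (n * b) :: 'a poly)"
        by (simp add: monom_altdef)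
      moreover have "monom (l (a, b, c)) (a + n * b) = smult (l (a, b, c)) (monom 1 (n * b) * monom 1 a)"
        by (simp add: mult_monom smult_monom add.commute)
      ultimately show "smult (l (a, b, c)) ([:0, 1:] ^ (n * b) * [:1, -1:] ^ (n * c) * monom 1 a)
        = [:1, -1:] ^ (n * c) * monom (l (a, b, c)) (a + n * b)"
        by (simp add: mult.left_commute mult.assoc)
    qed
    also have "\<dots> = (\<Sum>b<B. \<Sum>a<A. \<Sum>c<B. [:1, -1:] ^ (n * c) * monom (l (a, b, c)) (a + n * b))"
      by (rule sum.swap)
    also have "\<dots> = (\<Sum>b<B. \<Sum>c<B. \<Sum>a<A. [:1, -1:] ^ (n * c) * monom (l (a, b, c)) (a + n * b))"
      by (intro sum.cong refl sum.swap)
    also have "\<dots> = (\<Sum>c<B. \<Sum>b<B. \<Sum>a<A. [:1, -1:] ^ (n * c) * monom (l (a, b, c)) (a + n * b))"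
      by (rule sum.swap)
    finally show ?thesis by (simp add: sum_distrib_left)
  qed
  have F0: "F \<noteq> 0"
  proof -
    obtain a0 b0 c0 where "a0 < A" "b0 < B" "c0 < B" "l (a0, b0, c0) \<noteq> 0"
      using l(1) by (auto simp: I_def)
    then show ?thesis unfolding F_eq
      by (intro auxiliary_nonzero[OF char AB nB, of a0 b0 c0 "\<lambda>a b c. l (a, b, c)"]) auto
  qed
  have An: "A \<le> n" using AB B by (metis le_trans mult.right_neutral mult_le_mono2 One_nat_def Suc_leI)
  have degF: "degree F \<le> 2 * n * B"
    unfolding F_def
  proof (rule degree_sum_le)
    fix i assume "i \<in> I"
    then obtain a b c where i: "i = (a, b, c)" "a < A" "b < B" "c < B" by (auto simp: I_def)
    have "degree (smult (l i) ([:0, 1:] ^ (n * b) * [:1, -1:] ^ (n * c) * monom 1 a)) \<le> n * b + n * c + a"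
      by (intro order.trans[OF degree_smult_le] order.trans[OF degree_mult_le] add_mono
          order.trans[OF degree_power_le] degree_monom_le) auto
    also have "\<dots> \<le> n * b + n * c + n" using i An by simp
    also have "\<dots> \<le> n * B + n * B"
    proof -
      have "n * Suc b \<le> n * B" "n * c \<le> n * B" using i by (intro mult_le_mono2; simp)+
      then show ?thesis unfolding mult_Suc_right by linarith
    qed
    finally show "degree (smult (l i) (case i of (a, b, c) \<Rightarrow>
       [:0, 1:] ^ (n * b) * [:1, -1:] ^ (n * c) * monom 1 a)) \<le> 2 * n * B"
      using i by simp
  qed (simp add: I_def)
  have Dadd: "(Dop ^^ k) (\<Sum>i\<in>I. smult (l i) (g i)) = (\<Sum>i\<in>I. smult (l i) ((Dop ^^ k) (g i)))" for k g
  proof (induction k arbitrary: g)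
    case (Suc k)
    have "Dop (\<Sum>i\<in>I. smult (l i) (g i)) = (\<Sum>i\<in>I. smult (l i) (Dop (g i)))"
      unfolding Dop_def
      by (subst higher_pderiv_sum[where n = 1, simplified]) (simp add: pderiv_smult sum_distrib_left mult_smult_right del: mult_pCons_left)
    then show ?case using Suc.IH[of "\<lambda>i. Dop (g i)"] by (simp only: funpow_Suc_right o_apply)
  qed simp
  have step: "Dop ([:0, 1:] ^ s * [:1, -1:] ^ t * h) = [:0, 1:] ^ s * [:1, -1:] ^ t * Lop (of_nat s) (of_nat t) h" for s t h
  proof -
    define X where "X = [:0, 1::'a:]"
    define Y where "Y = [:1, -1::'a:]"
    have dX: "pderiv X = 1" and dY: "pderiv Y = -1" by (auto simp: X_def Y_def pderiv_pCons one_pCons)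
    have pX: "X * pderiv (X ^ s) = smult (of_nat s) (X ^ s)"
    proof (cases s)
      case (Suc k)
      show ?thesis unfolding Suc pderiv_power_Suc dX by (simp del: of_nat_Suc)
    qed simp
    have pY: "Y * pderiv (Y ^ t) = smult (- of_nat t) (Y ^ t)"
    proof (cases t)
      case (Suc k)
      show ?thesis unfolding Suc pderiv_power_Suc dY by (simp del: of_nat_Suc)
    qed simp
    have e1: "[:0, 1, -1:] = X * Y" by (simp add: X_def Y_def)
    have e2: "[:of_nat s, - of_nat s - of_nat t:] = smult (of_nat s) Y - smult (of_nat t) X"
      by (simp add: X_def Y_def)
    have "X * Y * pderiv (X ^ s * Y ^ t * h)
      = (X * pderiv (X ^ s)) * Y * Y ^ t * h + X * X ^ s * (Y * pderiv (Y ^ t)) * h + X ^ s * Y ^ t * (X * Y * pderiv h)"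
      unfolding pderiv_mult by (simp only: algebra_simps)
    also have "\<dots> = X ^ s * Y ^ t * (X * Y * pderiv h + (smult (of_nat s) Y - smult (of_nat t) X) * h)"
      unfolding pX pY by (simp add: algebra_simps)
    finally show ?thesis unfolding Dop_def Lop_def e1 e2 by (simp add: X_def Y_def)
  qed
  have iter: "(Dop ^^ k) ([:0, 1:] ^ s * [:1, -1:] ^ t * h)
    = [:0, 1:] ^ s * [:1, -1:] ^ t * (Lop (of_nat s) (of_nat t) ^^ k) h" for k s t h
    by (induction k) (simp_all only: funpow.simps o_apply id_apply step)
  have degR: "degree (R b c k a) \<le> a + k" for a b c k
  proof (induction k)
    case 0 show ?case by (simp add: R_def degree_monom_le)
  next
    case (Suc k)
    define h where "h = R b c k a"
    have "degree ([:0, 1, -1:] * pderiv h) \<le> Suc (a + k)"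
    proof (cases "pderiv h = 0")
      case False
      then have "degree h \<noteq> 0" by (metis degree_eq_zeroE pderiv_0 pderiv_pCons pCons_0_0 add_0)
      moreover have "degree (pderiv h) \<le> degree h - 1"
        by (rule degree_le) (auto simp: coeff_pderiv coeff_eq_0)
      ultimately have "degree (pderiv h) < degree h" by simp
      moreover have "degree ([:0, 1, -1:] * pderiv h) \<le> 2 + degree (pderiv h)"
        by (rule order.trans[OF degree_mult_le]) simp
      ultimately show ?thesis using Suc by (simp add: h_def)
    qed simp
    moreover have "degree ([:u, v:] * h) \<le> Suc (a + k)" for u v :: 'a
    proof -
      have "degree [:u, v:] \<le> 1" by simp
      then show ?thesis using Suc degree_mult_le[of "[:u, v:]" h] unfolding h_def by linarith
    qed
    ultimately have "degree (Lop (of_nat (n * b)) (of_nat (n * c)) h) \<le> Suc (a + k)"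
      unfolding Lop_def by (rule degree_add_le)
    then show ?case by (simp add: R_def h_def)
  qed
  have van: "poly ((Dop ^^ k) F) x = 0" if \<theta>: "\<theta> \<in> \<Theta>" and x: "x \<in> sols n \<theta>" and k: "k < A" for x k \<theta>
  proof -
    have xx: "x ^ n = fst \<theta>" "(1 - x) ^ n = snd \<theta>" using x by (auto simp: sols_def)
    have "poly ((Dop ^^ k) F) x =
      (\<Sum>i\<in>I. l i * (case i of (a, b, c) \<Rightarrow> fst \<theta> ^ b * snd \<theta> ^ c * poly (R b c k a) x))"
      unfolding F_def Dadd poly_sum
    proof (intro sum.cong refl)
      fix i assume "i \<in> I"
      obtain a b c where i: "i = (a, b, c)" by (cases i)
      show "poly (smult (l i) ((Dop ^^ k) (case i of (a, b, c) \<Rightarrow> [:0, 1:] ^ (n * b) * [:1, -1:] ^ (n * c) * monom 1 a))) x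
        = l i * (case i of (a, b, c) \<Rightarrow> fst \<theta> ^ b * snd \<theta> ^ c * poly (R b c k a) x)"
        unfolding i prod.case iter R_def by (simp add: power_mult flip: xx)
    qed
    also have "\<dots> = (\<Sum>i\<in>I. \<Sum>d<2 * A. x ^ d * (l i * M (\<theta>, k, d) i))"
    proof (intro sum.cong refl)
      fix i assume "i \<in> I"
      then obtain a b c where i: "i = (a, b, c)" "a < A" by (auto simp: I_def)
      have "poly (R b c k a) x = (\<Sum>d<2 * A. coeff (R b c k a) d * x ^ d)"
        unfolding poly_altdef
        by (rule sum.mono_neutral_left) (use degR[of b c k a] i k in \<open>auto simp: coeff_eq_0\<close>)
      then show "l i * (case i of (a, b, c) \<Rightarrow> fst \<theta> ^ b * snd \<theta> ^ c * poly (R b c k a) x)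
        = (\<Sum>d<2 * A. x ^ d * (l i * M (\<theta>, k, d) i))"
        unfolding i M_def by (simp add: sum_distrib_left mult_ac)
    qed
    also have "\<dots> = (\<Sum>d<2 * A. x ^ d * (\<Sum>i\<in>I. l i * M (\<theta>, k, d) i))"
      by (subst sum.swap) (simp add: sum_distrib_left)
    also have "\<dots> = 0" using l(2) \<theta> k by (intro sum.neutral) (auto simp: J_def)
    finally show ?thesis .
  qed
  define Z where "Z = (\<Union>\<theta>\<in>\<Theta>. sols n \<theta>)"
  have Ap: "A \<le> p" using An nB B by (metis le_trans mult.right_neutral mult_le_mono2 One_nat_def Suc_leI)
  have ord: "A \<le> order x F" if "x \<in> Z" for x
  proof -
    obtain \<theta> where \<theta>: "\<theta> \<in> \<Theta>" "x \<in> sols n \<theta>" using \<open>x \<in> Z\<close> by (auto simp: Z_def)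
    then have "x \<noteq> 0" "x \<noteq> 1" using nz[of \<theta>] n by (auto simp: sols_def zero_power)
    then have "[:-x, 1:] ^ A dvd F"
      using van[OF \<theta>] by (intro root_order_by_operator[OF char _ _ Ap]) (auto simp: Dop_def simp del: mult_pCons_left)
    then show ?thesis using F0 order_divides by blast
  qed
  have "card Z = (\<Sum>\<theta>\<in>\<Theta>. nsols n \<theta>)"
    unfolding Z_def nsols_def by (rule card_UN_disjoint) (auto simp: sols_def prod_eq_iff)
  then have "A * (\<Sum>\<theta>\<in>\<Theta>. nsols n \<theta>) = (\<Sum>x\<in>Z. A)" by simp
  also have "\<dots> \<le> (\<Sum>x\<in>Z. order x F)" by (rule sum_mono) (rule ord)
  also have "\<dots> \<le> (\<Sum>x | poly F x = 0. order x F)"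
  proof (rule sum_mono2)
    show "Z \<subseteq> {x. poly F x = 0}" using ord A F0 by (force simp: order_root)
  qed auto
  also have "\<dots> \<le> degree F" by (rule sum_order_le_degree) (rule F0)
  finally show ?thesis using degF by simp
qed

text \<open>The choice \<open>A = n div B\<close> is the largest order with
  \<open>A * B \<le> n\<close>. Rounding loses a factor of at most 2, so the linear bound 2 n B / A
  becomes 4 B^2, with B of size (n T)^(1/3).\<close>

theorem stepanov:
  fixes \<Theta> :: "('a::{field,finite} \<times> 'a) set"
  assumes char: "\<And>k. 0 < k \<Longrightarrow> k < p \<Longrightarrow> of_nat k \<noteq> (0::'a)"
    and nz: "\<And>\<theta>. \<theta> \<in> \<Theta> \<Longrightarrow> fst \<theta> \<noteq> 0 \<and> snd \<theta> \<noteq> 0"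
    and T: "2 * card \<Theta> * n < B ^ 3" and Bn: "B \<le> n" and nB: "n * B \<le> p"
  shows "(\<Sum>\<theta>\<in>\<Theta>. nsols n \<theta>) \<le> 4 * B\<^sup>2"
proof -
  define A where "A = n div B"
  have B: "B > 0" using T by (cases B) auto
  have A: "A > 0" using B Bn by (simp add: A_def div_greater_zero_iff)
  have AB: "A * B \<le> n" by (simp add: A_def)
  have "n < (A + 1) * B" using B by (simp add: A_def dividend_less_div_times)
  also have "\<dots> \<le> 2 * A * B" using A by simp
  finally have nAB: "n \<le> 2 * A * B" by simp
  have "2 * card \<Theta> * A * B \<le> 2 * card \<Theta> * n" using AB by (simp add: mult.assoc)
  also have "\<dots> < B\<^sup>2 * B" using T by (simp add: power2_eq_square power3_eq_cube)
  finally have "2 * card \<Theta> * A < B\<^sup>2" by simp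
  then have "A * (\<Sum>\<theta>\<in>\<Theta>. nsols n \<theta>) \<le> 2 * n * B"
    using A B Bn by (intro stepanov_linear[OF char nz AB nB A]) auto
  also have "\<dots> \<le> 2 * (2 * A * B) * B" using nAB by simp
  also have "\<dots> = A * (4 * B\<^sup>2)" by (simp add: power2_eq_square)
  finally show ?thesis using A by simp
qed

section \<open>Level sets of the number of solutions\<close>

lemma sum_inverse_squares_le:
  assumes "0 < m"
  shows "(\<Sum>k\<in>{m<..M}. 1 / (real k)\<^sup>2) \<le> 1 / real m"
proof (cases "m \<le> M")
  case True
  have "(\<Sum>k\<in>{m<..m + d}. 1 / (real k)\<^sup>2) \<le> 1 / real m - 1 / real (m + d)" for d
  proof (induction d)
    case (Suc d)
    have "{m<..m + Suc d} = insert (m + Suc d) {m<..m + d}" by auto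
    moreover have "1 / (real (m + Suc d))\<^sup>2 \<le> 1 / real (m + d) - 1 / real (m + Suc d)"
    proof -
      define x where "x = real (m + d)"
      have x: "x > 0" using assms by (simp add: x_def)
      have "1 / (x + 1)\<^sup>2 \<le> 1 / (x * (x + 1))"
        using x by (intro divide_left_mono) (auto simp: power2_eq_square)
      also have "\<dots> = 1 / x - 1 / (x + 1)" using x by (simp add: field_simps)
      finally show ?thesis by (simp add: x_def add_ac)
    qed
    ultimately show ?case using Suc by simp
  qed simp
  from this[of "M - m"] True show ?thesis by (simp add: field_simps) (smt (verit) divide_nonneg_nonneg of_nat_0_le_iff)
qed simp

lemma layer_cake:
  fixes F :: "'b \<Rightarrow> nat" and w :: "nat \<Rightarrow> real"
  assumes "finite A" "\<And>a. a \<in> A \<Longrightarrow> F a \<le> M"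
  shows "(\<Sum>a\<in>A. \<Sum>k\<in>{m<..F a}. w k) = (\<Sum>k\<in>{m<..M}. w k * card {a\<in>A. k \<le> F a})"
proof -
  have "(\<Sum>a\<in>A. \<Sum>k\<in>{m<..F a}. w k) = (\<Sum>a\<in>A. \<Sum>k\<in>{m<..M}. if k \<le> F a then w k else 0)"
  proof (rule sum.cong[OF refl])
    fix a assume "a \<in> A"
    then have "{m<..F a} = {k \<in> {m<..M}. k \<le> F a}" using assms(2)[of a] by auto
    then show "(\<Sum>k\<in>{m<..F a}. w k) = (\<Sum>k\<in>{m<..M}. if k \<le> F a then w k else 0)"
      by (simp add: sum.If_cases Int_def)
  qed
  also have "\<dots> = (\<Sum>k\<in>{m<..M}. \<Sum>a\<in>A. if k \<le> F a then w k else 0)" by (rule sum.swap)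
  finally show ?thesis using assms(1) by (simp add: sum.If_cases Int_def mult.commute)
qed

text \<open>Summation by parts: the squares up to the cutoff m contribute at most m^2 c / m^3, and
  every height j above it contributes 2 j c / j^3, a convergent series with tail 2 c / m.\<close>

lemma square_tail_le:
  fixes F :: "'b \<Rightarrow> nat" and c :: real
  assumes fin: "finite A" and m: "0 < m"
    and level: "\<And>k. m < k \<Longrightarrow> (real k) ^ 3 * card {a\<in>A. k \<le> F a} \<le> c"
  shows "(\<Sum>a | a \<in> A \<and> m < F a. (real (F a))\<^sup>2) \<le> 3 * c / m"
proof -
  define A' where "A' = {a\<in>A. m < F a}"
  have finA': "finite A'" using fin by (simp add: A'_def)
  define M where "M = Max (insert 0 (F ` A'))"
  have M: "F a \<le> M" if "a \<in> A'" for a unfolding M_def using finA' that by (intro Max_ge) auto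
  have sq: "(real k)\<^sup>2 \<le> (real m)\<^sup>2 + (\<Sum>j\<in>{m<..k}. 2 * real j)" if "m \<le> k" for k
    using that
  proof (induction rule: dec_induct)
    case (step k)
    then have "{m<..Suc k} = insert (Suc k) {m<..k}" by auto
    then show ?case using step by (simp add: power2_eq_square algebra_simps)
  qed simp
  have c0: "c \<ge> 0" by (rule order.trans[OF _ level[of "Suc m"]]) auto
  have cA: "card {a\<in>A'. k \<le> F a} \<le> c / (real k) ^ 3" if "m < k" for k
  proof -
    have "{a\<in>A'. k \<le> F a} = {a\<in>A. k \<le> F a}" using that by (auto simp: A'_def)
    then show ?thesis using level[OF that] m that by (simp add: field_simps)
  qed
  have "(\<Sum>a\<in>A'. (real (F a))\<^sup>2) \<le> (\<Sum>a\<in>A'. (real m)\<^sup>2 + (\<Sum>j\<in>{m<..F a}. 2 * real j))"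
    by (intro sum_mono sq) (auto simp: A'_def)
  also have "\<dots> = (real m)\<^sup>2 * card A' + (\<Sum>k\<in>{m<..M}. 2 * real k * card {a\<in>A'. k \<le> F a})"
    by (simp add: sum.distrib layer_cake[OF finA' M])
  also have "(real m)\<^sup>2 * card A' \<le> c / m"
  proof -
    have "{a\<in>A'. Suc m \<le> F a} = A'" by (auto simp: A'_def)
    then have "(real m)\<^sup>2 * card A' \<le> (real m)\<^sup>2 * (c / (real (Suc m)) ^ 3)"
      using cA[of "Suc m"] by (intro mult_left_mono) auto
    also have "\<dots> \<le> (real m)\<^sup>2 * (c / (real m) ^ 3)"
      using m c0 by (intro mult_left_mono divide_left_mono power_mono) auto
    also have "\<dots> = c / m" using m by (simp add: field_simps power2_eq_square power3_eq_cube)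
    finally show ?thesis .
  qed
  also have "(\<Sum>k\<in>{m<..M}. 2 * real k * card {a\<in>A'. k \<le> F a}) \<le> (\<Sum>k\<in>{m<..M}. 2 * c * (1 / (real k)\<^sup>2))"
  proof (rule sum_mono)
    fix k assume k: "k \<in> {m<..M}"
    then have "2 * real k * card {a\<in>A'. k \<le> F a} \<le> 2 * real k * (c / (real k) ^ 3)"
      using cA[of k] by (intro mult_left_mono) auto
    also have "\<dots> = 2 * c * (1 / (real k)\<^sup>2)" using k by (simp add: field_simps power2_eq_square power3_eq_cube)
    finally show "2 * real k * card {a\<in>A'. k \<le> F a} \<le> 2 * c * (1 / (real k)\<^sup>2)" .
  qed
  also have "\<dots> \<le> 2 * c * (1 / m)"
    unfolding sum_distrib_left[symmetric] using sum_inverse_squares_le[OF m] c0 by (intro mult_left_mono) auto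
  finally show ?thesis by (simp add: A'_def)
qed

lemma cube_le_square:
  fixes n p :: nat
  assumes "0 < n" "n\<^sup>2 \<le> p"
  shows "n ^ 3 \<le> p\<^sup>2"
proof -
  have "n ^ 3 \<le> n ^ 4" using assms(1) by (intro power_increasing) auto
  also have "\<dots> = (n\<^sup>2)\<^sup>2" by (simp flip: power_mult)
  also have "\<dots> \<le> p\<^sup>2" using assms(2) by (rule power_mono) simp
  finally show ?thesis .
qed

text \<open>Describing the subgroup as all n-th roots of unity turns a coset into a single field
  element, the n-th power of its members. That all positive integers below the order of the field
  are nonzero in it confines the locale to prime fields, as the arguments with derivatives
  require.\<close>

locale power_subgroup =
  fixes G :: "'a::{field,finite} set" and n p :: nat
  assumes p_card: "p = CARD('a)" and char: "\<And>k. 0 < k \<Longrightarrow> k < p \<Longrightarrow> of_nat k \<noteq> (0::'a)"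
    and G_def: "G = {x. x ^ n = 1}" and card_G: "card G = n" and n_pos: "0 < n"
begin

text \<open>Up to a constant, the average of \<^term>\<open>nsols n\<close> if \<open>n > sqrt p\<close>; no level set below it is controlled.\<close>

definition \<kappa> :: real where "\<kappa> = max 1 ((real n)\<^sup>2 / real p)"

lemma kappa_ge: "1 \<le> \<kappa>" "(real n)\<^sup>2 / real p \<le> \<kappa>" by (auto simp: \<kappa>_def)

lemma p_pos: "0 < p" by (simp add: p_card)

lemma small_subgroup:
  assumes "n\<^sup>2 \<le> p"
  shows "n ^ 3 \<le> p\<^sup>2" "\<kappa> = 1"
proof -
  show "n ^ 3 \<le> p\<^sup>2" using n_pos assms by (rule cube_le_square)
  have "real (n\<^sup>2) \<le> real p" using assms by (simp only: of_nat_le_iff)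
  then show "\<kappa> = 1" using p_pos by (simp add: \<kappa>_def max_def field_simps)
qed

lemma n_le_p: "n \<le> p" unfolding card_G[symmetric] p_card by (rule card_mono) auto

lemma zero_notin_G: "0 \<notin> G"
  using n_pos by (auto simp: G_def zero_power)

lemma nonzero_G: "x \<in> G \<Longrightarrow> x \<noteq> 0" using zero_notin_G by auto

lemma mult_G: "x \<in> G \<Longrightarrow> y \<in> G \<Longrightarrow> x * y \<in> G" by (auto simp: G_def power_mult_distrib)

lemma inverse_G: "x \<in> G \<Longrightarrow> inverse x \<in> G" by (auto simp: G_def power_inverse)

lemma power_eq_coset: "x \<noteq> 0 \<Longrightarrow> {y. y ^ n = x ^ n} = (\<lambda>g. g * x) ` G"
proof safe
  fix y assume x: "x \<noteq> 0" and y: "y ^ n = x ^ n"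
  then have "y / x \<in> G" by (simp add: G_def power_divide)
  then show "y \<in> (\<lambda>g. g * x) ` G" using x by (intro image_eqI[of _ _ "y / x"]) auto
qed (auto simp: G_def power_mult_distrib)

lemma card_power_fibre:
  fixes x :: 'a
  assumes "x \<noteq> 0"
  shows "card {y. y ^ n = x ^ n} = n"
  unfolding power_eq_coset[OF assms] using assms by (subst card_image) (auto simp: inj_on_def card_G)

lemma card_power_fibre_le: "a \<noteq> 0 \<Longrightarrow> card {y::'a. y ^ n = a} \<le> n"
proof (cases "{y. y ^ n = a} = {}")
  case False
  moreover assume "a \<noteq> 0"
  ultimately obtain x where "x ^ n = a" "a \<noteq> 0" by auto
  moreover from this have "x \<noteq> 0" using n_pos by (auto simp: power_0_left)
  ultimately show ?thesis using card_power_fibre[of x] by simp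
qed simp

lemma bij_betw_mult_G: "g \<in> G \<Longrightarrow> bij_betw (\<lambda>x. g * x) G G"
  by (rule bij_betw_byWitness[where f' = "\<lambda>x. inverse g * x"])
     (auto simp: mult_G inverse_G nonzero_G)

definition nz :: "('a \<times> 'a) set" where "nz = {\<theta>. fst \<theta> \<noteq> 0 \<and> snd \<theta> \<noteq> 0}"

lemma nsols_le_n: "\<theta> \<in> nz \<Longrightarrow> nsols n \<theta> \<le> n"
  unfolding nsols_def sols_def nz_def
  by (rule order.trans[OF card_mono card_power_fibre_le[of "fst \<theta>"]]) auto

text \<open>Stepanov's method is applied with the least admissible B, for which B^3 is comparable to
  n T. The two size conditions on T are precisely B \<le> n and n B \<le> p after cubing. Then \<nu>
  T \<le> 4 B^2 is cubed and T^2 cancelled; the constant is 64 * 16^2.\<close>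

lemma level_card_le_small:
  assumes "\<Theta> \<subseteq> nz" "\<And>\<theta>. \<theta> \<in> \<Theta> \<Longrightarrow> \<nu> \<le> nsols n \<theta>"
    and T1: "16 * card \<Theta> \<le> n\<^sup>2" and T2: "16 * card \<Theta> * n ^ 4 \<le> p ^ 3"
  shows "\<nu> ^ 3 * card \<Theta> \<le> 2 ^ 14 * n\<^sup>2"
proof (cases "card \<Theta> = 0")
  case False
  define T where "T = card \<Theta>"
  have T: "T > 0" using False unfolding T_def by (simp only: neq0_conv)
  define B where "B = (LEAST B. 2 * T * n < B ^ 3)"
  have "2 * T * n < (2 * T * n + 1) ^ 3"
    by (rule order.strict_trans2[of _ "2 * T * n + 1"]) (auto intro: self_le_power)
  then have B: "2 * T * n < B ^ 3" unfolding B_def by (rule LeastI)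
  have "B \<noteq> 0" using B by (intro notI) simp
  then have B': "(B - 1) ^ 3 \<le> 2 * T * n"
    using not_less_Least[of "B - 1" "\<lambda>B. 2 * T * n < B ^ 3"] unfolding B_def[symmetric] by simp
  \<comment> \<open>Minimality bounds only \<open>B - 1\<close>; since B is at least 2, passing to B
    costs a factor 8 after cubing, which turns 2 into 16.\<close>
  have "B \<noteq> 1" using B T n_pos by (intro notI) auto
  then have "B \<le> 2 * (B - 1)" using \<open>B \<noteq> 0\<close> by simp
  then have "B ^ 3 \<le> (2 * (B - 1)) ^ 3" by (rule power_mono) simp
  also have "\<dots> \<le> 16 * T * n" using B' by (simp add: power_mult_distrib)
  finally have B3: "B ^ 3 \<le> 16 * T * n" .
  have "B ^ 3 \<le> n ^ 3"
    using B3 mult_le_mono1[OF T1, of n] unfolding T_def[symmetric] power2_eq_square power3_eq_cube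
    by linarith
  then have Bn: "B \<le> n" by (simp add: power_mono_iff)
  have "(n * B) ^ 3 \<le> n ^ 3 * (16 * T * n)" using B3 by (simp add: power_mult_distrib)
  also have "\<dots> \<le> p ^ 3" using T2 by (simp add: T_def power_numeral_reduce algebra_simps)
  finally have nB: "n * B \<le> p" by (simp add: power_mono_iff)
  have "\<nu> * T = (\<Sum>\<theta>\<in>\<Theta>. \<nu>)" by (simp add: T_def)
  also have "\<dots> \<le> (\<Sum>\<theta>\<in>\<Theta>. nsols n \<theta>)" by (rule sum_mono) (use assms in auto)
  also have "\<dots> \<le> 4 * B\<^sup>2"
    using assms(1) by (intro stepanov[OF char _ B[unfolded T_def] Bn nB]) (auto simp: nz_def)
  finally have "(\<nu> * T) ^ 3 \<le> (4 * B\<^sup>2) ^ 3" by (rule power_mono) simp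
  also have "\<dots> = 64 * (B ^ 3)\<^sup>2" by (simp add: power_mult_distrib flip: power_mult)
  also have "\<dots> \<le> 64 * (16 * T * n)\<^sup>2" using B3 by (intro mult_le_mono2 power_mono) auto
  also have "\<dots> = T\<^sup>2 * (2 ^ 14 * n\<^sup>2)" by (simp add: power_mult_distrib)
  finally have "T\<^sup>2 * (\<nu> ^ 3 * T) \<le> T\<^sup>2 * (2 ^ 14 * n\<^sup>2)"
    by (simp add: power_mult_distrib power2_eq_square power3_eq_cube algebra_simps)
  then show ?thesis using T by (simp add: T_def)
qed simp

text \<open>The bound for small families holds up to \<open>T0\<close> elements. A level set with
  more elements would contain a subfamily of exactly \<open>T0\<close> elements whose multiplicities
  are too large for that bound, because \<nu> is far above \<kappa>. If \<open>T0\<close> is zero,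
  then 4096 \<kappa> already exceeds n and the level set is empty.\<close>

lemma level_card_le:
  assumes np: "n ^ 3 \<le> p\<^sup>2" and \<nu>: "4096 * \<kappa> \<le> real \<nu>"
  shows "real \<nu> ^ 3 * card {\<theta> \<in> nz. \<nu> \<le> nsols n \<theta>} \<le> 2 ^ 14 * (real n)\<^sup>2"
proof -
  define \<Theta> where "\<Theta> = {\<theta> \<in> nz. \<nu> \<le> nsols n \<theta>}"
  define T0 where "T0 = nat \<lfloor>(real n)\<^sup>2 / (16 * \<kappa> ^ 3)\<rfloor>"
  have k0: "\<kappa> > 0" using kappa_ge by linarith
  have T0: "real T0 \<le> (real n)\<^sup>2 / (16 * \<kappa> ^ 3)" unfolding T0_def using k0 by simp
  then have T0': "16 * real T0 * \<kappa> ^ 3 \<le> (real n)\<^sup>2" using k0 by (simp add: field_simps)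
  have small: "real \<nu> ^ 3 * card \<Psi> \<le> 2 ^ 14 * (real n)\<^sup>2"
    if "\<Psi> \<subseteq> \<Theta>" "card \<Psi> \<le> T0" for \<Psi>
  proof -
    have a: "16 * real (card \<Psi>) * \<kappa> ^ 3 \<le> (real n)\<^sup>2"
      using T0' that(2) k0 by (smt (verit) mult_right_mono of_nat_mono zero_le_power)
    have "16 * real (card \<Psi>) * 1 \<le> 16 * real (card \<Psi>) * \<kappa> ^ 3"
      using kappa_ge by (intro mult_left_mono) auto
    then have "real (16 * card \<Psi>) \<le> real (n\<^sup>2)" using a by simp
    then have t1: "16 * card \<Psi> \<le> n\<^sup>2" by (simp only: of_nat_le_iff)
    have "(real n)\<^sup>2 \<le> \<kappa> * p" using kappa_ge(2) p_pos by (simp add: field_simps)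
    then have "((real n)\<^sup>2) ^ 3 \<le> (\<kappa> * p) ^ 3" by (rule power_mono) simp
    then have "16 * real (card \<Psi>) * ((real n)\<^sup>2) ^ 3 \<le> 16 * real (card \<Psi>) * (\<kappa> * p) ^ 3"
      by (rule mult_left_mono) simp
    also have "\<dots> \<le> (real n)\<^sup>2 * p ^ 3"
      using mult_right_mono[OF a, of "real p ^ 3"] by (simp add: power_mult_distrib algebra_simps)
    finally have "(real n)\<^sup>2 * (16 * real (card \<Psi>) * real n ^ 4) \<le> (real n)\<^sup>2 * p ^ 3"
      by (simp add: algebra_simps flip: power_mult power_add)
    then have "real (16 * card \<Psi> * n ^ 4) \<le> real (p ^ 3)" using n_pos by simp
    then have t2: "16 * card \<Psi> * n ^ 4 \<le> p ^ 3" by (simp only: of_nat_le_iff)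
    have "\<nu> ^ 3 * card \<Psi> \<le> 2 ^ 14 * n\<^sup>2"
      by (rule level_card_le_small[OF _ _ t1 t2]) (use that in \<open>auto simp: \<Theta>_def\<close>)
    then have "real (\<nu> ^ 3 * card \<Psi>) \<le> real (2 ^ 14 * n\<^sup>2)" by (simp only: of_nat_le_iff)
    then show ?thesis by simp
  qed
  have "card \<Theta> \<le> T0"
  proof (rule ccontr)
    assume T: "\<not> card \<Theta> \<le> T0"
    show False
    proof (cases "T0 = 0")
      case False
      obtain \<Psi> where \<Psi>: "\<Psi> \<subseteq> \<Theta>" "card \<Psi> = T0" using T by (meson nat_le_linear obtain_subset_with_card_n)
      have "(real n)\<^sup>2 / (16 * \<kappa> ^ 3) \<le> 2 * real T0"
        using False unfolding T0_def by linarith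
      then have "(real n)\<^sup>2 \<le> 32 * real T0 * \<kappa> ^ 3" using k0 by (simp add: field_simps)
      moreover have "real \<nu> ^ 3 * real T0 \<le> 2 ^ 14 * (real n)\<^sup>2" using small[OF \<Psi>(1)] \<Psi>(2) by simp
      moreover have "(4096 * \<kappa>) ^ 3 * real T0 \<le> real \<nu> ^ 3 * real T0"
        using \<nu> k0 by (intro mult_right_mono power_mono) auto
      moreover have "2 ^ 14 * (real n)\<^sup>2 \<le> 2 ^ 14 * (32 * real T0 * \<kappa> ^ 3)"
        using calculation(1) by (rule mult_left_mono) simp
      ultimately have "(4096 * \<kappa>) ^ 3 * real T0 \<le> 2 ^ 14 * (32 * real T0 * \<kappa> ^ 3)"
        by (meson order.trans)
      then have "(4096 ^ 3 - 2 ^ 19) * (\<kappa> ^ 3 * real T0) \<le> 0" by (simp add: power_mult_distrib algebra_simps)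
      moreover have "\<kappa> ^ 3 * real T0 > 0" using k0 False by simp
      ultimately show False by (simp add: mult.commute)
    next
      case True
      have "(real n)\<^sup>2 / (16 * \<kappa> ^ 3) < 1"
      proof (rule ccontr)
        assume "\<not> ?thesis"
        then have "1 \<le> \<lfloor>(real n)\<^sup>2 / (16 * \<kappa> ^ 3)\<rfloor>" by (simp only: one_le_floor not_less)
        then show False using True unfolding T0_def by simp
      qed
      then have nk: "(real n)\<^sup>2 < 16 * \<kappa> ^ 3" using k0 by (simp add: field_simps)
      have "real n < 4096 * \<kappa>"
      proof (cases "\<kappa> = 1")
        case True
        then have "(real n)\<^sup>2 < 4\<^sup>2" using nk by simp
        then have "real n < 4" by (rule power_less_imp_less_base) simp
        then show ?thesis using True by simp
      next
        case False
        then have k: "\<kappa> = (real n)\<^sup>2 / real p" unfolding \<kappa>_def by (simp add: max_def split: if_splits)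
        have "(real n)\<^sup>2 * real p ^ 3 < 16 * ((real n)\<^sup>2) ^ 3"
          using nk p_pos unfolding k by (simp add: power_divide field_simps)
        then have "(real n)\<^sup>2 * real p ^ 3 < (real n)\<^sup>2 * (16 * real n ^ 4)"
          by (simp add: algebra_simps flip: power_mult power_add)
        then have "real p ^ 3 < 16 * real n ^ 4" using n_pos by simp
        \<comment> \<open>Cubing makes \<open>n ^ 3 \<le> p\<^sup>2\<close> applicable: p^9 < 16^3
          n^12 \<le> 16^3 p^8, hence p < 16^3. This is the origin of the threshold 4096.\<close>
        then have "(real p ^ 3) ^ 3 < (16 * real n ^ 4) ^ 3" by (rule power_strict_mono) auto
        also have "\<dots> = 4096 * (real n ^ 3) ^ 4" by (simp add: power_mult_distrib flip: power_mult)
        also have "\<dots> \<le> 4096 * ((real p)\<^sup>2) ^ 4"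
        proof -
          have "real (n ^ 3) \<le> real (p\<^sup>2)" using np by (simp only: of_nat_le_iff)
          then show ?thesis by (intro mult_left_mono power_mono) auto
        qed
        finally have "real p ^ 8 * real p < real p ^ 8 * 4096"
          by (simp add: power_numeral_reduce algebra_simps)
        then have "real p < 4096" by (rule mult_left_less_imp_less) simp
        then have "real n < 4096" using n_le_p by linarith
        then show ?thesis using kappa_ge(1) by linarith
      qed
      then have "n < \<nu>" using \<nu> by linarith
      then have "\<Theta> = {}" using nsols_le_n by (fastforce simp: \<Theta>_def)
      then show False using T by simp
    qed
  qed
  then show ?thesis using small[of \<Theta>] by (simp add: \<Theta>_def)
qed

text \<open>The height r is where the level bound n^2 / r^3 equals T. Up to height r, T values
  contribute T r^2 = n^2 / r; beyond it the tail estimate gives the same order n^2 / r, which is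
  (n^4 T)^(1/3). Cutting at the larger of r and \<kappa> stays inside the range in which level sets
  are controlled.\<close>

lemma head_square_sum_le:
  assumes np: "n ^ 3 \<le> p\<^sup>2" and \<Theta>: "\<Theta> \<subseteq> nz" and T: "real (card \<Theta>) \<le> T"
  shows "(\<Sum>\<theta> | \<theta> \<in> \<Theta> \<and> 4096 * \<kappa> < nsols n \<theta>. (real (nsols n \<theta>))\<^sup>2) \<le> 2 ^ 25 * root 3 (real n ^ 4 * T)"
proof (cases "card \<Theta> = 0")
  case True
  then have "\<Theta> = {}" by simp
  then show ?thesis using T by simp
next
  case False
  then have T0: "T > 0" using T by linarith
  define r where "r = root 3 ((real n)\<^sup>2 / T)"
  have r0: "r > 0" using n_pos T0 by (simp add: r_def)
  have r3: "r ^ 3 * T = (real n)\<^sup>2" using T0 by (simp add: r_def)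
  have W: "root 3 (real n ^ 4 * T) = (real n)\<^sup>2 / r"
  proof -
    have "((real n)\<^sup>2 / r) ^ 3 = real n ^ 4 * T"
      using r0 T0 n_pos arg_cong[OF r3, of "\<lambda>x. x * real n ^ 4"]
      by (simp add: power_divide field_simps flip: power_mult power_add)
    then show ?thesis using r0 by (metis odd_real_root_power_cancel odd_numeral)
  qed
  define \<mu> where "\<mu> = max \<kappa> r"
  define m where "m = nat \<lfloor>4096 * \<mu>\<rfloor>"
  have mu: "\<mu> \<ge> 1" "\<mu> \<ge> r" "\<mu> \<ge> \<kappa>" using kappa_ge by (auto simp: \<mu>_def)
  have m: "real m \<le> 4096 * \<mu>" "4096 * \<mu> < real m + 1" "real m \<ge> 2048 * \<mu>"
    using mu unfolding m_def by linarith+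
  have m0: "m > 0" using m mu by (intro Nat.gr0I) auto
  define A where "A = {\<theta> \<in> \<Theta>. 4096 * \<kappa> < nsols n \<theta>}"
  have "(\<Sum>\<theta> | \<theta> \<in> A \<and> m < nsols n \<theta>. (real (nsols n \<theta>))\<^sup>2) \<le> 3 * (2 ^ 14 * (real n)\<^sup>2) / m"
  proof (rule square_tail_le[OF _ m0])
    fix k assume k: "m < k"
    have "real (card {\<theta> \<in> A. k \<le> nsols n \<theta>}) \<le> real (card {\<theta> \<in> nz. k \<le> nsols n \<theta>})"
      unfolding of_nat_le_iff by (rule card_mono) (use \<Theta> in \<open>auto simp: A_def\<close>)
    then have "real k ^ 3 * card {\<theta> \<in> A. k \<le> nsols n \<theta>} \<le> real k ^ 3 * card {\<theta> \<in> nz. k \<le> nsols n \<theta>}"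
      by (intro mult_left_mono) auto
    also have "\<dots> \<le> 2 ^ 14 * (real n)\<^sup>2"
      by (rule level_card_le[OF np]) (use k m mu in linarith)
    finally show "real k ^ 3 * card {\<theta> \<in> A. k \<le> nsols n \<theta>} \<le> 2 ^ 14 * (real n)\<^sup>2" .
  qed simp
  also have "\<dots> \<le> 3 * (2 ^ 14 * (real n)\<^sup>2) / (2048 * r)"
    using m mu r0 m0 by (intro divide_left_mono) auto
  also have "\<dots> = 24 * ((real n)\<^sup>2 / r)" by simp
  finally have big: "(\<Sum>\<theta> | \<theta> \<in> A \<and> m < nsols n \<theta>. (real (nsols n \<theta>))\<^sup>2) \<le> 24 * ((real n)\<^sup>2 / r)" .
  have small: "(\<Sum>\<theta> | \<theta> \<in> A \<and> \<not> m < nsols n \<theta>. (real (nsols n \<theta>))\<^sup>2) \<le> 2 ^ 24 * ((real n)\<^sup>2 / r)"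
  proof (cases "r \<le> \<kappa>")
    case True
    then have "4096 * \<kappa> < real m + 1" using m by (simp add: \<mu>_def max_def)
    \<comment> \<open>Here the cutoff is 4096 \<kappa> itself, and membership in \<open>A\<close>
      already demands more than that.\<close>
    have "{\<theta> \<in> A. \<not> m < nsols n \<theta>} = {}"
    proof -
      have "m < nsols n \<theta>" if "\<theta> \<in> A" for \<theta>
        using that True m by (auto simp: A_def \<mu>_def max_def)
      then show ?thesis by auto
    qed
    then show ?thesis using r0 by (simp add: Collect_conj_eq)
  next
    case False
    then have "\<mu> = r" by (simp add: \<mu>_def)
    have "(\<Sum>\<theta> | \<theta> \<in> A \<and> \<not> m < nsols n \<theta>. (real (nsols n \<theta>))\<^sup>2) \<le> (\<Sum>\<theta> | \<theta> \<in> A \<and> \<not> m < nsols n \<theta>. (4096 * r)\<^sup>2)"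
    proof (rule sum_mono, rule power_mono)
      fix \<theta> assume "\<theta> \<in> {\<theta>. \<theta> \<in> A \<and> \<not> m < nsols n \<theta>}"
      then have "real (nsols n \<theta>) \<le> real m" by simp
      then show "real (nsols n \<theta>) \<le> 4096 * r" using m(1) \<open>\<mu> = r\<close> by linarith
    qed simp
    also have "\<dots> \<le> T * (4096 * r)\<^sup>2"
    proof -
      have "card {\<theta>. \<theta> \<in> A \<and> \<not> m < nsols n \<theta>} \<le> card \<Theta>" by (rule card_mono) (auto simp: A_def)
      then have "real (card {\<theta>. \<theta> \<in> A \<and> \<not> m < nsols n \<theta>}) \<le> T" using T by linarith
      then show ?thesis unfolding sum_constant by (intro mult_right_mono) auto
    qed
    also have "\<dots> = 2 ^ 24 * ((real n)\<^sup>2 / r)"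
      unfolding r3[symmetric] using r0 by (simp add: power_mult_distrib power2_eq_square power3_eq_cube)
    finally show ?thesis .
  qed
  have "(\<Sum>\<theta>\<in>A. (real (nsols n \<theta>))\<^sup>2) =
      (\<Sum>\<theta> | \<theta> \<in> A \<and> m < nsols n \<theta>. (real (nsols n \<theta>))\<^sup>2) + (\<Sum>\<theta> | \<theta> \<in> A \<and> \<not> m < nsols n \<theta>. (real (nsols n \<theta>))\<^sup>2)"
    by (subst sum.union_disjoint[symmetric]) (auto intro!: sum.cong)
  also have "\<dots> \<le> 24 * ((real n)\<^sup>2 / r) + 2 ^ 24 * ((real n)\<^sup>2 / r)" using big small by linarith
  also have "\<dots> \<le> 2 ^ 25 * ((real n)\<^sup>2 / r)" using r0 by (simp add: field_simps)
  finally show ?thesis unfolding W A_def by simp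
qed

end

section \<open>Pairs of elements of the subgroup\<close>

lemma triple_sum_product:
  fixes a :: "'i \<Rightarrow> 'r::comm_semiring_1"
  shows "(\<Sum>i\<in>A. a i) * (\<Sum>j\<in>B. b j) * (\<Sum>k\<in>D. c k) = (\<Sum>i\<in>A. \<Sum>j\<in>B. \<Sum>k\<in>D. a i * (b j * c k))"
proof -
  have "(\<Sum>i\<in>A. a i) * (\<Sum>j\<in>B. b j) * (\<Sum>k\<in>D. c k) = (\<Sum>i\<in>A. a i * ((\<Sum>j\<in>B. b j) * (\<Sum>k\<in>D. c k)))"
    by (subst mult.assoc, rule sum_distrib_right)
  also have "\<dots> = (\<Sum>i\<in>A. \<Sum>j\<in>B. \<Sum>k\<in>D. a i * (b j * c k))"
    by (unfold sum_product[of b B c D], simp only: sum_distrib_left)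
  finally show ?thesis .
qed

context power_subgroup
begin

definition invariant :: "('a \<Rightarrow> 'b) \<Rightarrow> bool" where
  "invariant f \<longleftrightarrow> (\<forall>g\<in>G. \<forall>x. f (g * x) = f x)"

text \<open>The number of cosets of \<open>G\<close> in \<open>{x. x \<noteq> 0 \<and> i \<le> f x}\<close>, for an invariant \<open>f\<close>.\<close>

definition q :: "('a \<Rightarrow> nat) \<Rightarrow> nat \<Rightarrow> nat" where
  "q f i = card ((\<lambda>x. x ^ n) ` {x. x \<noteq> 0 \<and> i \<le> f x})"

lemma invariantD: "invariant f \<Longrightarrow> g \<in> G \<Longrightarrow> f (g * x) = f x"
  by (auto simp: invariant_def)

lemma sum_over_classes:
  fixes F :: "'a \<Rightarrow> 'c::comm_semiring_1"
  assumes S: "0 \<notin> S" "\<And>g x. g \<in> G \<Longrightarrow> x \<in> S \<Longrightarrow> g * x \<in> S"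
  shows "(\<Sum>x\<in>S. F (x ^ n)) = of_nat n * (\<Sum>a\<in>(\<lambda>x. x ^ n) ` S. F a)"
proof -
  have "(\<Sum>x\<in>S. F (x ^ n)) = (\<Sum>a\<in>(\<lambda>x. x ^ n) ` S. \<Sum>x\<in>{x \<in> S. x ^ n = a}. F (x ^ n))"
    by (rule sum.image_gen) simp
  also have "\<dots> = (\<Sum>a\<in>(\<lambda>x. x ^ n) ` S. of_nat n * F a)"
  proof (rule sum.cong[OF refl])
    fix a assume "a \<in> (\<lambda>x. x ^ n) ` S"
    then obtain x0 where x0: "x0 \<in> S" "a = x0 ^ n" by auto
    then have nz0: "x0 \<noteq> 0" using S by auto
    have "{x \<in> S. x ^ n = a} = {x. x ^ n = x0 ^ n}"
      unfolding x0(2) using power_eq_coset[OF nz0] S(2) x0(1) by auto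
    then have "card {x \<in> S. x ^ n = a} = n" using card_power_fibre[OF nz0] by simp
    then show "(\<Sum>x\<in>{x \<in> S. x ^ n = a}. F (x ^ n)) = of_nat n * F a"
      by simp
  qed
  finally show ?thesis by (simp add: sum_distrib_left)
qed

lemma n_times_q: "invariant f \<Longrightarrow> n * q f i = card {x. x \<noteq> 0 \<and> i \<le> f x}"
  using sum_over_classes[of "{x. x \<noteq> 0 \<and> i \<le> f x}" "\<lambda>_. 1::nat"]
  by (simp add: q_def invariant_def nonzero_G)

section \<open>Pairs of group elements and their shapes\<close>

definition pairs :: "('a \<times> 'a) set" where
  "pairs = {(y, z). y \<in> G \<and> z \<in> G \<and> y \<noteq> 1 \<and> z \<noteq> 1 \<and> y \<noteq> z}"

text \<open>The second entry is the n-th power of one minus the ratio in the first, so the ratio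
  lies in \<open>sols n\<close> of the shape. Moreover the shape is determined by the cosets of 1 -
  y, 1 - z and z - y, which are all that an invariant function sees of these differences.\<close>

definition shape :: "'a \<times> 'a \<Rightarrow> 'a \<times> 'a" where
  "shape = (\<lambda>(y, z). (((1 - z) / (1 - y)) ^ n, ((z - y) / (1 - y)) ^ n))"

text \<open>
  If \<open>x = (1 - z) / (1 - y)\<close> has shape \<open>\<theta>\<close>, then \<open>z = x y + (1 - x)\<close>, so that the pairs \<open>(y, z)\<close> over a fixed \<open>x\<close>
  correspond to the solutions \<open>z / (1 - x)\<close> for the pair of cosets \<open>star \<theta>\<close>.
\<close>

definition star :: "'a \<times> 'a \<Rightarrow> 'a \<times> 'a" where
  "star = (\<lambda>(a, b). (inverse b, (-1) ^ n * a / b))"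

text \<open>One large factor suffices: the number of pairs over \<theta> is bounded by the square of
  the larger of the two factors, and that square is then covered by
  \<open>head_square_sum_le\<close>.\<close>

definition head :: "'a \<times> 'a \<Rightarrow> bool" where
  "head \<theta> \<longleftrightarrow> 4096 * \<kappa> < nsols n \<theta> \<or> 4096 * \<kappa> < nsols n (star \<theta>)"

lemma inj_on_star: "inj_on star nz"
  by (auto simp: inj_on_def star_def nz_def)

lemma star_nz: "\<theta> \<in> nz \<Longrightarrow> star \<theta> \<in> nz"
  by (cases \<theta>) (auto simp: star_def nz_def)

lemma shape_nz: "yz \<in> pairs \<Longrightarrow> shape yz \<in> nz"
  by (auto simp: shape_def nz_def pairs_def)

lemma card_pairs_le: "card pairs \<le> n\<^sup>2"
proof -
  have "card pairs \<le> card (G \<times> G)" by (rule card_mono) (auto simp: pairs_def)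
  then show ?thesis by (simp add: card_cartesian_product card_G power2_eq_square)
qed

lemma card_shape_fibre: "card {yz \<in> pairs. shape yz = \<theta>} \<le> nsols n \<theta> * nsols n (star \<theta>)"
proof -
  \<comment> \<open>With x the ratio in the first coordinate, the second coordinate is z / (1 - x),
    the solution attached to \<open>star \<theta>\<close>.\<close>
  define e where "e = (\<lambda>(y, z). ((1 - z) / (1 - y), z * (1 - y) / (z - y)) :: 'a \<times> 'a)"
  have comp: "1 - (1 - z) / (1 - y) = (z - y) / (1 - y)"
    "1 - z * (1 - y) / (z - y) = - y * (1 - z) / (z - y)"
    if "(y, z) \<in> pairs" for y z
  proof -
    have e: "1 - a / b = (b - a) / b" if "b \<noteq> 0" for a b :: 'a
      using that by (simp add: diff_divide_distrib)
    have ne: "1 - y \<noteq> 0" "z - y \<noteq> 0" using that by (auto simp: pairs_def)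
    show "1 - (1 - z) / (1 - y) = (z - y) / (1 - y)" unfolding e[OF ne(1)] by simp
    show "1 - z * (1 - y) / (z - y) = - y * (1 - z) / (z - y)"
      unfolding e[OF ne(2)] by (simp add: algebra_simps)
  qed
  have "inj_on e {yz \<in> pairs. shape yz = \<theta>}"
  proof (rule inj_onI, clarify)
    fix y z y' z' assume P: "(y, z) \<in> pairs" "(y', z') \<in> pairs" and "e (y, z) = e (y', z')"
    then have X: "(1 - z) / (1 - y) = (1 - z') / (1 - y')"
      and U: "z * (1 - y) / (z - y) = z' * (1 - y') / (z' - y')" by (auto simp: e_def)
    \<comment> \<open>The two coordinates recover z as their product u (1 - x); the ratio x and z
      then determine y.\<close>
    have zz: "z = z * (1 - y) / (z - y) * (1 - (1 - z) / (1 - y))" if "(y, z) \<in> pairs" for y z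
      using that unfolding comp(1)[OF that] by (auto simp: pairs_def)
    have "z = z'" using zz[OF P(1)] zz[OF P(2)] X U by simp
    moreover from this X P have "y = y'" by (auto simp: pairs_def divide_simps split: if_splits)
    ultimately show "y = y' \<and> z = z'" by simp
  qed
  moreover have "e ` {yz \<in> pairs. shape yz = \<theta>} \<subseteq> sols n \<theta> \<times> sols n (star \<theta>)"
  proof (rule image_subsetI)
    fix yz assume yz: "yz \<in> {yz \<in> pairs. shape yz = \<theta>}"
    obtain y z where eq: "yz = (y, z)" by (cases yz)
    with yz have P: "(y, z) \<in> pairs" and s: "shape (y, z) = \<theta>" by auto
    have "y \<in> G" "z \<in> G" using P by (auto simp: pairs_def)
    then have g: "y ^ n = 1" "z ^ n = 1" by (auto simp: G_def)
    have ne: "1 - y \<noteq> 0" "z - y \<noteq> 0" using P by (auto simp: pairs_def)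
    have "(1 - z) / (1 - y) \<in> sols n (shape (y, z))"
      using comp(1)[OF P] by (simp add: sols_def shape_def)
    moreover have "z * (1 - y) / (z - y) \<in> sols n (star (shape (y, z)))"
      unfolding sols_def mem_Collect_eq comp(2)[OF P]
      using g ne by (simp add: shape_def star_def power_mult_distrib power_divide power_minus[of "y * (1 - z) / (z - y)"])
    ultimately show "e yz \<in> sols n \<theta> \<times> sols n (star \<theta>)"
      by (simp add: e_def eq s)
  qed
  ultimately show ?thesis
    unfolding nsols_def card_cartesian_product[symmetric] by (intro card_inj_on_le) auto
qed

text \<open>The product of the two multiplicities is at most the square of the larger one, and this
  one is above the threshold. Since \<open>star\<close> is injective on \<open>nz\<close>, the
  second kind of square is again summed over at most T distinct values, so one estimate serves
  both.\<close>

lemma head_pairs_le: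
  assumes np: "n ^ 3 \<le> p\<^sup>2" and T: "real (card \<Theta>) \<le> T"
  shows "real (card {yz \<in> pairs. shape yz \<in> \<Theta> \<and> head (shape yz)}) \<le> 2 ^ 26 * root 3 (real n ^ 4 * T)"
proof -
  define A where "A = {\<theta> \<in> \<Theta>. \<theta> \<in> nz \<and> head \<theta>}"
  define big where "big \<theta> = (if 4096 * \<kappa> < nsols n \<theta> then (real (nsols n \<theta>))\<^sup>2 else 0)" for \<theta> :: "'a \<times> 'a"
  have big_nonneg: "0 \<le> big \<theta>" for \<theta> by (simp add: big_def)
  have sub: "A \<subseteq> nz" "A \<subseteq> \<Theta>" by (auto simp: A_def)
  have cA: "real (card A) \<le> T" using card_mono[OF _ sub(2)] T by simp
  have "card {yz \<in> pairs. shape yz \<in> \<Theta> \<and> head (shape yz)} \<le> card (\<Union>\<theta>\<in>A. {yz \<in> pairs. shape yz = \<theta>})"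
    by (rule card_mono) (auto simp: A_def shape_nz)
  also have "\<dots> \<le> (\<Sum>\<theta>\<in>A. card {yz \<in> pairs. shape yz = \<theta>})" by (rule card_UN_le) simp
  also have "\<dots> \<le> (\<Sum>\<theta>\<in>A. nsols n \<theta> * nsols n (star \<theta>))" by (intro sum_mono card_shape_fibre)
  finally have "real (card {yz \<in> pairs. shape yz \<in> \<Theta> \<and> head (shape yz)}) \<le> (\<Sum>\<theta>\<in>A. real (nsols n \<theta>) * real (nsols n (star \<theta>)))"
    by (metis (no_types, lifting) of_nat_le_iff of_nat_mult of_nat_sum sum.cong)
  also have "\<dots> \<le> (\<Sum>\<theta>\<in>A. big \<theta> + big (star \<theta>))"
  proof (rule sum_mono)
    fix \<theta> assume "\<theta> \<in> A"
    then have h: "4096 * \<kappa> < nsols n \<theta> \<or> 4096 * \<kappa> < nsols n (star \<theta>)" by (auto simp: A_def head_def)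
    show "real (nsols n \<theta>) * real (nsols n (star \<theta>)) \<le> big \<theta> + big (star \<theta>)"
    proof (cases "nsols n \<theta> \<le> nsols n (star \<theta>)")
      case True
      then have "real (nsols n \<theta>) * real (nsols n (star \<theta>)) \<le> big (star \<theta>)"
        using h by (auto simp: big_def power2_eq_square intro!: mult_right_mono)
      then show ?thesis using big_nonneg[of \<theta>] by linarith
    next
      case False
      then have "real (nsols n \<theta>) * real (nsols n (star \<theta>)) \<le> big \<theta>"
        using h by (auto simp: big_def power2_eq_square intro!: mult_left_mono)
      then show ?thesis using big_nonneg[of "star \<theta>"] by linarith
    qed
  qed
  also have "\<dots> = (\<Sum>\<theta>\<in>A. big \<theta>) + (\<Sum>\<theta>\<in>star ` A. big \<theta>)"
    using inj_on_subset[OF inj_on_star sub(1)] by (simp add: sum.distrib sum.reindex)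
  also have "(\<Sum>\<theta>\<in>A. big \<theta>) \<le> 2 ^ 25 * root 3 (real n ^ 4 * T)"
    using head_square_sum_le[OF np sub(1) cA] by (simp add: big_def sum.If_cases Int_def)
  also have "(\<Sum>\<theta>\<in>star ` A. big \<theta>) \<le> 2 ^ 25 * root 3 (real n ^ 4 * T)"
  proof -
    have "real (card (star ` A)) \<le> T" using card_image_le[of A star] cA by simp
    moreover have "star ` A \<subseteq> nz" using sub star_nz by blast
    ultimately show ?thesis using head_square_sum_le[OF np, of "star ` A" T]
      by (simp add: big_def sum.If_cases Int_def)
  qed
  finally show ?thesis by simp
qed

text \<open>For n^2 \<le> p the threshold is the constant 4096, so values that are not in
  \<open>head\<close> contribute O(T). This is absorbed by n^(4/3) T^(1/3) as long as T \<le> n^2;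
  for larger T the trivial bound n^2 on all pairs is already smaller.\<close>

lemma all_pairs_le:
  assumes np: "n\<^sup>2 \<le> p" and T: "real (card \<Theta>) \<le> T"
  shows "real (card {yz \<in> pairs. shape yz \<in> \<Theta>}) \<le> 2 ^ 27 * root 3 (real n ^ 4 * T)"
proof -
  note k = small_subgroup(2)[OF np] and np3 = small_subgroup(1)[OF np]
  have T0: "T \<ge> 0" using T by linarith
  show ?thesis
  proof (cases "(real n)\<^sup>2 \<le> T")
    case True
    have "real (card {yz \<in> pairs. shape yz \<in> \<Theta>}) \<le> real (n\<^sup>2)"
      unfolding of_nat_le_iff by (rule order.trans[OF card_mono card_pairs_le]) auto
    also have "real (n\<^sup>2) = root 3 ((real n ^ 2) ^ 3)"
      unfolding of_nat_power by (rule real_root_power_cancel[symmetric]) auto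
    also have "\<dots> \<le> root 3 (real n ^ 4 * T)"
      using True mult_left_mono[of "(real n)\<^sup>2" T "real n ^ 4"] by (intro real_root_le_mono) (auto simp flip: power_mult power_add)
    also have "\<dots> \<le> 2 ^ 27 * root 3 (real n ^ 4 * T)" using T0 by simp
    finally show ?thesis .
  next
    case False
    define A where "A = {\<theta> \<in> \<Theta>. \<not> head \<theta>}"
    have "card {yz \<in> pairs. shape yz \<in> \<Theta> \<and> \<not> head (shape yz)} \<le> card (\<Union>\<theta>\<in>A. {yz \<in> pairs. shape yz = \<theta>})"
      by (rule card_mono) (auto simp: A_def)
    also have "\<dots> \<le> (\<Sum>\<theta>\<in>A. card {yz \<in> pairs. shape yz = \<theta>})" by (rule card_UN_le) simp
    also have "\<dots> \<le> (\<Sum>\<theta>\<in>A. 4096 * 4096)"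
    proof (rule sum_mono)
      fix \<theta> assume "\<theta> \<in> A"
      then have "nsols n \<theta> \<le> 4096" "nsols n (star \<theta>) \<le> 4096" by (auto simp: A_def head_def k)
      then show "card {yz \<in> pairs. shape yz = \<theta>} \<le> 4096 * 4096"
        using card_shape_fibre[of \<theta>] mult_le_mono by (meson order.trans)
    qed
    also have "\<dots> \<le> card \<Theta> * (4096 * 4096)"
      by (simp add: A_def card_mono)
    finally have "real (card {yz \<in> pairs. shape yz \<in> \<Theta> \<and> \<not> head (shape yz)}) \<le> real (card \<Theta> * (4096 * 4096))"
      by (simp only: of_nat_le_iff)
    also have "\<dots> \<le> 2 ^ 24 * T" using T by simp
    also have "T = root 3 (T ^ 3)" by (rule real_root_power_cancel[symmetric]) (use T0 in auto)
    also have "root 3 (T ^ 3) \<le> root 3 (real n ^ 4 * T)"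
    proof (rule real_root_le_mono)
      have "T * T * T \<le> (real n)\<^sup>2 * (real n)\<^sup>2 * T"
        using False T0 by (intro mult_right_mono mult_mono) auto
      then show "T ^ 3 \<le> real n ^ 4 * T" by (simp add: power3_eq_cube flip: power_add)
    qed simp
    finally have tail: "real (card {yz \<in> pairs. shape yz \<in> \<Theta> \<and> \<not> head (shape yz)}) \<le> 2 ^ 24 * root 3 (real n ^ 4 * T)"
      by simp
    have "card {yz \<in> pairs. shape yz \<in> \<Theta>} = card ({yz \<in> pairs. shape yz \<in> \<Theta> \<and> head (shape yz)} \<union> {yz \<in> pairs. shape yz \<in> \<Theta> \<and> \<not> head (shape yz)})"
      by (rule arg_cong[where f = card]) auto
    also have "\<dots> = card {yz \<in> pairs. shape yz \<in> \<Theta> \<and> head (shape yz)} + card {yz \<in> pairs. shape yz \<in> \<Theta> \<and> \<not> head (shape yz)}"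
      by (rule card_Un_disjoint) auto
    finally show ?thesis using tail head_pairs_le[OF np3 T] T0 by simp
  qed
qed

text \<open>Each factor is written as a sum of indicators of its level sets. Fixing three heights
  confines the shape to a set whose size is at most a product of three numbers of cosets; since the
  cube root is multiplicative, the threefold sum over heights splits into a product of single
  sums.\<close>

lemma trilinear_le:
  fixes f h :: "'a \<Rightarrow> nat"
  assumes count: "\<And>\<Theta> T. real (card \<Theta>) \<le> T \<Longrightarrow> real (card {yz \<in> P. shape yz \<in> \<Theta>}) \<le> C * root 3 (real n ^ 4 * T)"
    and P: "P \<subseteq> pairs" and f: "\<And>x. x \<noteq> 0 \<Longrightarrow> f x \<le> I" and h: "\<And>x. x \<noteq> 0 \<Longrightarrow> h x \<le> J"
  shows "(\<Sum>(y, z)\<in>P. real (f (1 - y)) * real (f (1 - z)) * real (h (z - y)))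
     \<le> C * root 3 (real n ^ 4) * (\<Sum>i = 1..I. root 3 (q f i))\<^sup>2 * (\<Sum>k = 1..J. root 3 (q h k))"
proof -
  have fI: "real (f x) = (\<Sum>i = 1..I. of_bool (i \<le> f x))" if "x \<noteq> 0" for x
  proof -
    have "{1..I} \<inter> {i. i \<le> f x} = {1..f x}" using f[OF that] by auto
    then show ?thesis by (simp add: of_bool_def sum.If_cases)
  qed
  have hJ: "real (h x) = (\<Sum>i = 1..J. of_bool (i \<le> h x))" if "x \<noteq> 0" for x
  proof -
    have "{1..J} \<inter> {i. i \<le> h x} = {1..h x}" using h[OF that] by auto
    then show ?thesis by (simp add: of_bool_def sum.If_cases)
  qed
  have level: "real (card {yz \<in> P. i \<le> f (1 - fst yz) \<and> j \<le> f (1 - snd yz) \<and> k \<le> h (snd yz - fst yz)})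
     \<le> C * (root 3 (real n ^ 4) * (root 3 (q f i) * root 3 (q f j) * root 3 (q h k)))" for i j k
  proof -
    define cl where "cl g i = (\<lambda>x. x ^ n) ` {x. x \<noteq> 0 \<and> i \<le> g x}" for g :: "'a \<Rightarrow> nat" and i
    \<comment> \<open>Dividing by the coset of 1 - y passes from the triple of cosets to the
      shape.\<close>
    define \<Theta> where "\<Theta> = (\<lambda>(a, b, c). (b / a, c / a)) ` (cl f i \<times> cl f j \<times> cl h k)"
    have "card \<Theta> \<le> card (cl f i \<times> cl f j \<times> cl h k)" unfolding \<Theta>_def by (rule card_image_le) simp
    then have "real (card \<Theta>) \<le> real (q f i * (q f j * q h k))"
      unfolding of_nat_le_iff by (simp add: card_cartesian_product q_def cl_def)
    then have "real (card {yz \<in> P. shape yz \<in> \<Theta>}) \<le> C * root 3 (real n ^ 4 * real (q f i * (q f j * q h k)))"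
      by (rule count)
    moreover have "card {yz \<in> P. i \<le> f (1 - fst yz) \<and> j \<le> f (1 - snd yz) \<and> k \<le> h (snd yz - fst yz)}
       \<le> card {yz \<in> P. shape yz \<in> \<Theta>}"
    proof (rule card_mono; clarsimp)
      fix y z assume yz: "(y, z) \<in> P" and lev: "i \<le> f (1 - y)" "j \<le> f (1 - z)" "k \<le> h (z - y)"
      then have "((1 - y) ^ n, (1 - z) ^ n, (z - y) ^ n) \<in> cl f i \<times> cl f j \<times> cl h k"
        using P by (auto simp: cl_def pairs_def intro!: imageI)
      then show "shape (y, z) \<in> \<Theta>" unfolding \<Theta>_def shape_def
        by (intro image_eqI) (auto simp: power_divide)
    qed
    ultimately show ?thesis by (simp add: real_root_mult)
  qed
  have "(\<Sum>(y, z)\<in>P. real (f (1 - y)) * real (f (1 - z)) * real (h (z - y))) =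
    (\<Sum>yz\<in>P. \<Sum>i = 1..I. \<Sum>j = 1..I. \<Sum>k = 1..J.
      of_bool (i \<le> f (1 - fst yz) \<and> j \<le> f (1 - snd yz) \<and> k \<le> h (snd yz - fst yz)))"
  proof (rule sum.cong[OF refl], clarify)
    fix y z assume "(y, z) \<in> P"
    then have ne: "1 - y \<noteq> 0" "1 - z \<noteq> 0" "z - y \<noteq> 0" using P by (auto simp: pairs_def)
    show "real (f (1 - y)) * real (f (1 - z)) * real (h (z - y)) = (\<Sum>i = 1..I. \<Sum>j = 1..I. \<Sum>k = 1..J.
      of_bool (i \<le> f (1 - fst (y, z)) \<and> j \<le> f (1 - snd (y, z)) \<and> k \<le> h (snd (y, z) - fst (y, z))))"
      unfolding fI[OF ne(1)] fI[OF ne(2)] hJ[OF ne(3)] triple_sum_product fst_conv snd_conv of_bool_conj ..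
  qed
  also have "\<dots> = (\<Sum>i = 1..I. \<Sum>j = 1..I. \<Sum>k = 1..J. \<Sum>yz\<in>P.
      of_bool (i \<le> f (1 - fst yz) \<and> j \<le> f (1 - snd yz) \<and> k \<le> h (snd yz - fst yz)))"
    by (subst sum.swap, rule sum.cong[OF refl], subst sum.swap, rule sum.cong[OF refl], rule sum.swap)
  also have "\<dots> = (\<Sum>i = 1..I. \<Sum>j = 1..I. \<Sum>k = 1..J.
      real (card {yz \<in> P. i \<le> f (1 - fst yz) \<and> j \<le> f (1 - snd yz) \<and> k \<le> h (snd yz - fst yz)}))"
    by (intro sum.cong refl) (simp add: of_bool_def sum.If_cases Int_def)
  also have "\<dots> \<le> (\<Sum>i = 1..I. \<Sum>j = 1..I. \<Sum>k = 1..J.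
      C * (root 3 (real n ^ 4) * (root 3 (q f i) * root 3 (q f j) * root 3 (q h k))))"
    by (intro sum_mono level)
  also have "\<dots> = C * root 3 (real n ^ 4) * (\<Sum>i = 1..I. root 3 (q f i))\<^sup>2 * (\<Sum>k = 1..J. root 3 (q h k))"
    unfolding power2_eq_square sum_product
    by (simp add: sum_distrib_left sum_distrib_right mult_ac)
  finally show ?thesis .
qed

text \<open>Jensen's inequality: replacing \<open>w\<close> by its average over the dilates by \<open>G\<close> decreases the right-hand side.\<close>

lemma dilation_average:
  fixes \<phi> w :: "'a \<Rightarrow> real"
  assumes inv: "invariant \<phi>"
  shows "(\<Sum>y\<in>G. w y)\<^sup>2 * (\<Sum>t\<in>UNIV. (\<Sum>y\<in>G. \<phi> (y + t))\<^sup>2)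
    \<le> (real n)\<^sup>2 * (\<Sum>t\<in>UNIV. (\<Sum>y\<in>G. w y * \<phi> (y + t))\<^sup>2)"
proof -
  define u where "u t = (\<Sum>y\<in>G. w y * \<phi> (y + t))" for t
  have bijU: "bij_betw (\<lambda>x. g * x) UNIV UNIV" if "g \<in> G" for g
    by (rule bij_betw_byWitness[where f' = "\<lambda>x. inverse g * x"]) (use nonzero_G[OF that] in auto)
  have uu: "u (g * t) = (\<Sum>y\<in>G. w (g * y) * \<phi> (y + t))" if g: "g \<in> G" for g t
  proof -
    have "u (g * t) = (\<Sum>y\<in>G. w (g * y) * \<phi> (g * y + g * t))"
      unfolding u_def by (rule sum.reindex_bij_betw[OF bij_betw_mult_G[OF g], symmetric])
    also have "\<dots> = (\<Sum>y\<in>G. w (g * y) * \<phi> (y + t))"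
      using invariantD[OF inv g] by (simp flip: distrib_left)
    finally show ?thesis .
  qed
  \<comment> \<open>Averaging replaces the weight at y by its sum over the dilates of y, and this is
    the total weight for every y in \<open>G\<close>, because \<open>G\<close> acts transitively on
    itself.\<close>
  have avg: "(\<Sum>g\<in>G. u (g * t)) = (\<Sum>y\<in>G. w y) * (\<Sum>y\<in>G. \<phi> (y + t))" for t
  proof -
    have "(\<Sum>g\<in>G. u (g * t)) = (\<Sum>g\<in>G. \<Sum>y\<in>G. w (g * y) * \<phi> (y + t))"
      by (simp add: uu)
    also have "\<dots> = (\<Sum>y\<in>G. (\<Sum>g\<in>G. w (g * y)) * \<phi> (y + t))"
      by (subst sum.swap) (simp add: sum_distrib_right)
    also have "\<dots> = (\<Sum>y\<in>G. (\<Sum>y\<in>G. w y) * \<phi> (y + t))"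
    proof (rule sum.cong[OF refl])
      fix y assume y: "y \<in> G"
      have "(\<Sum>g\<in>G. w (g * y)) = (\<Sum>g\<in>G. w g)"
        using sum.reindex_bij_betw[OF bij_betw_mult_G[OF y], of w] by (simp add: mult.commute)
      then show "(\<Sum>g\<in>G. w (g * y)) * \<phi> (y + t) = (\<Sum>y\<in>G. w y) * \<phi> (y + t)" by simp
    qed
    finally show ?thesis by (simp add: sum_distrib_left)
  qed
  have "(\<Sum>y\<in>G. w y)\<^sup>2 * (\<Sum>t\<in>UNIV. (\<Sum>y\<in>G. \<phi> (y + t))\<^sup>2) = (\<Sum>t\<in>UNIV. (\<Sum>g\<in>G. u (g * t))\<^sup>2)"
    unfolding avg power_mult_distrib by (rule sum_distrib_left)
  also have "\<dots> \<le> (\<Sum>t\<in>UNIV. (\<Sum>g\<in>G. (u (g * t))\<^sup>2) * real n)"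
    by (intro sum_mono) (metis card_G sum_squared_le_sum_of_squares)
  also have "\<dots> = real n * (\<Sum>g\<in>G. \<Sum>t\<in>UNIV. (u (g * t))\<^sup>2)"
    by (subst sum.swap) (simp add: sum_distrib_left mult.commute)
  also have "\<dots> = real n * (\<Sum>g\<in>G. \<Sum>t\<in>UNIV. (u t)\<^sup>2)"
    using sum.reindex_bij_betw[OF bijU, where g = "\<lambda>t. (u t)\<^sup>2"] by simp
  also have "\<dots> = (real n)\<^sup>2 * (\<Sum>t\<in>UNIV. (u t)\<^sup>2)"
    by (simp add: card_G power2_eq_square)
  finally show ?thesis by (simp add: u_def)
qed

end

section \<open>Correlations\<close>

context power_subgroup
begin

definition corr :: "('a \<Rightarrow> nat) \<Rightarrow> 'a \<Rightarrow> nat" where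
  "corr \<phi> x = (\<Sum>t\<in>UNIV. \<phi> t * \<phi> (t + x))"

definition spread :: "('a \<Rightarrow> nat) \<Rightarrow> 'a \<Rightarrow> nat" where
  "spread \<phi> t = (\<Sum>y\<in>G. \<phi> (y + t))"

lemma sum_shift: "(\<Sum>t\<in>UNIV. F (c + t)) = (\<Sum>t\<in>UNIV. F (t::'a))"
  by (rule sum.reindex_bij_betw) (rule bij_betw_byWitness[where f' = "\<lambda>x. x - c"], auto)

lemma sum_dilate: "g \<in> G \<Longrightarrow> (\<Sum>t\<in>UNIV. F (g * t)) = (\<Sum>t\<in>UNIV. F (t::'a))"
  by (rule sum.reindex_bij_betw)
     (rule bij_betw_byWitness[where f' = "\<lambda>x. inverse g * x"], auto simp: nonzero_G)

lemma sum_dilate_G: "g \<in> G \<Longrightarrow> (\<Sum>t\<in>G. F (g * t)) = (\<Sum>t\<in>G. F t)"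
  by (rule sum.reindex_bij_betw[OF bij_betw_mult_G])

lemma corr_diff: "corr \<phi> (z - y) = (\<Sum>t\<in>UNIV. \<phi> (y + t) * \<phi> (z + t))"
  unfolding corr_def by (subst sum_shift[of _ y, symmetric]) (simp add: algebra_simps)

lemma corr_le_corr_0: "corr \<phi> x \<le> corr \<phi> 0"
proof -
  have "2 * corr \<phi> x \<le> (\<Sum>t\<in>UNIV. \<phi> t * \<phi> t + \<phi> (x + t) * \<phi> (x + t))"
    unfolding corr_def sum_distrib_left
  proof (rule sum_mono)
    fix t
    have "2 * (int (\<phi> t) * int (\<phi> (t + x))) \<le> int (\<phi> t) * int (\<phi> t) + int (\<phi> (t + x)) * int (\<phi> (t + x))"
      using zero_le_square[of "int (\<phi> t) - int (\<phi> (t + x))"] by (simp add: algebra_simps)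
    then have "int (2 * (\<phi> t * \<phi> (t + x))) \<le> int (\<phi> t * \<phi> t + \<phi> (t + x) * \<phi> (t + x))" by simp
    then show "2 * (\<phi> t * \<phi> (t + x)) \<le> \<phi> t * \<phi> t + \<phi> (x + t) * \<phi> (x + t)"
      unfolding of_nat_le_iff by (simp add: add.commute)
  qed
  also have "\<dots> = 2 * corr \<phi> 0"
    by (simp add: sum.distrib corr_def sum_shift[of "\<lambda>t. \<phi> t * \<phi> t"])
  finally show ?thesis by simp
qed

lemma sum_corr: "(\<Sum>x\<in>UNIV. corr \<phi> x) = (\<Sum>t\<in>UNIV. \<phi> t)\<^sup>2"
  unfolding corr_def by (subst sum.swap) (simp add: sum_distrib_left[symmetric] sum_shift power2_eq_square sum_distrib_right[symmetric])

lemma invariant_corr: "invariant \<phi> \<Longrightarrow> invariant (corr \<phi>)"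
  unfolding invariant_def[of "corr \<phi>"]
proof clarify
  fix g x assume inv: "invariant \<phi>" and g: "g \<in> G"
  have "corr \<phi> (g * x) = (\<Sum>t\<in>UNIV. \<phi> (g * t) * \<phi> (g * t + g * x))"
    unfolding corr_def by (rule sum_dilate[OF g, symmetric])
  then show "corr \<phi> (g * x) = corr \<phi> x"
    using invariantD[OF inv g] by (simp add: corr_def flip: distrib_left)
qed

lemma invariant_spread: "invariant \<phi> \<Longrightarrow> invariant (spread \<phi>)"
  unfolding invariant_def[of "spread \<phi>"]
proof clarify
  fix g x assume inv: "invariant \<phi>" and g: "g \<in> G"
  have "spread \<phi> (g * x) = (\<Sum>t\<in>G. \<phi> (g * t + g * x))"
    unfolding spread_def by (rule sum_dilate_G[OF g, symmetric])
  then show "spread \<phi> (g * x) = spread \<phi> x"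
    using invariantD[OF inv g] by (simp add: spread_def flip: distrib_left)
qed

lemma sum_spread: "(\<Sum>x\<in>UNIV. spread \<phi> x) = n * (\<Sum>x\<in>UNIV. \<phi> x)"
  unfolding spread_def by (subst sum.swap) (simp add: sum_shift card_G)

lemma sum_G_differences:
  fixes k :: "'a \<Rightarrow> 'c::comm_semiring_1"
  assumes "invariant k"
  shows "(\<Sum>x\<in>G. \<Sum>y\<in>G. k (x - y)) = of_nat n * (\<Sum>y\<in>G. k (1 - y))"
proof -
  have "(\<Sum>y\<in>G. k (x - y)) = (\<Sum>y\<in>G. k (1 - y))" if x: "x \<in> G" for x
  proof -
    have "(\<Sum>y\<in>G. k (x - y)) = (\<Sum>y\<in>G. k (x * 1 - x * y))"
      using sum_dilate_G[OF x, of "\<lambda>y. k (x - y)"] by simp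
    then show ?thesis using invariantD[OF assms x] by (simp only: flip: right_diff_distrib)
  qed
  then show ?thesis by (simp add: card_G)
qed

lemma sum_spread_squares: "(\<Sum>t\<in>UNIV. (spread \<phi> t)\<^sup>2) = (\<Sum>x\<in>G. \<Sum>y\<in>G. corr \<phi> (x - y))"
proof -
  have "(\<Sum>t\<in>UNIV. (spread \<phi> t)\<^sup>2) = (\<Sum>t\<in>UNIV. \<Sum>x\<in>G. \<Sum>y\<in>G. \<phi> (x + t) * \<phi> (y + t))"
    by (simp add: spread_def power2_eq_square sum_product)
  also have "\<dots> = (\<Sum>x\<in>G. \<Sum>y\<in>G. \<Sum>t\<in>UNIV. \<phi> (x + t) * \<phi> (y + t))"
    by (subst sum.swap, rule sum.cong[OF refl], rule sum.swap)
  also have "\<dots> = (\<Sum>x\<in>G. \<Sum>y\<in>G. corr \<phi> (x - y))"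
    unfolding corr_diff by (intro sum.cong refl) (rule mult.commute)
  finally show ?thesis .
qed

text \<open>\<open>dilation_average\<close> is applied to the weight g (1 - y), and the square on
  its right is expanded over (y, z). The diagonal produces the term with
  \<open>corr \<phi> 0\<close>, entries with y = 1 or z = 1 vanish because g is zero at 0, and the
  rest is the sum over \<open>pairs\<close>. With \<phi> equal to \<open>ind\<close> this serves the
  energy, with \<open>r\<^sub>2\<close> the threefold sums.\<close>

lemma pair_sum_lower_bound:
  fixes g :: "'a \<Rightarrow> nat"
  assumes inv: "invariant \<phi>" and g0: "g 0 = 0"
  shows "(real (\<Sum>y\<in>G. g (1 - y)))\<^sup>2 * real (\<Sum>t\<in>UNIV. (spread \<phi> t)\<^sup>2)
    \<le> (real n)\<^sup>2 * (real (corr \<phi> 0) * (\<Sum>y\<in>G. (real (g (1 - y)))\<^sup>2)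
        + (\<Sum>(y, z)\<in>pairs. real (g (1 - y)) * real (g (1 - z)) * real (corr \<phi> (z - y))))"
proof -
  have inv': "invariant (\<lambda>x. real (\<phi> x))" using inv by (simp add: invariant_def)
  define v where "v y z = real (g (1 - y)) * real (g (1 - z)) * real (corr \<phi> (z - y))" for y z
  have "(\<Sum>t\<in>UNIV. (\<Sum>y\<in>G. real (g (1 - y)) * real (\<phi> (y + t)))\<^sup>2) =
     (\<Sum>t\<in>UNIV. \<Sum>y\<in>G. \<Sum>z\<in>G. real (g (1 - y)) * real (g (1 - z)) * (real (\<phi> (y + t)) * real (\<phi> (z + t))))"
    unfolding power2_eq_square sum_product by (intro sum.cong refl) (simp only: mult_ac)
  also have "\<dots> = (\<Sum>y\<in>G. \<Sum>z\<in>G. \<Sum>t\<in>UNIV. real (g (1 - y)) * real (g (1 - z)) * (real (\<phi> (y + t)) * real (\<phi> (z + t))))"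
    by (subst sum.swap, rule sum.cong[OF refl], rule sum.swap)
  also have "\<dots> = (\<Sum>y\<in>G. \<Sum>z\<in>G. v y z)"
    by (simp add: v_def corr_diff sum_distrib_left)
  also have "\<dots> = (\<Sum>yz\<in>G \<times> G. v (fst yz) (snd yz))" by (simp add: sum.cartesian_product case_prod_beta)
  also have "\<dots> = (\<Sum>yz\<in>pairs \<union> (\<lambda>y. (y, y)) ` (G - {1}). v (fst yz) (snd yz))"
  proof (rule sum.mono_neutral_right)
    show "\<forall>yz\<in>G \<times> G - (pairs \<union> (\<lambda>y. (y, y)) ` (G - {1})). v (fst yz) (snd yz) = 0"
    proof
      fix yz assume yz: "yz \<in> G \<times> G - (pairs \<union> (\<lambda>y. (y, y)) ` (G - {1}))"
      obtain y z where eq: "yz = (y, z)" by (cases yz)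
      have "y = 1 \<or> z = 1"
      proof (rule ccontr)
        assume "\<not> ?thesis"
        with yz show False unfolding eq by (cases "y = z") (auto simp: pairs_def)
      qed
      then show "v (fst yz) (snd yz) = 0" using g0 by (auto simp: eq v_def)
    qed
  qed (auto simp: pairs_def)
  also have "\<dots> = (\<Sum>yz\<in>pairs. v (fst yz) (snd yz)) + (\<Sum>yz\<in>(\<lambda>y. (y, y)) ` (G - {1}). v (fst yz) (snd yz))"
    by (rule sum.union_disjoint) (auto simp: pairs_def)
  also have "(\<Sum>yz\<in>(\<lambda>y. (y, y)) ` (G - {1}). v (fst yz) (snd yz)) = (\<Sum>y\<in>G - {1}. v y y)"
    by (subst sum.reindex) (auto simp: inj_on_def)
  also have "\<dots> = (\<Sum>y\<in>G. v y y)"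
    by (rule sum.mono_neutral_left) (auto simp: v_def g0)
  also have "\<dots> = real (corr \<phi> 0) * (\<Sum>y\<in>G. (real (g (1 - y)))\<^sup>2)"
    by (simp add: v_def sum_distrib_left power2_eq_square mult_ac)
  finally show ?thesis
    using dilation_average[OF inv', of "\<lambda>y. real (g (1 - y))"]
    by (simp add: v_def spread_def case_prod_beta add.commute)
qed

section \<open>The number of representations as a difference\<close>

definition ind :: "'a \<Rightarrow> nat" where "ind x = (if x \<in> G then 1 else 0)"

abbreviation \<rho> :: "'a \<Rightarrow> nat" where "\<rho> \<equiv> corr ind"

lemma sum_ind: "(\<Sum>t\<in>UNIV. ind t * F t) = (\<Sum>t\<in>G. F t)"
proof -
  have "(\<Sum>t\<in>UNIV. ind t * F t) = (\<Sum>t\<in>UNIV. if t \<in> G then F t else 0)"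
    by (intro sum.cong) (auto simp: ind_def)
  then show ?thesis by (simp add: sum.If_cases)
qed

lemma invariant_ind: "invariant ind"
proof -
  have "g * x \<in> G \<longleftrightarrow> x \<in> G" if "g \<in> G" for g x
    using that by (auto simp: G_def power_mult_distrib)
  then show ?thesis by (auto simp: invariant_def ind_def)
qed

lemma invariant_rho: "invariant \<rho>" by (rule invariant_corr[OF invariant_ind])

lemma spread_ind: "spread ind = \<rho>"
  by (rule ext) (simp add: corr_def sum_ind spread_def)

lemma rho_0: "\<rho> 0 = n"
  by (simp add: corr_def sum_ind) (simp add: ind_def card_G)

lemma sum_rho: "(\<Sum>x\<in>UNIV. \<rho> x) = n\<^sup>2"
  using sum_ind[of "\<lambda>_. 1"] by (simp add: sum_corr card_G)

lemma rho_le_n: "\<rho> x \<le> n" using corr_le_corr_0[of ind x] by (simp add: rho_0)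

lemma sum_G_differences_rho: "(\<Sum>x\<in>G. \<Sum>y\<in>G. k (x - y)) = (\<Sum>d\<in>UNIV. \<rho> d * k d)"
  for k :: "'a \<Rightarrow> nat"
proof -
  have "(\<Sum>d\<in>UNIV. \<rho> d * k d) = (\<Sum>d\<in>UNIV. \<Sum>y\<in>G. ind (y + d) * k d)"
    by (simp add: corr_def sum_ind sum_distrib_right)
  also have "\<dots> = (\<Sum>y\<in>G. \<Sum>d\<in>UNIV. ind (y + d) * k d)" by (rule sum.swap)
  also have "\<dots> = (\<Sum>y\<in>G. \<Sum>x\<in>UNIV. ind x * k (x - y))"
  proof (rule sum.cong[OF refl])
    fix y
    show "(\<Sum>d\<in>UNIV. ind (y + d) * k d) = (\<Sum>x\<in>UNIV. ind x * k (x - y))"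
      using sum_shift[of "\<lambda>x. ind x * k (x - y)" y] by simp
  qed
  also have "\<dots> = (\<Sum>y\<in>G. \<Sum>x\<in>G. k (x - y))" by (simp add: sum_ind)
  finally show ?thesis using sum.swap[of "\<lambda>x y. k (x - y)" G G] by simp
qed

text \<open>If t and t + x are in \<open>G\<close>, then u = (t + x) / x and 1 - u = - t / x have
  n-th powers depending only on x. This brings the level sets of \<open>\<rho>\<close> within reach
  of Stepanov's method, with distinct cosets of x giving distinct \<theta>.\<close>

lemma rho_eq_nsols:
  assumes "x \<noteq> 0"
  shows "\<rho> x = nsols n (inverse (x ^ n), (-1) ^ n * inverse (x ^ n))"
proof -
  have "\<rho> x = (\<Sum>t\<in>G. ind (t + x))" by (simp add: corr_def sum_ind)
  also have "\<dots> = card {t \<in> G. t + x \<in> G}" by (simp add: ind_def sum.If_cases Int_def)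
  also have "\<dots> = card (sols n (inverse (x ^ n), (-1) ^ n * inverse (x ^ n)))"
  proof (rule bij_betw_same_card[of "\<lambda>t. (t + x) / x"], rule bij_betw_byWitness[where f' = "\<lambda>u. u * x - x"])
    have sub: "1 - (t + x) / x = - t / x" for t using assms by (simp add: field_simps)
    show "(\<lambda>t. (t + x) / x) ` {t \<in> G. t + x \<in> G} \<subseteq> sols n (inverse (x ^ n), (-1) ^ n * inverse (x ^ n))"
    proof (rule image_subsetI)
      fix t assume "t \<in> {t \<in> G. t + x \<in> G}"
      then have "t ^ n = 1" "(t + x) ^ n = 1" by (auto simp: G_def)
      then show "(t + x) / x \<in> sols n (inverse (x ^ n), (-1) ^ n * inverse (x ^ n))"
        unfolding sols_def mem_Collect_eq sub power_divide power_minus[of t]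
        by (simp add: divide_inverse)
    qed
    show "(\<lambda>u. u * x - x) ` sols n (inverse (x ^ n), (-1) ^ n * inverse (x ^ n)) \<subseteq> {t \<in> G. t + x \<in> G}"
    proof (clarsimp simp: sols_def G_def, intro conjI)
      fix u assume u: "u ^ n = inverse (x ^ n)" "(1 - u) ^ n = (-1) ^ n * inverse (x ^ n)"
      have "(u * x - x) ^ n = (-1) ^ n * ((1 - u) ^ n * x ^ n)"
        by (simp add: power_mult_distrib[symmetric] algebra_simps)
      also have "\<dots> = ((-1) ^ n * (-1) ^ n) * (inverse (x ^ n) * x ^ n)" unfolding u by (simp only: mult_ac)
      also have "\<dots> = 1" using assms by (simp flip: power_mult_distrib)
      finally show "(u * x - x) ^ n = 1" .
      show "(u * x) ^ n = 1" using assms u by (simp add: power_mult_distrib)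
    qed
  qed (use assms in auto)
  finally show ?thesis by (simp add: nsols_def)
qed

lemma kappa_square_le: "n ^ 3 \<le> p\<^sup>2 \<Longrightarrow> \<kappa>\<^sup>2 \<le> real n"
proof -
  assume "n ^ 3 \<le> p\<^sup>2"
  then have "real (n ^ 3) \<le> real (p\<^sup>2)" by (simp only: of_nat_le_iff)
  then have "real n * real n ^ 3 \<le> real n * (real p)\<^sup>2" by (intro mult_left_mono) auto
  then have "((real n)\<^sup>2 / real p)\<^sup>2 \<le> real n"
    using p_pos by (simp add: power_divide divide_le_eq flip: power_mult power_Suc)
  then show ?thesis using n_pos by (auto simp: \<kappa>_def max_def)
qed

text \<open>Above 4096 \<kappa> this is Stepanov's bound. Below, the first moment gives k q \<le> n,
  and the remaining factor k^2 is at most 2^24 \<kappa>^2 \<le> 2^24 n; the last inequality is where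
  n^3 \<le> p^2 enters.\<close>

lemma q_rho_le:
  assumes np: "n ^ 3 \<le> p\<^sup>2"
  shows "real k ^ 3 * q \<rho> k \<le> 2 ^ 24 * (real n)\<^sup>2"
proof (cases "4096 * \<kappa> \<le> real k")
  case True
  define A where "A = (\<lambda>x. x ^ n) ` {x. x \<noteq> 0 \<and> k \<le> \<rho> x}"
  have "q \<rho> k = card ((\<lambda>a. (inverse a, (-1) ^ n * inverse a)) ` A)"
    unfolding q_def A_def[symmetric] by (subst card_image) (auto simp: inj_on_def)
  also have "\<dots> \<le> card {\<theta> \<in> nz. k \<le> nsols n \<theta>}"
    by (rule card_mono) (auto simp: A_def nz_def rho_eq_nsols)
  finally have "real k ^ 3 * q \<rho> k \<le> real k ^ 3 * card {\<theta> \<in> nz. k \<le> nsols n \<theta>}"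
    by (intro mult_left_mono) auto
  also have "\<dots> \<le> 2 ^ 14 * (real n)\<^sup>2" by (rule level_card_le[OF np True])
  also have "\<dots> \<le> 2 ^ 24 * (real n)\<^sup>2" by (intro mult_right_mono) auto
  finally show ?thesis .
next
  case False
  have "n * (k * q \<rho> k) = k * card {x. x \<noteq> 0 \<and> k \<le> \<rho> x}"
    by (simp add: n_times_q[OF invariant_rho, symmetric])
  also have "\<dots> = (\<Sum>x | x \<noteq> 0 \<and> k \<le> \<rho> x. k)" by simp
  also have "\<dots> \<le> (\<Sum>x | x \<noteq> 0 \<and> k \<le> \<rho> x. \<rho> x)" by (rule sum_mono) auto
  also have "\<dots> \<le> (\<Sum>x\<in>UNIV. \<rho> x)" by (rule sum_mono2) auto
  also have "\<dots> = n * n" by (simp add: sum_rho power2_eq_square)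
  finally have "k * q \<rho> k \<le> n" using n_pos by simp
  then have kq: "real (k * q \<rho> k) \<le> real n" by (simp only: of_nat_le_iff)
  have "real k ^ 3 * q \<rho> k = (real k)\<^sup>2 * real (k * q \<rho> k)" by (simp add: power2_eq_square power3_eq_cube)
  also have "\<dots> \<le> (4096 * \<kappa>)\<^sup>2 * real n"
    using False kq by (intro mult_mono power_mono) (auto simp del: of_nat_mult)
  also have "\<dots> = 2 ^ 24 * \<kappa>\<^sup>2 * real n" by (simp add: power_mult_distrib)
  also have "\<dots> \<le> 2 ^ 24 * real n * real n"
    using kappa_square_le[OF np] by (intro mult_right_mono mult_left_mono) auto
  finally show ?thesis by (simp add: power2_eq_square)
qed

lemma rho_square_tail_le:
  assumes np: "n ^ 3 \<le> p\<^sup>2" and m: "0 < m"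
  shows "(\<Sum>x | x \<noteq> 0 \<and> m < \<rho> x. (real (\<rho> x))\<^sup>2) \<le> 3 * (2 ^ 24 * real n ^ 3) / m"
proof -
  have "(\<Sum>x | x \<in> - {0} \<and> m < \<rho> x. (real (\<rho> x))\<^sup>2) \<le> 3 * (2 ^ 24 * real n ^ 3) / m"
  proof (rule square_tail_le[OF _ m])
    fix k assume "m < k"
    have "{a \<in> - {0}. k \<le> \<rho> a} = {x. x \<noteq> 0 \<and> k \<le> \<rho> x}" by auto
    then have "real (card {a \<in> - {0}. k \<le> \<rho> a}) = real n * real (q \<rho> k)"
      by (simp add: n_times_q[OF invariant_rho, symmetric])
    then show "real k ^ 3 * card {a \<in> - {0}. k \<le> \<rho> a} \<le> 2 ^ 24 * real n ^ 3"
      using mult_left_mono[OF q_rho_le[OF np, of k], of "real n"]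
      by (simp add: power2_eq_square power3_eq_cube mult_ac)
  qed simp
  then show ?thesis by simp
qed

lemma harm_eq: "harm m = (\<Sum>k = 1..m. 1 / real k)"
  by (simp add: harm_def inverse_eq_divide)

lemma harm_ge_1: "0 < m \<Longrightarrow> (1::real) \<le> harm m"
  unfolding harm_eq by (rule order.trans[OF _ member_le_sum[of 1]]) auto

text \<open>Each height k contributes k^2 times n^3 / k^3, so the third moment away from 0 carries
  one logarithm. It controls both the diagonal term and the Cauchy-Schwarz step for pairs of low
  multiplicity.\<close>

lemma rho_cubes_le:
  assumes np: "n ^ 3 \<le> p\<^sup>2"
  shows "(\<Sum>x\<in>- {0}. real (\<rho> x) ^ 3) \<le> 3 * 2 ^ 24 * real n ^ 3 * harm n"
proof -
  have cube: "real k ^ 3 \<le> (\<Sum>j\<in>{0<..k}. 3 * (real j)\<^sup>2)" for k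
  proof (induction k)
    case (Suc k)
    have "{0<..Suc k} = insert (Suc k) {0<..k}" by auto
    then show ?case using Suc by (simp add: power2_eq_square power3_eq_cube algebra_simps)
  qed simp
  have "(\<Sum>x\<in>- {0}. real (\<rho> x) ^ 3) \<le> (\<Sum>x\<in>- {0}. \<Sum>j\<in>{0<..\<rho> x}. 3 * (real j)\<^sup>2)"
    by (intro sum_mono cube)
  also have "\<dots> = (\<Sum>k\<in>{0<..n}. 3 * (real k)\<^sup>2 * card {x \<in> - {0}. k \<le> \<rho> x})"
    by (rule layer_cake) (auto simp: rho_le_n)
  also have "\<dots> \<le> (\<Sum>k\<in>{0<..n}. 3 * 2 ^ 24 * real n ^ 3 * (1 / real k))"
  proof (rule sum_mono)
    fix k assume k: "k \<in> {0<..n}"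
    have "{a \<in> - {0}. k \<le> \<rho> a} = {x. x \<noteq> 0 \<and> k \<le> \<rho> x}" by auto
    then have "real (card {a \<in> - {0}. k \<le> \<rho> a}) = real n * real (q \<rho> k)"
      by (simp add: n_times_q[OF invariant_rho, symmetric])
    then have "3 * (real k)\<^sup>2 * card {x \<in> - {0}. k \<le> \<rho> x} = 3 * real n / real k * (real k ^ 3 * q \<rho> k)"
      using k by (simp add: power2_eq_square power3_eq_cube)
    also have "\<dots> \<le> 3 * real n / real k * (2 ^ 24 * (real n)\<^sup>2)"
      by (intro mult_left_mono q_rho_le[OF np]) auto
    finally show "3 * (real k)\<^sup>2 * card {x \<in> - {0}. k \<le> \<rho> x} \<le> 3 * 2 ^ 24 * real n ^ 3 * (1 / real k)"
      by (simp add: power2_eq_square power3_eq_cube)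
  qed
  also have "\<dots> = 3 * 2 ^ 24 * real n ^ 3 * harm n"
    unfolding harm_eq sum_distrib_left[symmetric]
    by (intro arg_cong2[where f = "(*)"] sum.cong) auto
  finally show ?thesis .
qed

lemma sum_root_q_rho_le:
  assumes np: "n ^ 3 \<le> p\<^sup>2"
  shows "(\<Sum>k = 1..m. root 3 (q \<rho> k)) \<le> 2 ^ 8 * root 3 ((real n)\<^sup>2) * harm m"
proof -
  have "root 3 (q \<rho> k) \<le> 2 ^ 8 * root 3 ((real n)\<^sup>2) * (1 / real k)" if "k \<in> {1..m}" for k
  proof -
    have "root 3 (real k ^ 3 * q \<rho> k) \<le> root 3 (2 ^ 24 * (real n)\<^sup>2)"
      using q_rho_le[OF np, of k] by (intro real_root_le_mono) simp_all
    moreover have "root 3 (2 ^ 24) = (2 ^ 8 :: real)"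
      using real_root_power_cancel[of 3 "2 ^ 8 :: real"] by (simp only: power_mult[symmetric]) simp
    ultimately have "real k * root 3 (q \<rho> k) \<le> 2 ^ 8 * root 3 ((real n)\<^sup>2)"
      unfolding real_root_mult by (simp add: real_root_power_cancel)
    then show ?thesis using that by (simp add: field_simps)
  qed
  then show ?thesis unfolding harm_eq sum_distrib_left by (intro sum_mono) auto
qed

end

section \<open>The additive energy\<close>

lemma sum_inverse_two_thirds_le: "(\<Sum>i = 1..m. 1 / root 3 ((real i)\<^sup>2)) \<le> 3 * root 3 (real m)"
proof (induction m)
  case (Suc m)
  define a where "a = root 3 (real m)"
  define b where "b = root 3 (real (Suc m))"
  have ab: "0 \<le> a" "a \<le> b" "0 < b" by (simp_all add: a_def b_def)
  have b2: "root 3 ((real (Suc m))\<^sup>2) = b\<^sup>2" by (simp add: b_def real_root_power)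
  have "a ^ 3 = real m" "b ^ 3 = real (Suc m)" by (simp_all add: a_def b_def del: of_nat_Suc)
  then have "1 = (b - a) * (b\<^sup>2 + a * b + a\<^sup>2)" by (simp add: algebra_simps power2_eq_square power3_eq_cube)
  also have "\<dots> \<le> (b - a) * (b\<^sup>2 + b * b + b\<^sup>2)"
    using ab by (intro mult_left_mono add_mono mult_right_mono power_mono) auto
  finally have "1 / b\<^sup>2 \<le> 3 * (b - a)" using ab by (simp add: field_simps power2_eq_square)
  then show ?case using Suc by (simp add: b2 a_def b_def del: of_nat_Suc)
qed simp

context power_subgroup
begin

definition energy :: nat where "energy = (\<Sum>x\<in>UNIV. (\<rho> x)\<^sup>2)"

lemma energy_le: "energy \<le> n ^ 3"
proof -
  have "energy \<le> (\<Sum>x\<in>UNIV. n * \<rho> x)"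
    unfolding energy_def power2_eq_square by (intro sum_mono mult_right_mono rho_le_n) simp
  then show ?thesis by (simp add: sum_distrib_left[symmetric] sum_rho power2_eq_square power3_eq_cube)
qed

lemma energy_ge: "n\<^sup>2 \<le> energy"
  unfolding energy_def using member_le_sum[of 0 UNIV "\<lambda>x. (\<rho> x)\<^sup>2"] by (simp add: rho_0)

lemma q_le_second_moment:
  assumes "invariant f"
  shows "n * (i\<^sup>2 * q f i) \<le> (\<Sum>x\<in>UNIV. (f x)\<^sup>2)"
proof -
  have "n * (i\<^sup>2 * q f i) = i\<^sup>2 * card {x. x \<noteq> 0 \<and> i \<le> f x}"
    by (simp add: n_times_q[OF assms, symmetric])
  also have "\<dots> = (\<Sum>x | x \<noteq> 0 \<and> i \<le> f x. i\<^sup>2)" by simp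
  also have "\<dots> \<le> (\<Sum>x | x \<noteq> 0 \<and> i \<le> f x. (f x)\<^sup>2)" by (rule sum_mono) (auto intro: power_mono)
  also have "\<dots> \<le> (\<Sum>x\<in>UNIV. (f x)\<^sup>2)" by (rule sum_mono2) auto
  finally show ?thesis .
qed

lemma q_le_first_moment:
  assumes "invariant f"
  shows "n * (i * q f i) \<le> (\<Sum>x\<in>UNIV. f x)"
proof -
  have "n * (i * q f i) = i * card {x. x \<noteq> 0 \<and> i \<le> f x}"
    by (simp add: n_times_q[OF assms, symmetric])
  also have "\<dots> = (\<Sum>x | x \<noteq> 0 \<and> i \<le> f x. i)" by simp
  also have "\<dots> \<le> (\<Sum>x | x \<noteq> 0 \<and> i \<le> f x. f x)" by (rule sum_mono) auto
  also have "\<dots> \<le> (\<Sum>x\<in>UNIV. f x)" by (rule sum_mono2) auto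
  finally show ?thesis .
qed

text \<open>
  The pairs of low multiplicity matter only for \<open>n > sqrt p\<close>. They are treated by the Cauchy-Schwarz
  inequality against the third moment of \<^term>\<open>\<rho>\<close>, because there the number of solutions is at most
  \<open>4096 * \<kappa>\<close>.
\<close>

definition low :: "('a \<times> 'a) set" where
  "low = {(a, b). a \<noteq> 0 \<and> b \<noteq> 0 \<and> a \<noteq> b \<and> \<not> head ((b / a) ^ n, ((a - b) / a) ^ n)}"

text \<open>The summand depends only on the cosets of a, b and a - b. A triple of cosets is attained
  by at most 4096 \<kappa> n pairs, and dropping the relation between the three cosets lets the sum
  over triples factor into the cube of the sum of squares over cosets, which is at most E /
  n.\<close>

lemma low_square_sum_le:
  "(\<Sum>(a, b)\<in>low. (real (\<rho> a) * real (\<rho> b) * real (\<rho> (a - b)))\<^sup>2) \<le> 4096 * \<kappa> * real n * (real energy / real n) ^ 3"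
proof -
  \<comment> \<open>The choice of a representative of the coset is harmless because
    \<open>\<rho>\<close> is invariant; this makes its square a function of the n-th power.\<close>
  define R where "R \<alpha> = (real (\<rho> (SOME x. x ^ n = \<alpha>)))\<^sup>2" for \<alpha> :: 'a
  have R: "R (x ^ n) = (real (\<rho> x))\<^sup>2" if x: "x \<noteq> 0" for x
  proof -
    define y where "y = (SOME y. y ^ n = x ^ n)"
    have "y ^ n = x ^ n" unfolding y_def by (rule someI[of "\<lambda>y. y ^ n = x ^ n" x]) simp
    then obtain g where "g \<in> G" "y = g * x" using power_eq_coset[OF x] by auto
    then show ?thesis unfolding R_def y_def[symmetric] using invariantD[OF invariant_rho] by simp
  qed
  define cl where "cl = (\<lambda>x. x ^ n) ` (- {0::'a})"
  have R_sum: "real n * (\<Sum>\<alpha>\<in>cl. R \<alpha>) \<le> real energy"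
  proof -
    have "real n * (\<Sum>\<alpha>\<in>cl. R \<alpha>) = (\<Sum>x\<in>- {0}. R (x ^ n))"
      unfolding cl_def by (rule sum_over_classes[symmetric]) (auto simp: nonzero_G)
    also have "\<dots> = (\<Sum>x\<in>- {0}. (real (\<rho> x))\<^sup>2)" by (rule sum.cong) (auto simp: R)
    also have "\<dots> \<le> (\<Sum>x\<in>UNIV. (real (\<rho> x))\<^sup>2)" by (rule sum_mono2) auto
    finally show ?thesis by (simp add: energy_def)
  qed
  define e where "e = (\<lambda>(a, b). (a ^ n, b ^ n, (a - b) ^ n) :: 'a \<times> 'a \<times> 'a)"
  have e_cl: "e ` low \<subseteq> cl \<times> cl \<times> cl" by (auto simp: e_def low_def cl_def)
  \<comment> \<open>There are n choices for a in its coset, and then b / a is one of the solutions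
    for \<theta>, of which there are at most 4096 \<kappa> because \<theta> is not in
    \<open>head\<close>.\<close>
  have fibre: "real (card {ab \<in> low. e ab = \<tau>}) \<le> 4096 * \<kappa> * real n" if \<tau>: "\<tau> \<in> e ` low" for \<tau>
  proof -
    obtain a0 b0 where l0: "(a0, b0) \<in> low" "\<tau> = e (a0, b0)" using \<tau> by auto
    then have a0: "a0 \<noteq> 0" by (simp add: low_def)
    define \<theta> where "\<theta> = ((b0 / a0) ^ n, ((a0 - b0) / a0) ^ n)"
    have "\<not> head \<theta>" using l0 by (auto simp: low_def \<theta>_def)
    then have N: "real (nsols n \<theta>) \<le> 4096 * \<kappa>" by (auto simp: head_def)
    have "card {ab \<in> low. e ab = \<tau>} \<le> card ({a. a ^ n = a0 ^ n} \<times> sols n \<theta>)"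
    proof (rule card_inj_on_le[of "\<lambda>(a, b). (a, b / a)"])
      show "inj_on (\<lambda>(a, b). (a, b / a)) {ab \<in> low. e ab = \<tau>}"
        by (auto simp: inj_on_def low_def)
      show "(\<lambda>(a, b). (a, b / a)) ` {ab \<in> low. e ab = \<tau>} \<subseteq> {a. a ^ n = a0 ^ n} \<times> sols n \<theta>"
      proof (rule image_subsetI)
        fix ab assume ab: "ab \<in> {ab \<in> low. e ab = \<tau>}"
        obtain a b where eq: "ab = (a, b)" by (cases ab)
        from ab have "a \<noteq> 0" and pw: "a ^ n = a0 ^ n" "b ^ n = b0 ^ n" "(a - b) ^ n = (a0 - b0) ^ n"
          by (auto simp: eq low_def l0 e_def)
        then have "1 - b / a = (a - b) / a" by (simp add: diff_divide_distrib)
        then show "(\<lambda>(a, b). (a, b / a)) ab \<in> {a. a ^ n = a0 ^ n} \<times> sols n \<theta>"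
          using pw by (simp add: eq sols_def \<theta>_def power_divide)
      qed
    qed simp
    then have "real (card {ab \<in> low. e ab = \<tau>}) \<le> real (n * nsols n \<theta>)"
      unfolding of_nat_le_iff card_cartesian_product card_power_fibre[OF a0] by (simp add: nsols_def)
    also have "\<dots> \<le> real n * (4096 * \<kappa>)"
      using N by (simp add: mult_left_mono)
    finally show ?thesis by (simp add: mult.commute)
  qed
  have R0: "R \<alpha> \<ge> 0" for \<alpha> by (simp add: R_def)
  have k0: "\<kappa> \<ge> 0" using kappa_ge by linarith
  have "(\<Sum>(a, b)\<in>low. (real (\<rho> a) * real (\<rho> b) * real (\<rho> (a - b)))\<^sup>2)
    = (\<Sum>ab\<in>low. (\<lambda>(\<alpha>, \<beta>, \<gamma>). R \<alpha> * (R \<beta> * R \<gamma>)) (e ab))"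
    by (rule sum.cong) (auto simp: low_def e_def R power_mult_distrib)
  also have "\<dots> = (\<Sum>\<tau>\<in>e ` low. \<Sum>ab\<in>{ab \<in> low. e ab = \<tau>}. (\<lambda>(\<alpha>, \<beta>, \<gamma>). R \<alpha> * (R \<beta> * R \<gamma>)) (e ab))"
    by (rule sum.image_gen) simp
  also have "\<dots> = (\<Sum>\<tau>\<in>e ` low. real (card {ab \<in> low. e ab = \<tau>}) * (\<lambda>(\<alpha>, \<beta>, \<gamma>). R \<alpha> * (R \<beta> * R \<gamma>)) \<tau>)"
    by (rule sum.cong[OF refl]) simp
  also have "\<dots> \<le> (\<Sum>\<tau>\<in>e ` low. 4096 * \<kappa> * real n * (\<lambda>(\<alpha>, \<beta>, \<gamma>). R \<alpha> * (R \<beta> * R \<gamma>)) \<tau>)"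
    by (intro sum_mono mult_right_mono fibre) (auto simp: R0)
  also have "\<dots> \<le> (\<Sum>\<tau>\<in>cl \<times> cl \<times> cl. 4096 * \<kappa> * real n * (\<lambda>(\<alpha>, \<beta>, \<gamma>). R \<alpha> * (R \<beta> * R \<gamma>)) \<tau>)"
    by (rule sum_mono2[OF _ e_cl]) (auto simp: R0 k0)
  also have "\<dots> = 4096 * \<kappa> * real n * (\<Sum>\<alpha>\<in>cl. R \<alpha>) ^ 3"
  proof -
    have "(\<Sum>\<alpha>\<in>cl. R \<alpha>) ^ 3 = (\<Sum>\<alpha>\<in>cl. \<Sum>\<beta>\<in>cl. \<Sum>\<gamma>\<in>cl. R \<alpha> * (R \<beta> * R \<gamma>))"
      unfolding power3_eq_cube by (rule triple_sum_product)
    also have "\<dots> = (\<Sum>\<tau>\<in>cl \<times> cl \<times> cl. (\<lambda>(\<alpha>, \<beta>, \<gamma>). R \<alpha> * (R \<beta> * R \<gamma>)) \<tau>)"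
      by (simp add: sum.cartesian_product)
    finally show ?thesis by (simp add: sum_distrib_left)
  qed
  also have "\<dots> \<le> 4096 * \<kappa> * real n * (real energy / real n) ^ 3"
    using R_sum n_pos k0 by (intro mult_left_mono power_mono) (auto simp: field_simps R0 sum_nonneg)
  finally show ?thesis .
qed

text \<open>Expanding the square introduces two elements x, y of \<open>G\<close>; the conditions on
  a and on b then decouple, each leaving \<open>\<rho> (x - y)\<close>, and the difference x - y = d
  occurs \<open>\<rho> d\<close> times.\<close>

lemma third_moment_eq:
  "(\<Sum>ab\<in>UNIV. (real (card {x \<in> G. x - fst ab \<in> G \<and> x - snd ab \<in> G}))\<^sup>2) = (\<Sum>x\<in>UNIV. real (\<rho> x) ^ 3)"
proof -
  have c: "card {x \<in> G. x - fst ab \<in> G \<and> x - snd ab \<in> G} = (\<Sum>x\<in>G. ind (x - fst ab) * ind (x - snd ab))" for ab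
    by (simp add: ind_def sum.If_cases Int_def if_distrib[of "\<lambda>u. u * _"] cong: if_cong)
  have corr: "(\<Sum>a\<in>UNIV. ind (x - a) * ind (y - a)) = \<rho> (x - y)" for x y
  proof -
    have "(\<Sum>a\<in>UNIV. ind (x - a) * ind (y - a)) = (\<Sum>t\<in>UNIV. ind (y + t) * ind (x + t))"
      by (rule sum.reindex_bij_witness[of _ uminus uminus]) (auto simp: mult.commute)
    then show ?thesis by (simp add: corr_diff)
  qed
  have "(\<Sum>ab\<in>UNIV. (\<Sum>x\<in>G. ind (x - fst ab) * ind (x - snd ab))\<^sup>2)
    = (\<Sum>ab\<in>UNIV. \<Sum>x\<in>G. \<Sum>y\<in>G. (ind (x - fst ab) * ind (y - fst ab)) * (ind (x - snd ab) * ind (y - snd ab)))"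
    unfolding power2_eq_square sum_product by (intro sum.cong refl) (simp only: mult_ac)
  also have "\<dots> = (\<Sum>x\<in>G. \<Sum>y\<in>G. \<Sum>ab\<in>UNIV. (ind (x - fst ab) * ind (y - fst ab)) * (ind (x - snd ab) * ind (y - snd ab)))"
    by (subst sum.swap, rule sum.cong[OF refl], rule sum.swap)
  also have "\<dots> = (\<Sum>x\<in>G. \<Sum>y\<in>G. (\<rho> (x - y))\<^sup>2)"
  proof (intro sum.cong refl)
    fix x y
    have "(\<Sum>ab\<in>UNIV. (ind (x - fst ab) * ind (y - fst ab)) * (ind (x - snd ab) * ind (y - snd ab)))
      = (\<Sum>a\<in>UNIV. \<Sum>b\<in>UNIV. (ind (x - a) * ind (y - a)) * (ind (x - b) * ind (y - b)))"
      by (simp add: sum.cartesian_product UNIV_Times_UNIV case_prod_beta flip: UNIV_Times_UNIV)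
    also have "\<dots> = (\<rho> (x - y))\<^sup>2"
      unfolding power2_eq_square corr[symmetric] by (rule sum_product[symmetric])
    finally show "(\<Sum>ab\<in>UNIV. (ind (x - fst ab) * ind (y - fst ab)) * (ind (x - snd ab) * ind (y - snd ab))) = (\<rho> (x - y))\<^sup>2" .
  qed
  also have "\<dots> = (\<Sum>d\<in>UNIV. \<rho> d * (\<rho> d)\<^sup>2)"
    by (rule sum_G_differences_rho)
  also have "\<dots> = (\<Sum>d\<in>UNIV. \<rho> d ^ 3)" by (simp only: power2_eq_square power3_eq_cube mult.assoc)
  finally have "(\<Sum>ab\<in>UNIV. (card {x \<in> G. x - fst ab \<in> G \<and> x - snd ab \<in> G})\<^sup>2) = (\<Sum>d\<in>UNIV. \<rho> d ^ 3)"
    by (simp only: c)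
  then show ?thesis
    by (metis (no_types, lifting) of_nat_power of_nat_sum sum.cong)
qed

text \<open>Dilating each pair (y, z) by all x in \<open>G\<close> gives n copies of the sum, now
  over pairs of differences a = x - x y and b = x - x z. The number of copies meeting a given (a, b)
  is bounded by the quantity in \<open>third_moment_eq\<close>, and the Cauchy-Schwarz inequality
  separates it from the weights.\<close>

lemma low_pairs_square_le:
  "(real n * (\<Sum>(y, z)\<in>{yz \<in> pairs. \<not> head (shape yz)}. real (\<rho> (1 - y)) * real (\<rho> (1 - z)) * real (\<rho> (z - y))))\<^sup>2
    \<le> (\<Sum>x\<in>UNIV. real (\<rho> x) ^ 3) * (4096 * \<kappa> * real n * (real energy / real n) ^ 3)"
proof -
  define P where "P = {yz \<in> pairs. \<not> head (shape yz)}"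
  define v where "v ab = real (\<rho> (fst ab)) * real (\<rho> (snd ab)) * real (\<rho> (fst ab - snd ab))" for ab
  define c where "c ab = real (card {x \<in> G. x - fst ab \<in> G \<and> x - snd ab \<in> G})" for ab
  define \<delta> where "\<delta> = (\<lambda>(x, y, z). (x - x * y, x - x * z) :: 'a \<times> 'a)"
  have \<delta>_low: "\<delta> ` (G \<times> P) \<subseteq> low"
  proof (rule image_subsetI)
    fix xyz assume A: "xyz \<in> G \<times> P"
    obtain x y z where eq: "xyz = (x, y, z)" by (cases xyz)
    have x: "x \<noteq> 0" and yz: "y \<noteq> 1" "z \<noteq> 1" "y \<noteq> z" and nh: "\<not> head (shape (y, z))"
      using A by (auto simp: eq P_def pairs_def nonzero_G)
    have f: "x - x * y = x * (1 - y)" "x - x * z = x * (1 - z)" "x * (1 - y) - x * (1 - z) = x * (z - y)"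
      by (simp_all add: algebra_simps)
    show "\<delta> xyz \<in> low"
      using x yz nh unfolding eq \<delta>_def low_def prod.case mem_Collect_eq f
      by (simp add: shape_def)
  qed
  have vd: "v (\<delta> (x, y, z)) = real (\<rho> (1 - y)) * real (\<rho> (1 - z)) * real (\<rho> (z - y))" if x: "x \<in> G" for x y z
  proof -
    have f: "x - x * y = x * (1 - y)" "x - x * z = x * (1 - z)" "x * (1 - y) - x * (1 - z) = x * (z - y)"
      by (simp_all add: algebra_simps)
    show ?thesis unfolding v_def \<delta>_def prod.case fst_conv snd_conv f
      using invariantD[OF invariant_rho x] by simp
  qed
  have "real n * (\<Sum>(y, z)\<in>P. real (\<rho> (1 - y)) * real (\<rho> (1 - z)) * real (\<rho> (z - y)))
    = (\<Sum>x\<in>G. \<Sum>(y, z)\<in>P. v (\<delta> (x, y, z)))"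
    by (simp add: vd card_G)
  also have "\<dots> = (\<Sum>t\<in>G \<times> P. v (\<delta> t))" by (simp add: sum.cartesian_product case_prod_beta)
  also have "\<dots> = (\<Sum>ab\<in>low. \<Sum>t\<in>{t. t \<in> G \<times> P \<and> \<delta> t = ab}. v (\<delta> t))"
    by (rule sum.group[symmetric, OF _ _ \<delta>_low]) auto
  also have "\<dots> = (\<Sum>ab\<in>low. real (card {t. t \<in> G \<times> P \<and> \<delta> t = ab}) * v ab)"
    by (rule sum.cong[OF refl]) simp
  also have "\<dots> \<le> (\<Sum>ab\<in>low. c ab * v ab)"
  proof (rule sum_mono, rule mult_right_mono)
    fix ab
    \<comment> \<open>Given (a, b), the dilation x determines y and z, and both x - a = x y and x -
      b = x z lie in \<open>G\<close>.\<close>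
    have "card {t. t \<in> G \<times> P \<and> \<delta> t = ab} \<le> card {x \<in> G. x - fst ab \<in> G \<and> x - snd ab \<in> G}"
    proof (rule card_inj_on_le[of fst])
      show "inj_on fst {t. t \<in> G \<times> P \<and> \<delta> t = ab}"
        by (auto simp: inj_on_def \<delta>_def nonzero_G)
      show "fst ` {t. t \<in> G \<times> P \<and> \<delta> t = ab} \<subseteq> {x \<in> G. x - fst ab \<in> G \<and> x - snd ab \<in> G}"
        by (auto simp: \<delta>_def P_def pairs_def mult_G)
    qed simp
    then show "real (card {t. t \<in> G \<times> P \<and> \<delta> t = ab}) \<le> c ab" by (simp add: c_def)
    show "0 \<le> v ab" by (simp add: v_def)
  qed
  finally have le: "real n * (\<Sum>(y, z)\<in>P. real (\<rho> (1 - y)) * real (\<rho> (1 - z)) * real (\<rho> (z - y))) \<le> (\<Sum>ab\<in>low. c ab * v ab)" .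
  have "0 \<le> real n * (\<Sum>(y, z)\<in>P. real (\<rho> (1 - y)) * real (\<rho> (1 - z)) * real (\<rho> (z - y)))"
    by (intro mult_nonneg_nonneg sum_nonneg) auto
  then have "(real n * (\<Sum>(y, z)\<in>P. real (\<rho> (1 - y)) * real (\<rho> (1 - z)) * real (\<rho> (z - y))))\<^sup>2 \<le> (\<Sum>ab\<in>low. c ab * v ab)\<^sup>2"
    by (rule power_mono[OF le])
  also have "\<dots> \<le> (\<Sum>ab\<in>low. (c ab)\<^sup>2) * (\<Sum>ab\<in>low. (v ab)\<^sup>2)"
    by (rule Cauchy_Schwarz_ineq_sum)
  also have "\<dots> \<le> (\<Sum>x\<in>UNIV. real (\<rho> x) ^ 3) * (4096 * \<kappa> * real n * (real energy / real n) ^ 3)"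
  proof (rule mult_mono)
    have "(\<Sum>ab\<in>low. (c ab)\<^sup>2) \<le> (\<Sum>ab\<in>UNIV. (c ab)\<^sup>2)" by (rule sum_mono2) auto
    also have "\<dots> = (\<Sum>x\<in>UNIV. real (\<rho> x) ^ 3)" unfolding c_def by (rule third_moment_eq)
    finally show "(\<Sum>ab\<in>low. (c ab)\<^sup>2) \<le> (\<Sum>x\<in>UNIV. real (\<rho> x) ^ 3)" .
    show "(\<Sum>ab\<in>low. (v ab)\<^sup>2) \<le> 4096 * \<kappa> * real n * (real energy / real n) ^ 3"
      using low_square_sum_le by (simp add: v_def case_prod_beta)
  qed (auto intro!: sum_nonneg)
  finally show ?thesis by (simp add: P_def)
qed

text \<open>Here r stands for the cube root of n, and \<open>D\<close>, \<open>hd\<close>,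
  \<open>tl\<close> for the diagonal, the pairs of high and those of low multiplicity. The estimate
  for \<open>tl\<close> involves E itself, so the inequality has to be solved for u = E^3.\<close>

lemma energy_le_aux:
  fixes r H Q D hd tl E A k :: real
  assumes r: "1 \<le> r" and H: "1 \<le> H" and E: "0 \<le> E" and k: "0 \<le> k"
    and main: "E ^ 3 \<le> 4 * r ^ 12 * (D + hd + tl)"
    and D: "D \<le> 3 * 2 ^ 24 * r ^ 9 * H" and hd: "hd \<le> 2 ^ 58 * r ^ 10 * H"
    and tl: "(r ^ 3 * tl)\<^sup>2 \<le> (r ^ 9 + 3 * 2 ^ 24 * r ^ 9 * H) * (4096 * k * r ^ 3 * (E / r ^ 3) ^ 3)"
  shows "E ^ 3 \<le> 2 ^ 62 * H * (r ^ 22 + r ^ 21 * k)"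
proof -
  have pw: "r ^ 9 \<le> r ^ 10" "0 < r ^ 3" using r by (auto intro: power_increasing)
  define u where "u = E ^ 3"
  have u0: "0 \<le> u" using E by (simp add: u_def)
  define b where "b = 2 ^ 42 * r ^ 21 * H * k"
  have b0: "0 \<le> b" using r H k by (simp add: b_def)
  have "D + hd \<le> 2 ^ 26 * (r ^ 10 * H) + 2 ^ 58 * (r ^ 10 * H)"
  proof -
    have "D \<le> 3 * 2 ^ 24 * (r ^ 9 * H)" using D by simp
    also have "\<dots> \<le> 2 ^ 26 * (r ^ 10 * H)" using pw H r by (intro mult_mono) auto
    finally show ?thesis using hd unfolding mult.assoc by (rule add_mono)
  qed
  moreover have "0 \<le> r ^ 10 * H" using r H by simp
  then have "(2 ^ 26 + 2 ^ 58) * (r ^ 10 * H) \<le> 2 ^ 59 * (r ^ 10 * H)" by (rule mult_right_mono[rotated]) simp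
  ultimately have Dh: "D + hd \<le> 2 ^ 59 * (r ^ 10 * H)" unfolding distrib_right by (rule order.trans)
  have "r ^ 9 + 3 * 2 ^ 24 * r ^ 9 * H \<le> 2 ^ 26 * (r ^ 9 * H)"
    using mult_left_mono[OF H, of "r ^ 9"] r by simp
  then have "(r ^ 3 * tl)\<^sup>2 \<le> 2 ^ 26 * (r ^ 9 * H) * (4096 * k * r ^ 3 * (E / r ^ 3) ^ 3)"
    using tl r k E by (elim order.trans) (intro mult_right_mono, auto)
  also have "\<dots> = 2 ^ 38 * r ^ 3 * H * k * u"
    using r by (simp add: u_def power_divide field_simps flip: power_add power_mult)
  finally have tl2: "(r ^ 3 * tl)\<^sup>2 \<le> 2 ^ 38 * r ^ 3 * H * k * u" .
  have "(4 * r ^ 12 * tl)\<^sup>2 = 16 * r ^ 18 * (r ^ 3 * tl)\<^sup>2"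
    by (simp add: power_mult_distrib flip: power_add power_mult)
  also have "\<dots> \<le> 16 * r ^ 18 * (2 ^ 38 * r ^ 3 * H * k * u)"
    using tl2 r by (intro mult_left_mono) auto
  also have "\<dots> = b * u" by (simp add: b_def power_add[symmetric] mult_ac)
  \<comment> \<open>The inequality of arithmetic and geometric means leaves only half of u on the
    right, which the left-hand side absorbs.\<close>
  also have "\<dots> \<le> ((b + u) / 2)\<^sup>2"
    using zero_le_power2[of "b - u"] by (simp add: power2_eq_square field_simps)
  finally have "4 * r ^ 12 * tl \<le> (b + u) / 2"
    using b0 u0 by (intro power2_le_imp_le[of "4 * r ^ 12 * tl"]) auto
  moreover have "4 * r ^ 12 * (D + hd) \<le> 4 * r ^ 12 * (2 ^ 59 * (r ^ 10 * H))"
    using Dh r by (intro mult_left_mono) auto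
  moreover have "4 * r ^ 12 * (2 ^ 59 * (r ^ 10 * H)) = 2 ^ 61 * r ^ 22 * H"
    by (simp add: power_add[symmetric] mult_ac)
  moreover have "u \<le> 4 * r ^ 12 * (D + hd) + 4 * r ^ 12 * tl"
    using main unfolding u_def[symmetric] by (simp only: distrib_left add.assoc)
  ultimately have "u \<le> 2 ^ 61 * r ^ 22 * H + (b + u) / 2" by linarith
  then have "u \<le> 2 * (2 ^ 61 * r ^ 22 * H) + b" unfolding le_divide_eq_numeral1 by argo
  then have "u \<le> 2 ^ 62 * r ^ 22 * H + b" by simp
  moreover have "b \<le> 2 ^ 62 * r ^ 21 * H * k"
    unfolding b_def using r H k by (intro mult_right_mono) auto
  ultimately show ?thesis by (simp add: u_def algebra_simps)
qed

theorem energy_bound: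
  assumes np: "n ^ 3 \<le> p\<^sup>2"
  shows "real energy ^ 3 \<le> 2 ^ 63 * harm n * (root 3 (real n ^ 22) + real n ^ 9 / real p)"
proof -
  define E where "E = real energy"
  define r where "r = root 3 (real n)"
  have r1: "1 \<le> r" using n_pos by (simp add: r_def)
  have rn: "r ^ 3 = real n" by (simp add: r_def)
  have rt: "root 3 (real n ^ m) = r ^ m" for m by (simp add: r_def real_root_power)
  have nr: "real n ^ m = r ^ (3 * m)" for m by (simp add: power_mult rn)
  have H1: "(1::real) \<le> harm n" by (rule harm_ge_1[OF n_pos])
  have E_ge: "(real n)\<^sup>2 \<le> E" using energy_ge unfolding E_def of_nat_power[symmetric] of_nat_le_iff .
  have E0: "0 < E" using E_ge n_pos by (smt (verit) of_nat_0_less_iff zero_less_power)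
  have E_le: "E \<le> real n ^ 3" using energy_le unfolding E_def of_nat_power[symmetric] of_nat_le_iff .
  have k_le: "\<kappa> \<le> 1 + (real n)\<^sup>2 / real p" by (simp add: \<kappa>_def)
  have "E ^ 3 \<le> 2 ^ 62 * harm n * (r ^ 22 + r ^ 21 * \<kappa>)"
  proof (cases "E < 4 * (real n)\<^sup>2")
    case True
    then have "E ^ 3 \<le> (4 * (real n)\<^sup>2) ^ 3" using E0 by (intro power_mono) auto
    also have "\<dots> = 64 * r ^ 18" by (simp add: power_mult_distrib nr flip: power_mult)
    also have "\<dots> \<le> 2 ^ 62 * harm n * (r ^ 22 + r ^ 21 * \<kappa>)"
    proof -
      have "r ^ 18 \<le> r ^ 22" using r1 by (intro power_increasing) auto
      also have "\<dots> \<le> r ^ 22 + r ^ 21 * \<kappa>" using r1 kappa_ge(1) by simp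
      finally have *: "1 * r ^ 18 \<le> harm n * (r ^ 22 + r ^ 21 * \<kappa>)"
        using H1 r1 by (intro mult_mono) auto
      have "64 * (1 * r ^ 18) \<le> 2 ^ 62 * (harm n * (r ^ 22 + r ^ 21 * \<kappa>))"
        by (rule mult_mono[OF _ *]) (use r1 in auto)
      then show ?thesis by (simp only: mult.assoc mult_1)
    qed
    finally show ?thesis .
  next
    case False
    \<comment> \<open>Cutting \<^term>\<open>\<rho>\<close> off at \<open>K\<close> loses at most half of the energy, and it removes the logarithm from two
      of the three sums in the trilinear estimate.\<close>
    define K where "K = nat \<lceil>2 ^ 28 * real n ^ 3 / E\<rceil>"
    define c where "c = real n ^ 3 / E"
    have c: "1 \<le> c" "2 ^ 28 * real n ^ 3 / E = 2 ^ 28 * c" "2 ^ 29 * real n ^ 3 / E = 2 ^ 29 * c"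
      using E_le E0 by (simp_all add: c_def)
    have pow2: "(2::real) ^ 28 = 268435456" "(2::real) ^ 29 = 536870912" by simp_all
    have K: "2 ^ 28 * real n ^ 3 / E \<le> real K" "real K \<le> 2 ^ 29 * real n ^ 3 / E" "0 < K"
      using c(1) unfolding K_def c(2,3) unfolding pow2 by linarith+
    define g where "g x = (if x = 0 then 0 else min (\<rho> x) K)" for x
    have inv_g: "invariant g"
      unfolding invariant_def g_def using invariantD[OF invariant_rho] nonzero_G by auto
    define W where "W = (\<Sum>y\<in>G. g (1 - y))"
    have nW: "n * W = (\<Sum>d\<in>UNIV. \<rho> d * g d)"
      unfolding W_def using sum_G_differences[OF inv_g] sum_G_differences_rho[of g] by simp
    have W_ge: "E / 2 \<le> real n * real W"
    proof -
      have "E = (\<Sum>d\<in>UNIV. (real (\<rho> d))\<^sup>2)" by (simp add: E_def energy_def)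
      \<comment> \<open>Three sources: the truncated weight, the point 0, and the part above the
        cutoff, each of the last two worth at most E / 4.\<close>
      also have "\<dots> \<le> (\<Sum>d\<in>UNIV. real (\<rho> d) * real (g d) + (if d = 0 then (real n)\<^sup>2 else 0)
           + (if d \<noteq> 0 \<and> K < \<rho> d then (real (\<rho> d))\<^sup>2 else 0))"
        by (rule sum_mono) (auto simp: g_def power2_eq_square rho_0 min_def)
      also have "\<dots> = real n * real W + (real n)\<^sup>2 + (\<Sum>d | d \<noteq> 0 \<and> K < \<rho> d. (real (\<rho> d))\<^sup>2)"
        unfolding of_nat_mult[symmetric] nW by (simp add: sum.distrib sum.If_cases Int_def)
      also have "\<dots> \<le> real n * real W + E / 4 + 3 * (2 ^ 24 * real n ^ 3) / real K"
        using False rho_square_tail_le[OF np K(3)] by (intro add_mono) auto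
      \<comment> \<open>This fixes the factor 2^28 in \<open>K\<close>: what lies above the cutoff
        is at most 3/16 of the energy.\<close>
      also have "3 * (2 ^ 24 * real n ^ 3) / real K \<le> E / 4"
      proof -
        define X where "X = real n ^ 3"
        have "2 ^ 28 * X \<le> E * real K" using K(1) E0 by (simp add: field_simps X_def)
        moreover have "0 \<le> X" by (simp add: X_def)
        ultimately have "3 * (2 ^ 24 * X) \<le> E * real K / 4" by simp
        then have "3 * (2 ^ 24 * real n ^ 3) \<le> E * real K / 4" by (simp only: X_def)
        then show ?thesis using K(3) by (simp add: field_simps)
      qed
      finally show ?thesis by simp
    qed
    define D where "D = real n * (\<Sum>y\<in>G. (real (g (1 - y)))\<^sup>2)"
    define t where "t yz = real (g (1 - fst yz)) * real (g (1 - snd yz)) * real (\<rho> (snd yz - fst yz))" for yz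
    define hd where "hd = (\<Sum>yz\<in>{yz \<in> pairs. head (shape yz)}. t yz)"
    define tl where "tl = (\<Sum>yz\<in>{yz \<in> pairs. \<not> head (shape yz)}. t yz)"
    have split: "(\<Sum>yz\<in>pairs. t yz) = hd + tl"
      unfolding hd_def tl_def by (subst sum.union_disjoint[symmetric]) (auto intro!: sum.cong)
    have ineq: "(real W)\<^sup>2 * E \<le> (real n)\<^sup>2 * (D + hd + tl)"
      using pair_sum_lower_bound[OF invariant_ind, of g] split
      by (simp add: spread_ind rho_0 g_def[of 0] W_def D_def E_def energy_def t_def case_prod_beta add.assoc)
    have main: "E ^ 3 \<le> 4 * r ^ 12 * (D + hd + tl)"
    proof -
      have "(E / 2)\<^sup>2 * E \<le> (real n * real W)\<^sup>2 * E"
        using W_ge E0 by (intro mult_right_mono power_mono) auto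
      also have "\<dots> \<le> (real n)\<^sup>2 * ((real n)\<^sup>2 * (D + hd + tl))"
        using mult_left_mono[OF ineq, of "(real n)\<^sup>2"] by (simp add: power_mult_distrib mult.assoc)
      also have "\<dots> = r ^ 12 * (D + hd + tl)" by (simp add: nr mult.assoc[symmetric] power_add[symmetric])
      finally show ?thesis by (simp add: power2_eq_square power3_eq_cube)
    qed
    have D_le: "D \<le> 3 * 2 ^ 24 * r ^ 9 * harm n"
    proof -
      have "invariant (\<lambda>x. (g x)\<^sup>2)" using inv_g by (simp add: invariant_def)
      from sum_G_differences[OF this] sum_G_differences_rho[of "\<lambda>x. (g x)\<^sup>2"]
      have "n * (\<Sum>y\<in>G. (g (1 - y))\<^sup>2) = (\<Sum>d\<in>UNIV. \<rho> d * (g d)\<^sup>2)" by simp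
      then have "real (n * (\<Sum>y\<in>G. (g (1 - y))\<^sup>2)) = real (\<Sum>d\<in>UNIV. \<rho> d * (g d)\<^sup>2)" by simp
      then have "D = (\<Sum>d\<in>UNIV. real (\<rho> d) * (real (g d))\<^sup>2)" by (simp add: D_def)
      also have "\<dots> = (\<Sum>d\<in>- {0}. real (\<rho> d) * (real (g d))\<^sup>2)"
        by (rule sum.mono_neutral_right) (auto simp: g_def)
      also have "\<dots> \<le> (\<Sum>d\<in>- {0}. real (\<rho> d) ^ 3)"
      proof (rule sum_mono)
        fix d
        have "real (\<rho> d) * (real (g d))\<^sup>2 \<le> real (\<rho> d) * (real (\<rho> d))\<^sup>2"
          by (intro mult_left_mono power_mono) (auto simp: g_def)
        then show "real (\<rho> d) * (real (g d))\<^sup>2 \<le> real (\<rho> d) ^ 3" by (simp add: power2_eq_square power3_eq_cube)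
      qed
      also have "\<dots> \<le> 3 * 2 ^ 24 * real n ^ 3 * harm n" by (rule rho_cubes_le[OF np])
      finally show ?thesis by (simp add: nr)
    qed
    have hd_le: "hd \<le> 2 ^ 58 * r ^ 10 * harm n"
    proof -
      \<comment> \<open>Up to \<open>K\<close> the second moment is the better bound on the number
        of cosets: q \<le> E / (n i^2) has cube roots that sum to (E K / n)^(1/3), of order n^(2/3),
        with no logarithm.\<close>
      have s1: "(\<Sum>i = 1..K. root 3 (q g i)) \<le> 3 * (2 ^ 10 * r\<^sup>2)"
      proof -
        have "root 3 (q g i) \<le> root 3 (E / real n) * (1 / root 3 ((real i)\<^sup>2))" if i: "i \<in> {1..K}" for i
        proof -
          have "q g i \<le> q \<rho> i" unfolding q_def by (intro card_mono image_mono) (auto simp: g_def)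
          then have "n * (i\<^sup>2 * q g i) \<le> energy"
            using q_le_second_moment[OF invariant_rho, of i] unfolding energy_def[symmetric]
            by (meson mult_le_mono2 order.trans)
          then have "real (n * (i\<^sup>2 * q g i)) \<le> E" unfolding E_def by (simp only: of_nat_le_iff)
          then have "(real i)\<^sup>2 * real (q g i) \<le> E / real n" using n_pos by (simp add: field_simps)
          then have "root 3 ((real i)\<^sup>2 * real (q g i)) \<le> root 3 (E / real n)" by simp
          moreover have "0 < root 3 ((real i)\<^sup>2)" using i by simp
          ultimately show ?thesis by (simp add: real_root_mult field_simps)
        qed
        then have "(\<Sum>i = 1..K. root 3 (q g i)) \<le> root 3 (E / real n) * (\<Sum>i = 1..K. 1 / root 3 ((real i)\<^sup>2))"
          unfolding sum_distrib_left by (intro sum_mono) auto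
        also have "\<dots> \<le> root 3 (E / real n) * (3 * root 3 (real K))"
          using E0 by (intro mult_left_mono sum_inverse_two_thirds_le) auto
        also have "\<dots> = 3 * root 3 (E * real K / real n)" by (simp add: real_root_mult real_root_divide)
        also have "root 3 (E * real K / real n) \<le> root 3 (2 ^ 30 * (real n)\<^sup>2)"
        proof (rule real_root_le_mono)
          have "E * real K \<le> 2 ^ 29 * real n ^ 3" using K(2) E0 by (simp add: field_simps)
          \<comment> \<open>Rounding the exponent up to a multiple of 3 makes the cube root of the
            constant exact.\<close>
          also have "\<dots> \<le> 2 ^ 30 * real n ^ 3" by simp
          finally show "E * real K / real n \<le> 2 ^ 30 * (real n)\<^sup>2"
            using n_pos by (simp add: field_simps power2_eq_square power3_eq_cube)
        qed simp
        also have "root 3 (2 ^ 30 * (real n)\<^sup>2) = 2 ^ 10 * r\<^sup>2"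
          using real_root_power_cancel[of 3 "2 ^ 10 :: real"] unfolding real_root_mult rt
          by (simp only: power_mult[symmetric]) simp
        finally show ?thesis by simp
      qed
      have s2: "(\<Sum>k = 1..n. root 3 (q \<rho> k)) \<le> 2 ^ 8 * r\<^sup>2 * harm n"
        using sum_root_q_rho_le[OF np, of n] by (simp add: rt)
      have "(\<Sum>(y, z)\<in>{yz \<in> pairs. head (shape yz)}. real (g (1 - y)) * real (g (1 - z)) * real (\<rho> (z - y)))
         \<le> 2 ^ 26 * root 3 (real n ^ 4) * (\<Sum>i = 1..K. root 3 (q g i))\<^sup>2 * (\<Sum>k = 1..n. root 3 (q \<rho> k))"
      proof (rule trilinear_le)
        fix \<Theta> T assume "real (card (\<Theta> :: ('a \<times> 'a) set)) \<le> T"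
        from head_pairs_le[OF np this]
        show "real (card {yz \<in> {yz \<in> pairs. head (shape yz)}. shape yz \<in> \<Theta>}) \<le> 2 ^ 26 * root 3 (real n ^ 4 * T)"
          by (simp add: conj_ac)
      qed (auto simp: g_def rho_le_n)
      also have "\<dots> \<le> 2 ^ 26 * r ^ 4 * (3 * (2 ^ 10 * r\<^sup>2))\<^sup>2 * (2 ^ 8 * r\<^sup>2 * harm n)"
        unfolding rt using s1 s2 r1 by (intro mult_mono power_mono order.refl) (auto intro!: sum_nonneg)
      finally have "hd \<le> 2 ^ 26 * r ^ 4 * (3 * (2 ^ 10 * r\<^sup>2))\<^sup>2 * (2 ^ 8 * r\<^sup>2 * harm n)"
        by (simp add: hd_def t_def case_prod_beta)
      also have "\<dots> = (9 * 2 ^ 54) * (r ^ 10 * harm n)"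
        by (simp add: power_mult_distrib power_add[symmetric] power_mult[symmetric] mult_ac)
      also have "\<dots> \<le> 2 ^ 58 * (r ^ 10 * harm n)" using r1 H1 by (intro mult_right_mono) auto
      finally show ?thesis by (simp only: mult.assoc)
    qed
    have tl_sq: "(r ^ 3 * tl)\<^sup>2 \<le> (r ^ 9 + 3 * 2 ^ 24 * r ^ 9 * harm n) * (4096 * \<kappa> * r ^ 3 * (E / r ^ 3) ^ 3)"
    proof -
      define tl' where "tl' = (\<Sum>(y, z)\<in>{yz \<in> pairs. \<not> head (shape yz)}. real (\<rho> (1 - y)) * real (\<rho> (1 - z)) * real (\<rho> (z - y)))"
      have "0 \<le> tl" unfolding tl_def t_def by (rule sum_nonneg) auto
      moreover have "tl \<le> tl'"
        unfolding tl_def tl'_def t_def case_prod_beta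
        by (intro sum_mono mult_mono) (auto simp: g_def)
      ultimately have "(real n * tl)\<^sup>2 \<le> (real n * tl')\<^sup>2"
        by (intro power_mono mult_left_mono) auto
      also have "\<dots> \<le> (\<Sum>x\<in>UNIV. real (\<rho> x) ^ 3) * (4096 * \<kappa> * real n * (E / real n) ^ 3)"
        unfolding tl'_def E_def by (rule low_pairs_square_le)
      also have "\<dots> \<le> (real n ^ 3 + 3 * 2 ^ 24 * real n ^ 3 * harm n) * (4096 * \<kappa> * real n * (E / real n) ^ 3)"
      proof (rule mult_right_mono)
        have "(\<Sum>x\<in>UNIV. real (\<rho> x) ^ 3) = (\<Sum>x\<in>insert 0 (- {0}). real (\<rho> x) ^ 3)"
          by (rule sum.cong) auto
        also have "\<dots> = real n ^ 3 + (\<Sum>x\<in>- {0}. real (\<rho> x) ^ 3)"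
          by (subst sum.insert) (auto simp: rho_0)
        finally show "(\<Sum>x\<in>UNIV. real (\<rho> x) ^ 3) \<le> real n ^ 3 + 3 * 2 ^ 24 * real n ^ 3 * harm n"
          using rho_cubes_le[OF np] by simp
        show "0 \<le> 4096 * \<kappa> * real n * (E / real n) ^ 3" using kappa_ge(1) E0 by simp
      qed
      finally show ?thesis by (simp add: rn nr[of 3])
    qed
    show ?thesis
      by (rule energy_le_aux[OF r1 H1 _ _ main D_le hd_le tl_sq]) (use E0 kappa_ge in auto)
  qed
  also have "\<dots> \<le> 2 ^ 62 * harm n * (r ^ 22 + r ^ 21 * (1 + (real n)\<^sup>2 / real p))"
    using k_le H1 r1 by (intro mult_left_mono add_left_mono) auto
  also have "\<dots> = 2 ^ 62 * harm n * (r ^ 22 + r ^ 21 + real n ^ 9 / real p)"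
    by (simp add: nr algebra_simps flip: power_add)
  also have "\<dots> \<le> 2 ^ 62 * harm n * (2 * (r ^ 22 + real n ^ 9 / real p))"
  proof (intro mult_left_mono)
    have "r ^ 21 \<le> r ^ 22" using r1 by (intro power_increasing) auto
    moreover have "0 \<le> real n ^ 9 / real p" by simp
    ultimately show "r ^ 22 + r ^ 21 + real n ^ 9 / real p \<le> 2 * (r ^ 22 + real n ^ 9 / real p)" by argo
  qed (use H1 in simp)
  finally show ?thesis by (simp add: E_def rt mult_ac)
qed

end

section \<open>Threefold and fourfold sums\<close>

context power_subgroup
begin

text \<open>For a slope g, let \<open>\<nu> g t\<close> count the c in \<open>G\<close> with g c + t
  in \<open>G\<close>. Summed over all slopes, the variance of \<open>\<nu> g\<close> is at most p
  n^2, because g (c - d) runs through the whole field when c and d differ. The n slopes in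
  \<open>G\<close> share the variance E - n^4 / p, and variances are nonnegative.\<close>

theorem energy_variance_bound: "real energy \<le> real n ^ 4 / real p + real n * real p"
proof -
  define \<nu> where "\<nu> g t = (\<Sum>c\<in>G. ind (g * c + t))" for g t
  define m where "m = (real n)\<^sup>2 / real p"
  have sum1: "(\<Sum>t\<in>UNIV. \<nu> g t) = n\<^sup>2" for g
    unfolding \<nu>_def using sum_ind[of "\<lambda>_. 1"]
    by (subst sum.swap) (simp add: sum_shift card_G power2_eq_square)
  have sum2: "(\<Sum>t\<in>UNIV. (\<nu> g t)\<^sup>2) = (\<Sum>c\<in>G. \<Sum>d\<in>G. \<rho> (g * (c - d)))" for g
  proof -
    have "(\<Sum>t\<in>UNIV. (\<nu> g t)\<^sup>2) = (\<Sum>t\<in>UNIV. \<Sum>c\<in>G. \<Sum>d\<in>G. ind (g * c + t) * ind (g * d + t))"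
      by (simp add: \<nu>_def power2_eq_square sum_product)
    also have "\<dots> = (\<Sum>c\<in>G. \<Sum>d\<in>G. \<Sum>t\<in>UNIV. ind (g * d + t) * ind (g * c + t))"
      by (subst sum.swap, rule sum.cong[OF refl], subst sum.swap) (simp add: mult.commute)
    finally show ?thesis by (simp add: corr_diff[symmetric] right_diff_distrib)
  qed
  have "(\<Sum>g\<in>UNIV. \<Sum>t\<in>UNIV. (\<nu> g t)\<^sup>2) = (\<Sum>g\<in>UNIV. \<Sum>c\<in>G. \<Sum>d\<in>G. \<rho> (g * (c - d)))"
    by (simp add: sum2)
  also have "\<dots> = (\<Sum>c\<in>G. \<Sum>d\<in>G. \<Sum>g\<in>UNIV. \<rho> (g * (c - d)))"
    by (subst sum.swap, rule sum.cong[OF refl], rule sum.swap)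
  also have "\<dots> \<le> (\<Sum>c\<in>G. \<Sum>d\<in>G. n\<^sup>2 + (if c = d then p * n else 0))"
  proof (intro sum_mono)
    fix c d :: 'a
    show "(\<Sum>g\<in>UNIV. \<rho> (g * (c - d))) \<le> n\<^sup>2 + (if c = d then p * n else 0)"
    proof (cases "c = d")
      case True
      then show ?thesis by (simp add: rho_0 p_card)
    next
      case False
      then have "(\<Sum>g\<in>UNIV. \<rho> (g * (c - d))) = (\<Sum>x\<in>UNIV. \<rho> x)"
        by (intro sum.reindex_bij_betw bij_betw_byWitness[where f' = "\<lambda>x. x / (c - d)"]) auto
      then show ?thesis using sum_rho False by simp
    qed
  qed
  also have "\<dots> = n ^ 4 + p * n\<^sup>2"
    by (simp add: sum.distrib card_G power2_eq_square power4_eq_xxxx algebra_simps)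
  finally have tot: "real (\<Sum>g\<in>UNIV. \<Sum>t\<in>UNIV. (\<nu> g t)\<^sup>2) \<le> real (n ^ 4 + p * n\<^sup>2)"
    by (simp only: of_nat_le_iff)
  have var: "(\<Sum>t\<in>UNIV. (real (\<nu> g t) - m)\<^sup>2) = real (\<Sum>t\<in>UNIV. (\<nu> g t)\<^sup>2) - real n ^ 4 / real p" for g
  proof -
    have "(\<Sum>t\<in>UNIV. (real (\<nu> g t) - m)\<^sup>2) = (\<Sum>t\<in>UNIV. (real (\<nu> g t))\<^sup>2 - 2 * m * real (\<nu> g t) + m\<^sup>2)"
      by (intro sum.cong refl) (simp add: power2_diff)
    also have "\<dots> = real (\<Sum>t\<in>UNIV. (\<nu> g t)\<^sup>2) - 2 * m * real (\<Sum>t\<in>UNIV. \<nu> g t) + real p * m\<^sup>2"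
      by (simp add: sum.distrib sum_subtractf sum_distrib_left p_card)
    also have "\<dots> = real (\<Sum>t\<in>UNIV. (\<nu> g t)\<^sup>2) - real n ^ 4 / real p"
      unfolding sum1 m_def using p_pos by (simp add: field_simps power2_eq_square power4_eq_xxxx)
    finally show ?thesis .
  qed
  \<comment> \<open>Invariance makes every slope from \<open>G\<close> equivalent to slope
    1.\<close>
  have EG: "(\<Sum>t\<in>UNIV. (\<nu> g t)\<^sup>2) = energy" if g: "g \<in> G" for g
    unfolding sum2 using invariantD[OF invariant_rho g] sum_G_differences_rho[of \<rho>]
    by (simp add: energy_def power2_eq_square)
  have "real n * (real energy - real n ^ 4 / real p) = (\<Sum>g\<in>G. \<Sum>t\<in>UNIV. (real (\<nu> g t) - m)\<^sup>2)"
    by (simp only: var) (simp add: EG card_G)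
  also have "\<dots> \<le> (\<Sum>g\<in>UNIV. \<Sum>t\<in>UNIV. (real (\<nu> g t) - m)\<^sup>2)"
    by (rule sum_mono2) (auto intro!: sum_nonneg)
  also have "\<dots> = real (\<Sum>g\<in>UNIV. \<Sum>t\<in>UNIV. (\<nu> g t)\<^sup>2) - real n ^ 4"
    by (simp only: var sum_subtractf of_nat_sum) (use p_pos in \<open>simp add: p_card\<close>)
  also have "\<dots> \<le> real p * (real n)\<^sup>2" using tot by simp
  finally have "real n * (real energy - real n ^ 4 / real p) \<le> real n * (real n * real p)"
    by (simp add: power2_eq_square mult_ac)
  then have "real energy - real n ^ 4 / real p \<le> real n * real p"
    by (rule mult_left_le_imp_le) (simp add: n_pos)
  then show ?thesis by simp
qed

section \<open>Representation functions of sums with two to four terms\<close>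

definition conv :: "('a \<Rightarrow> nat) \<Rightarrow> 'a \<Rightarrow> nat" where
  "conv \<phi> x = (\<Sum>b\<in>G. \<phi> (x - b))"

lemma invariant_conv: "invariant \<phi> \<Longrightarrow> invariant (conv \<phi>)"
  unfolding invariant_def[of "conv \<phi>"]
proof clarify
  fix g x assume inv: "invariant \<phi>" and g: "g \<in> G"
  have "conv \<phi> (g * x) = (\<Sum>t\<in>G. \<phi> (g * x - g * t))"
    unfolding conv_def by (rule sum_dilate_G[OF g, symmetric])
  then show "conv \<phi> (g * x) = conv \<phi> x"
    using invariantD[OF inv g] by (simp add: conv_def flip: right_diff_distrib)
qed

lemma sum_conv: "(\<Sum>x\<in>UNIV. conv \<phi> x) = n * (\<Sum>x\<in>UNIV. \<phi> x)"
proof -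
  have "(\<Sum>x\<in>UNIV. \<phi> (x - b)) = (\<Sum>x\<in>UNIV. \<phi> x)" for b
    using sum_shift[of \<phi> "- b"] by (simp add: add.commute)
  then show ?thesis unfolding conv_def by (subst sum.swap) (simp add: card_G)
qed

text \<open>Adding or subtracting an element of \<open>G\<close> makes no difference to the
  autocorrelation, since only the difference of two such elements enters. This is why counts with
  mixed signs can replace counts of plain sums.\<close>

lemma corr_conv: "corr (conv \<phi>) = corr (spread \<phi>)"
proof
  fix x
  have a: "corr (conv \<phi>) x = (\<Sum>b\<in>G. \<Sum>c\<in>G. corr \<phi> (x + b - c))"
  proof -
    have "corr (conv \<phi>) x = (\<Sum>t\<in>UNIV. \<Sum>b\<in>G. \<Sum>c\<in>G. \<phi> (- b + t) * \<phi> (x - c + t))"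
      by (simp add: corr_def conv_def sum_product algebra_simps)
    also have "\<dots> = (\<Sum>b\<in>G. \<Sum>c\<in>G. corr \<phi> (x - c - (- b)))"
      unfolding corr_diff by (subst sum.swap, rule sum.cong[OF refl], rule sum.swap)
    finally show ?thesis by (simp add: algebra_simps)
  qed
  have "corr (spread \<phi>) x = (\<Sum>t\<in>UNIV. \<Sum>b\<in>G. \<Sum>c\<in>G. \<phi> (b + t) * \<phi> (x + c + t))"
    by (simp add: corr_def spread_def sum_product algebra_simps)
  also have "\<dots> = (\<Sum>b\<in>G. \<Sum>c\<in>G. corr \<phi> (x + c - b))"
    unfolding corr_diff by (subst sum.swap, rule sum.cong[OF refl], rule sum.swap)
  also have "\<dots> = (\<Sum>b\<in>G. \<Sum>c\<in>G. corr \<phi> (x + b - c))" by (rule sum.swap)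
  finally show "corr (conv \<phi>) x = corr (spread \<phi>) x" using a by simp
qed

lemma corr_0: "corr \<phi> 0 = (\<Sum>t\<in>UNIV. (\<phi> t)\<^sup>2)"
  by (simp add: corr_def power2_eq_square)

lemma corr_conv_ind: "corr (conv ind) = spread (spread (conv ind))"
proof
  fix x
  have "corr (conv ind) x = (\<Sum>t\<in>UNIV. (\<Sum>b\<in>G. ind (t - b)) * conv ind (t + x))"
    by (simp add: corr_def conv_def)
  also have "\<dots> = (\<Sum>b\<in>G. \<Sum>t\<in>UNIV. ind (t - b) * conv ind (t + x))"
    unfolding sum_distrib_right by (rule sum.swap)
  also have "\<dots> = (\<Sum>b\<in>G. \<Sum>s\<in>G. conv ind (s + (b + x)))"
  proof (rule sum.cong[OF refl])
    fix b
    have "(\<Sum>t\<in>UNIV. ind (t - b) * conv ind (t + x)) = (\<Sum>s\<in>UNIV. ind s * conv ind (s + (b + x)))"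
      using sum_shift[of "\<lambda>t. ind (t - b) * conv ind (t + x)" b] by (simp add: algebra_simps)
    then show "(\<Sum>t\<in>UNIV. ind (t - b) * conv ind (t + x)) = (\<Sum>s\<in>G. conv ind (s + (b + x)))"
      by (simp add: sum_ind)
  qed
  finally show "corr (conv ind) x = spread (spread (conv ind)) x" by (simp add: spread_def)
qed

abbreviation r\<^sub>2 :: "'a \<Rightarrow> nat" where "r\<^sub>2 \<equiv> conv ind"
text \<open>\<open>spread\<close> subtracts a group element where \<open>conv\<close> adds one:
  \<open>r\<^sub>2\<close>, \<open>r\<^sub>3\<close> and \<open>r\<^sub>4\<close> count
  representations a + b, a + b - c and a + b - c - d.\<close>

abbreviation r\<^sub>3 :: "'a \<Rightarrow> nat" where "r\<^sub>3 \<equiv> spread r\<^sub>2"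
abbreviation r\<^sub>4 :: "'a \<Rightarrow> nat" where "r\<^sub>4 \<equiv> corr r\<^sub>2"

definition T\<^sub>3 :: nat where "T\<^sub>3 = (\<Sum>x\<in>UNIV. (r\<^sub>3 x)\<^sup>2)"
definition T\<^sub>4 :: nat where "T\<^sub>4 = (\<Sum>x\<in>UNIV. (r\<^sub>4 x)\<^sup>2)"

lemma r4_eq: "r\<^sub>4 = spread r\<^sub>3" by (rule corr_conv_ind)

lemma invariant_r2: "invariant r\<^sub>2" by (rule invariant_conv[OF invariant_ind])
lemma invariant_r3: "invariant r\<^sub>3" by (rule invariant_spread[OF invariant_r2])
lemma invariant_r4: "invariant r\<^sub>4" by (rule invariant_corr[OF invariant_r2])

lemma sum_r2: "(\<Sum>x\<in>UNIV. r\<^sub>2 x) = n\<^sup>2"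
  using sum_ind[of "\<lambda>_. 1"] by (simp add: sum_conv card_G power2_eq_square)
lemma sum_r3: "(\<Sum>x\<in>UNIV. r\<^sub>3 x) = n ^ 3"
  by (simp add: sum_spread sum_r2 power2_eq_square power3_eq_cube)
lemma sum_r4: "(\<Sum>x\<in>UNIV. r\<^sub>4 x) = n ^ 4"
  by (simp add: sum_corr sum_r2 flip: power_mult)

lemma r4_0: "r\<^sub>4 0 = energy"
proof -
  have "corr (conv ind) 0 = (\<Sum>x\<in>UNIV. (spread ind x)\<^sup>2)"
    unfolding corr_conv by (rule corr_0)
  then show ?thesis by (simp add: spread_ind energy_def)
qed

lemma r3_le: "r\<^sub>3 x \<le> n\<^sup>2"
proof -
  have "r\<^sub>2 x \<le> n" for x
  proof -
    have "r\<^sub>2 x \<le> (\<Sum>b\<in>G. 1)" unfolding conv_def by (rule sum_mono) (simp add: ind_def)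
    then show ?thesis by (simp add: card_G)
  qed
  then have "r\<^sub>3 x \<le> (\<Sum>b\<in>G. n)" unfolding spread_def by (rule sum_mono)
  then show ?thesis by (simp add: card_G power2_eq_square)
qed

lemma r4_le: "r\<^sub>4 x \<le> n ^ 4"
  using member_le_sum[of x UNIV "r\<^sub>4"] by (simp add: sum_r4)

lemma spread_second_moment_le: "(\<Sum>x\<in>UNIV. (spread \<phi> x)\<^sup>2) \<le> n\<^sup>2 * (\<Sum>x\<in>UNIV. (\<phi> x)\<^sup>2)"
proof -
  have "(\<Sum>x\<in>UNIV. (spread \<phi> x)\<^sup>2) = (\<Sum>x\<in>G. \<Sum>y\<in>G. corr \<phi> (x - y))" by (rule sum_spread_squares)
  also have "\<dots> \<le> (\<Sum>x\<in>G. \<Sum>y\<in>G. corr \<phi> 0)" by (intro sum_mono corr_le_corr_0)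
  finally show ?thesis by (simp add: card_G corr_0 power2_eq_square mult_ac)
qed

text \<open>For such x, the pair of cosets of - x and 1 + x is one of at most T = s u pairs, and - x
  is a solution for it. For T \<le> n^2, the Cauchy-Schwarz inequality against the second moment of
  \<open>nsols\<close> gives (n T)^(2/3). For larger T the trivial bound \<open>card S\<close>, at
  most n^2, is smaller than that.\<close>

lemma shift_count_le:
  fixes S U :: "'a set"
  assumes np: "n\<^sup>2 \<le> p" and S0: "0 \<notin> S" and U0: "0 \<notin> U"
    and Sinv: "\<And>g x. g \<in> G \<Longrightarrow> x \<in> S \<Longrightarrow> g * x \<in> S"
    and s: "s = card ((\<lambda>x. x ^ n) ` S)" and u: "u = card ((\<lambda>x. x ^ n) ` U)" and sn: "s \<le> n"
  shows "real (card {x \<in> S. x + 1 \<in> U}) \<le> 2 ^ 13 * root 3 ((real n * real s * real u)\<^sup>2)"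
proof -
  define T where "T = real s * real u"
  define \<Theta> where "\<Theta> = (\<lambda>(a, b). ((-1) ^ n * a, b)) ` ((\<lambda>x. x ^ n) ` S \<times> (\<lambda>x. x ^ n) ` U)"
  have \<Theta>nz: "\<Theta> \<subseteq> nz" using S0 U0 by (auto simp: \<Theta>_def nz_def)
  have "card \<Theta> \<le> s * u"
    unfolding \<Theta>_def s u card_cartesian_product[symmetric] by (rule card_image_le) simp
  then have "real (card \<Theta>) \<le> real (s * u)" by (simp only: of_nat_le_iff)
  then have T: "real (card \<Theta>) \<le> T" by (simp add: T_def)
  have T0: "0 \<le> T" by (simp add: T_def)
  have target: "(real n * real s * real u)\<^sup>2 = (real n * T)\<^sup>2" by (simp add: T_def mult.assoc)
  show ?thesis
  proof (cases "T \<le> (real n)\<^sup>2")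
    case False
    have "card {x \<in> S. x + 1 \<in> U} \<le> card S" by (rule card_mono) auto
    also have "card S = n * s"
      using sum_over_classes[of S "\<lambda>_. 1::nat"] S0 Sinv unfolding s by simp
    also have "n * s \<le> n\<^sup>2" using sn by (simp add: power2_eq_square)
    finally have "real (card {x \<in> S. x + 1 \<in> U}) \<le> real (n\<^sup>2)" by (simp only: of_nat_le_iff)
    also have "real (n\<^sup>2) = root 3 (((real n)\<^sup>2) ^ 3)"
      unfolding of_nat_power by (rule real_root_power_cancel[symmetric]) auto
    also have "\<dots> \<le> root 3 ((real n * T)\<^sup>2)"
    proof (rule real_root_le_mono)
      have "((real n)\<^sup>2) ^ 3 = (real n * (real n)\<^sup>2)\<^sup>2" by (simp add: power_mult_distrib flip: power_mult power_add)
      also have "\<dots> \<le> (real n * T)\<^sup>2" using False by (intro power_mono mult_left_mono) auto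
      finally show "((real n)\<^sup>2) ^ 3 \<le> (real n * T)\<^sup>2" .
    qed simp
    also have "\<dots> \<le> 2 ^ 13 * root 3 ((real n * T)\<^sup>2)" by simp
    finally show ?thesis unfolding target .
  next
    case True
    have "card {x \<in> S. x + 1 \<in> U} \<le> card (\<Union>\<theta>\<in>\<Theta>. sols n \<theta>)"
    proof (rule card_inj_on_le[of uminus])
      show "uminus ` {x \<in> S. x + 1 \<in> U} \<subseteq> (\<Union>\<theta>\<in>\<Theta>. sols n \<theta>)"
      proof (rule image_subsetI)
        fix x assume "x \<in> {x \<in> S. x + 1 \<in> U}"
        then have x: "x \<in> S" "1 + x \<in> U" by (auto simp: add.commute)
        have "((-1) ^ n * x ^ n, (1 + x) ^ n) \<in> \<Theta>" using x by (force simp: \<Theta>_def)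
        moreover have "- x \<in> sols n ((-1) ^ n * x ^ n, (1 + x) ^ n)"
          by (simp add: sols_def power_minus[of x])
        ultimately show "- x \<in> (\<Union>\<theta>\<in>\<Theta>. sols n \<theta>)" by blast
      qed
    qed auto
    also have "\<dots> \<le> (\<Sum>\<theta>\<in>\<Theta>. nsols n \<theta>)" unfolding nsols_def by (rule card_UN_le) simp
    finally have "real (card {x \<in> S. x + 1 \<in> U}) \<le> real (\<Sum>\<theta>\<in>\<Theta>. nsols n \<theta>)" by (simp only: of_nat_le_iff)
    then have "(real (card {x \<in> S. x + 1 \<in> U}))\<^sup>2 \<le> (\<Sum>\<theta>\<in>\<Theta>. real (nsols n \<theta>))\<^sup>2"
      by (intro power_mono) auto
    also have "\<dots> \<le> (\<Sum>\<theta>\<in>\<Theta>. (real (nsols n \<theta>))\<^sup>2) * card \<Theta>" by (rule sum_squared_le_sum_of_squares)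
    also have "\<dots> \<le> (2 ^ 26 * root 3 (real n ^ 4 * T)) * T"
    proof (rule mult_mono[OF _ T])
      have "(\<Sum>\<theta>\<in>\<Theta>. (real (nsols n \<theta>))\<^sup>2) \<le> (\<Sum>\<theta>\<in>\<Theta>. 4096\<^sup>2 + (if 4096 * \<kappa> < nsols n \<theta> then (real (nsols n \<theta>))\<^sup>2 else 0))"
      proof (rule sum_mono)
        fix \<theta> :: "'a \<times> 'a"
        have "(real (nsols n \<theta>))\<^sup>2 \<le> 4096\<^sup>2" if "\<not> 4096 * \<kappa> < nsols n \<theta>"
          using that by (intro power_mono) (auto simp: small_subgroup[OF np])
        then show "(real (nsols n \<theta>))\<^sup>2 \<le> 4096\<^sup>2 + (if 4096 * \<kappa> < nsols n \<theta> then (real (nsols n \<theta>))\<^sup>2 else 0)" by auto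
      qed
      also have "\<dots> = 4096\<^sup>2 * real (card \<Theta>) + (\<Sum>\<theta> | \<theta> \<in> \<Theta> \<and> 4096 * \<kappa> < nsols n \<theta>. (real (nsols n \<theta>))\<^sup>2)"
        by (simp add: sum.distrib sum.If_cases Int_def)
      also have "\<dots> \<le> 4096\<^sup>2 * root 3 (real n ^ 4 * T) + 2 ^ 25 * root 3 (real n ^ 4 * T)"
      proof (intro add_mono mult_left_mono head_square_sum_le[OF small_subgroup(1)[OF np] \<Theta>nz T])
        have "T = root 3 (T ^ 3)" by (rule real_root_power_cancel[symmetric]) (use T0 in auto)
        also have "\<dots> \<le> root 3 (real n ^ 4 * T)"
        proof (rule real_root_le_mono)
          have "T * T * T \<le> (real n)\<^sup>2 * (real n)\<^sup>2 * T"
            using True T0 by (intro mult_right_mono mult_mono) auto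
          then show "T ^ 3 \<le> real n ^ 4 * T" by (simp add: power3_eq_cube flip: power_add)
        qed simp
        finally show "real (card \<Theta>) \<le> root 3 (real n ^ 4 * T)" using T by linarith
      qed simp
      also have "\<dots> \<le> 2 ^ 26 * root 3 (real n ^ 4 * T)" using T0 by simp
      finally show "(\<Sum>\<theta>\<in>\<Theta>. (real (nsols n \<theta>))\<^sup>2) \<le> 2 ^ 26 * root 3 (real n ^ 4 * T)" .
    qed (use T0 in auto)
    also have "\<dots> = (2 ^ 13 * root 3 ((real n * T)\<^sup>2))\<^sup>2"
    proof -
      have "root 3 (real n ^ 4 * T) * T = root 3 (real n ^ 4 * T * T ^ 3)"
        using T0 by (simp add: real_root_mult[of 3 _ "T ^ 3"] real_root_power_cancel)
      also have "real n ^ 4 * T * T ^ 3 = ((real n * T)\<^sup>2)\<^sup>2"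
        by (simp add: power_mult_distrib power_numeral_reduce)
      also have "root 3 (((real n * T)\<^sup>2)\<^sup>2) = (root 3 ((real n * T)\<^sup>2))\<^sup>2"
        by (simp only: real_root_power zero_less_numeral)
      finally have e: "root 3 (real n ^ 4 * T) * T = (root 3 ((real n * T)\<^sup>2))\<^sup>2" .
      have "(2 ^ 13 :: real)\<^sup>2 = 2 ^ 26" by simp
      then show ?thesis
        unfolding mult.assoc e power_mult_distrib[of "2 ^ 13" "root 3 ((real n * T)\<^sup>2)"] by (simp only:)
    qed
    finally show ?thesis unfolding target
      by (rule power2_le_imp_le) (intro mult_nonneg_nonneg real_root_ge_zero zero_le_power2, simp)
  qed
qed


text \<open>For i up to 2 n^2 the first moment and \<open>T3\<close> suffice. Beyond, Q \<le> n, and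
  summing \<open>r\<^sub>4\<close> over its level set leads to a count of x in that set for which
  \<open>r\<^sub>3 (x + 1)\<close> is large. Estimating it gives i Q of order n Q^(2/3)
  \<open>T\<^sub>3\<close>^(1/3) up to a logarithm; cubing and dividing by Q^2 yields the
  bound.\<close>

lemma q_r4_le:
  assumes np: "n\<^sup>2 \<le> p" and T3: "n ^ 4 \<le> T\<^sub>3" and i: "0 < i"
  shows "real i ^ 3 * real (q r\<^sub>4 i) \<le> 2 ^ 42 * real n ^ 3 * real T\<^sub>3 * harm (n\<^sup>2) ^ 3"
proof -
  define Q where "Q = q r\<^sub>4 i"
  define H :: real where "H = harm (n\<^sup>2)"
  have H1: "1 \<le> H" unfolding H_def by (rule harm_ge_1) (use n_pos in simp)
  have T3': "real n ^ 4 \<le> real T\<^sub>3" using T3 unfolding of_nat_power[symmetric] of_nat_le_iff .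
  have iQ: "i * Q \<le> n ^ 3"
    using q_le_first_moment[OF invariant_r4, of i] n_pos unfolding sum_r4 Q_def
    by (simp add: power_numeral_reduce)
  show ?thesis
  proof (cases "i \<le> 2 * n\<^sup>2")
    case True
    have "i ^ 3 * Q = i\<^sup>2 * (i * Q)" by (simp add: power2_eq_square power3_eq_cube)
    also have "\<dots> \<le> (2 * n\<^sup>2)\<^sup>2 * n ^ 3" using True iQ by (intro mult_le_mono power_mono) auto
    finally have "real (i ^ 3 * Q) \<le> real ((2 * n\<^sup>2)\<^sup>2 * n ^ 3)" by (simp only: of_nat_le_iff)
    then have "real i ^ 3 * real Q \<le> 4 * (real n ^ 3 * real n ^ 4)"
      by (simp add: power_mult_distrib mult_ac flip: power_mult)
    also have "\<dots> \<le> 2 ^ 42 * (real n ^ 3 * real T\<^sub>3)"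
      using T3' by (intro mult_mono) auto
    also have "\<dots> \<le> 2 ^ 42 * (real n ^ 3 * real T\<^sub>3) * H ^ 3"
      using H1 by (intro mult_left_mono[of 1 "H ^ 3", simplified]) auto
    finally show ?thesis by (simp add: Q_def H_def mult.assoc)
  next
    case False
    show ?thesis
    proof (cases "Q = 0")
      case True
      then show ?thesis using H1 by (simp add: Q_def H_def)
    next
      case Q0: False
      have "Q \<le> n"
      proof (rule ccontr)
        assume "\<not> Q \<le> n"
        then have "n\<^sup>2 * n < i * Q" using False n_pos by (intro mult_strict_mono) auto
        then show False using iQ by (simp add: power2_eq_square power3_eq_cube)
      qed
      define S where "S = {x. x \<noteq> 0 \<and> i \<le> r\<^sub>4 x}"
      define U where "U j = {x. x \<noteq> 0 \<and> j \<le> r\<^sub>3 x}" for j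
      have Sinv: "g * x \<in> S" if "g \<in> G" "x \<in> S" for g x
        using that invariantD[OF invariant_r4] nonzero_G by (auto simp: S_def)
      have cS: "card S = n * Q" unfolding Q_def S_def by (rule n_times_q[OF invariant_r4, symmetric])
      have "i * (n * Q) = (\<Sum>x\<in>S. i)" by (simp add: cS)
      also have "\<dots> \<le> (\<Sum>x\<in>S. r\<^sub>4 x)" by (rule sum_mono) (simp add: S_def)
      also have "\<dots> = (\<Sum>e\<in>G. \<Sum>x\<in>S. r\<^sub>3 (e + x))"
        unfolding r4_eq spread_def[of r\<^sub>3] by (rule sum.swap)
      \<comment> \<open>Dilating by e, which preserves the level set and \<open>r\<^sub>3\<close>,
        turns the shift by e into the shift by 1.\<close>
      also have "\<dots> = (\<Sum>e\<in>G. \<Sum>x\<in>S. r\<^sub>3 (x + 1))"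
      proof (rule sum.cong[OF refl])
        fix e assume e: "e \<in> G"
        have "bij_betw (\<lambda>x. e * x) S S"
          by (rule bij_betw_byWitness[where f' = "\<lambda>x. inverse e * x"])
             (use e Sinv inverse_G nonzero_G in auto)
        then have "(\<Sum>x\<in>S. r\<^sub>3 (e + x)) = (\<Sum>x\<in>S. r\<^sub>3 (e + e * x))"
          by (rule sum.reindex_bij_betw[symmetric])
        also have "\<dots> = (\<Sum>x\<in>S. r\<^sub>3 (e * (x + 1)))" by (simp add: algebra_simps)
        finally show "(\<Sum>x\<in>S. r\<^sub>3 (e + x)) = (\<Sum>x\<in>S. r\<^sub>3 (x + 1))"
          using invariantD[OF invariant_r3 e] by simp
      qed
      finally have "i * Q \<le> (\<Sum>x\<in>S. r\<^sub>3 (x + 1))" using n_pos by (simp add: card_G)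
      \<comment> \<open>At x = -1 the argument of \<open>r\<^sub>3\<close> is 0, which belongs to no
        coset; this single value is bounded by n^2.\<close>
      also have "\<dots> \<le> (\<Sum>x\<in>S. (if x = -1 then n\<^sup>2 else 0) + (\<Sum>j = 1..n\<^sup>2. if x + 1 \<in> U j then 1 else 0))"
      proof (rule sum_mono)
        fix x
        show "r\<^sub>3 (x + 1) \<le> (if x = -1 then n\<^sup>2 else 0) + (\<Sum>j = 1..n\<^sup>2. if x + 1 \<in> U j then 1 else 0)"
        proof (cases "x = -1")
          case True
          then show ?thesis using r3_le[of 0] by simp
        next
          case False
          then have "x + 1 \<noteq> 0" by (simp add: eq_neg_iff_add_eq_0)
          then have "{1..n\<^sup>2} \<inter> {j. x + 1 \<in> U j} = {1..r\<^sub>3 (x + 1)}" using r3_le[of "x + 1"] by (auto simp: U_def)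
          then show ?thesis by (simp add: sum.If_cases)
        qed
      qed
      also have "\<dots> \<le> n\<^sup>2 + (\<Sum>j = 1..n\<^sup>2. card {x \<in> S. x + 1 \<in> U j})"
      proof -
        have "(\<Sum>x\<in>S. \<Sum>j = 1..n\<^sup>2. if x + 1 \<in> U j then 1 else 0) = (\<Sum>j = 1..n\<^sup>2. card {x \<in> S. x + 1 \<in> U j})"
          by (subst sum.swap) (simp add: sum.If_cases Int_def)
        then show ?thesis by (simp add: sum.distrib)
      qed
      finally have "i * Q \<le> n\<^sup>2 + (\<Sum>j = 1..n\<^sup>2. card {x \<in> S. x + 1 \<in> U j})" .
      \<comment> \<open>Since i exceeds 2 n^2, the stray term n^2 is at most half of the left-hand
        side and can be absorbed.\<close>
      moreover have "2 * n\<^sup>2 \<le> i * Q"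
        using False Q0 by (metis le_trans mult.right_neutral mult_le_mono2 nat_le_linear not_less_eq_eq One_nat_def not0_implies_Suc Suc_le_mono zero_le)
      ultimately have "i * Q \<le> 2 * (\<Sum>j = 1..n\<^sup>2. card {x \<in> S. x + 1 \<in> U j})" by linarith
      then have "real (i * Q) \<le> real (2 * (\<Sum>j = 1..n\<^sup>2. card {x \<in> S. x + 1 \<in> U j}))" by (simp only: of_nat_le_iff)
      then have "real i * real Q \<le> 2 * (\<Sum>j = 1..n\<^sup>2. real (card {x \<in> S. x + 1 \<in> U j}))" by simp
      also have "\<dots> \<le> 2 * (\<Sum>j = 1..n\<^sup>2. 2 ^ 13 * real n * root 3 ((real Q)\<^sup>2 * real T\<^sub>3) * (1 / real j))"
      proof (intro mult_left_mono sum_mono)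
        fix j assume j: "j \<in> {1..n\<^sup>2}"
        define u where "u = q r\<^sub>3 j"
        have "real (card {x \<in> S. x + 1 \<in> U j}) \<le> 2 ^ 13 * root 3 ((real n * real Q * real u)\<^sup>2)"
          by (rule shift_count_le[OF np _ _ Sinv _ _ \<open>Q \<le> n\<close>]) (auto simp: S_def U_def Q_def u_def q_def)
        also have "root 3 ((real n * real Q * real u)\<^sup>2) \<le> root 3 (real n ^ 3 * ((real Q)\<^sup>2 * real T\<^sub>3) / real j ^ 3)"
        proof (rule real_root_le_mono)
          \<comment> \<open>Multiplying the first-moment bound on u by the second-moment bound gives
            u^2 \<le> n \<open>T\<^sub>3\<close> / j^3; the power j^3 makes the cube root summable
            up to a logarithm.\<close>
          have "n * (j * u) \<le> n * n\<^sup>2"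
            using q_le_first_moment[OF invariant_r3, of j] unfolding sum_r3 u_def by (simp add: power2_eq_square power3_eq_cube)
          then have "j * u \<le> n\<^sup>2" using n_pos by simp
          moreover have "n * (j\<^sup>2 * u) \<le> T\<^sub>3"
            using q_le_second_moment[OF invariant_r3, of j] unfolding T\<^sub>3_def u_def .
          ultimately have "(j * u) * (n * (j\<^sup>2 * u)) \<le> n\<^sup>2 * T\<^sub>3" by (rule mult_le_mono)
          then have "n * (n * (j ^ 3 * u\<^sup>2)) \<le> n * (n * (n * T\<^sub>3))"
            by (simp add: power2_eq_square power3_eq_cube mult_ac)
          then have "j ^ 3 * u\<^sup>2 \<le> n * T\<^sub>3" using n_pos by simp
          then have "real (j ^ 3 * u\<^sup>2) \<le> real (n * T\<^sub>3)" by (simp only: of_nat_le_iff)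
          then have "(real n)\<^sup>2 * (real Q)\<^sup>2 * (real j ^ 3 * (real u)\<^sup>2) \<le> (real n)\<^sup>2 * (real Q)\<^sup>2 * (real n * real T\<^sub>3)"
            by (intro mult_left_mono) auto
          then show "(real n * real Q * real u)\<^sup>2 \<le> real n ^ 3 * ((real Q)\<^sup>2 * real T\<^sub>3) / real j ^ 3"
            using j by (simp add: pos_le_divide_eq power2_eq_square power3_eq_cube mult_ac)
        qed simp
        also have "root 3 (real n ^ 3 * ((real Q)\<^sup>2 * real T\<^sub>3) / real j ^ 3) = real n * root 3 ((real Q)\<^sup>2 * real T\<^sub>3) / real j"
          by (simp only: real_root_mult real_root_divide real_root_power_cancel zero_less_numeral of_nat_0_le_iff)
        finally show "real (card {x \<in> S. x + 1 \<in> U j}) \<le> 2 ^ 13 * real n * root 3 ((real Q)\<^sup>2 * real T\<^sub>3) * (1 / real j)"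
          by simp
      qed simp
      also have "\<dots> = 2 ^ 14 * real n * root 3 ((real Q)\<^sup>2 * real T\<^sub>3) * H"
        unfolding H_def harm_eq sum_distrib_left[symmetric] by simp
      finally have "(real i * real Q) ^ 3 \<le> (2 ^ 14 * real n * root 3 ((real Q)\<^sup>2 * real T\<^sub>3) * H) ^ 3"
        by (intro power_mono) auto
      also have "\<dots> = (real Q)\<^sup>2 * (2 ^ 42 * real n ^ 3 * real T\<^sub>3 * H ^ 3)"
        unfolding power_mult_distrib by simp
      finally have "(real Q)\<^sup>2 * (real i ^ 3 * real Q) \<le> (real Q)\<^sup>2 * (2 ^ 42 * real n ^ 3 * real T\<^sub>3 * H ^ 3)"
        by (simp add: power_mult_distrib power2_eq_square power3_eq_cube mult_ac)
      then show ?thesis using Q0 by (simp add: Q_def H_def)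
    qed
  qed
qed

text \<open>The first two alternatives are harmless sizes of \<open>T\<^sub>3\<close>. Otherwise
  \<open>pair_sum_lower_bound\<close> for \<open>r\<^sub>2\<close> applies with
  \<open>r\<^sub>4\<close> away from 0 as the weight. Both terms on its right carry a factor
  \<open>T\<^sub>3\<close>, the second because the level sets of \<open>r\<^sub>4\<close> are
  themselves bounded through \<open>T\<^sub>3\<close>; cancelling it leaves a bound for the
  square.\<close>

theorem T3_bound:
  assumes np: "n\<^sup>2 \<le> p"
  shows "T\<^sub>3 \<le> n ^ 4 \<or> T\<^sub>3 \<le> 2 * n * energy \<or>
    (real T\<^sub>3)\<^sup>2 \<le> 4 * real n ^ 3 * (real energy)\<^sup>2 + 2 ^ 71 * root 3 (real n ^ 25) * harm (n\<^sup>2) ^ 3 * harm (n ^ 4) ^ 3"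
proof (cases "T\<^sub>3 \<le> n ^ 4 \<or> T\<^sub>3 \<le> 2 * n * energy")
  case False
  define T where "T = real T\<^sub>3"
  define H :: real where "H = harm (n\<^sup>2)"
  define L :: real where "L = harm (n ^ 4)"
  have T4: "n ^ 4 \<le> T\<^sub>3" and big: "2 * n * energy < T\<^sub>3" using False by auto
  then have T0: "0 < T" by (simp add: T_def)
  have H1: "1 \<le> H" and L1: "1 \<le> L" unfolding H_def L_def by (intro harm_ge_1; use n_pos in simp)+
  define g where "g x = (if x = 0 then 0 else r\<^sub>4 x)" for x
  have inv_g: "invariant g"
    unfolding invariant_def g_def using invariantD[OF invariant_r4] nonzero_G by auto
  define W where "W = (\<Sum>y\<in>G. g (1 - y))"
  \<comment> \<open>The value of \<open>r\<^sub>4\<close> at 0 is the energy and occurs n times on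
    the diagonal. By the second excluded alternative it takes at most half of
    \<open>T\<^sub>3\<close>.\<close>
  have "n * W + n * energy = T\<^sub>3"
  proof -
    have "T\<^sub>3 = (\<Sum>x\<in>G. \<Sum>y\<in>G. r\<^sub>4 (x - y))" unfolding T\<^sub>3_def by (rule sum_spread_squares)
    also have "\<dots> = (\<Sum>x\<in>G. \<Sum>y\<in>G. g (x - y) + (if y = x then energy else 0))"
      by (intro sum.cong refl) (auto simp: g_def r4_0)
    also have "\<dots> = (\<Sum>x\<in>G. \<Sum>y\<in>G. g (x - y)) + n * energy"
      by (simp add: sum.distrib card_G)
    finally show ?thesis using sum_G_differences[OF inv_g] by (simp add: W_def)
  qed
  then have "T = real n * real W + real n * real energy" unfolding T_def by (metis of_nat_add of_nat_mult)
  moreover have "2 * (real n * real energy) \<le> T"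
  proof -
    have "real (2 * n * energy) \<le> T" using big unfolding T_def of_nat_le_iff by simp
    then show ?thesis by (simp add: mult.assoc)
  qed
  moreover have "0 \<le> real n * real energy" by simp
  ultimately have nW: "T / 2 \<le> real n * real W" "real n * real W \<le> T" by linarith+
  define D where "D = real (r\<^sub>4 0) * (\<Sum>y\<in>G. (real (g (1 - y)))\<^sup>2)"
  define V where "V = (\<Sum>(y, z)\<in>pairs. real (g (1 - y)) * real (g (1 - z)) * real (r\<^sub>4 (z - y)))"
  have ineq: "(real W)\<^sup>2 * T \<le> (real n)\<^sup>2 * (D + V)"
    using pair_sum_lower_bound[OF invariant_r2, of g] unfolding W_def D_def V_def T_def T\<^sub>3_def by (simp add: g_def)
  \<comment> \<open>One factor of the square in the diagonal is bounded by the maximum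
    \<open>r\<^sub>4 0\<close>, the other is summed to W, and n W is at most T.\<close>
  have D_le: "real n * D \<le> (real energy)\<^sup>2 * T"
  proof -
    have "D \<le> real energy * (\<Sum>y\<in>G. real energy * real (g (1 - y)))"
      unfolding D_def r4_0 power2_eq_square
    proof (intro mult_left_mono sum_mono mult_right_mono)
      fix y
      have "g (1 - y) \<le> energy" using corr_le_corr_0[of r\<^sub>2 "1 - y"] by (simp add: g_def r4_0)
      then show "real (g (1 - y)) \<le> real energy" by simp
    qed auto
    also have "\<dots> = (real energy)\<^sup>2 * real W"
      by (simp add: W_def sum_distrib_left power2_eq_square mult.assoc)
    finally have "real n * D \<le> real n * ((real energy)\<^sup>2 * real W)" by (rule mult_left_mono) simp
    also have "\<dots> = (real energy)\<^sup>2 * (real n * real W)" by simp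
    also have "\<dots> \<le> (real energy)\<^sup>2 * T" using nW(2) by (rule mult_left_mono) simp
    finally show ?thesis .
  qed
  define c where "c = root 3 (2 ^ 42 * real n ^ 3 * T * H ^ 3)"
  have c3: "c ^ 3 = 2 ^ 42 * real n ^ 3 * T * H ^ 3" unfolding c_def by (rule odd_real_root_pow) simp
  have c0: "0 \<le> c" using T0 H1 by (simp add: c_def)
  have roots: "(\<Sum>k = 1..n ^ 4. root 3 (q r\<^sub>4 k)) \<le> c * L"
  proof -
    have "root 3 (q r\<^sub>4 k) \<le> c * (1 / real k)" if k: "k \<in> {1..n ^ 4}" for k
    proof -
      have "root 3 (real k ^ 3 * real (q r\<^sub>4 k)) \<le> c"
        unfolding c_def using q_r4_le[OF np T4, of k] k by (intro real_root_le_mono) (auto simp: T_def H_def)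
      then have "real k * root 3 (q r\<^sub>4 k) \<le> c"
        by (simp only: real_root_mult real_root_power_cancel zero_less_numeral of_nat_0_le_iff)
      then show ?thesis using k by (simp add: field_simps)
    qed
    then show ?thesis unfolding L_def harm_eq sum_distrib_left by (intro sum_mono) auto
  qed
  have roots_g: "(\<Sum>k = 1..n ^ 4. root 3 (q g k)) \<le> c * L"
  proof (rule order.trans[OF sum_mono roots])
    fix k
    have "q g k \<le> q r\<^sub>4 k" unfolding q_def by (intro card_mono image_mono) (auto simp: g_def)
    then show "root 3 (q g k) \<le> root 3 (q r\<^sub>4 k)" by simp
  qed
  have "V \<le> 2 ^ 27 * root 3 (real n ^ 4) * (\<Sum>i = 1..n ^ 4. root 3 (q g i))\<^sup>2 * (\<Sum>k = 1..n ^ 4. root 3 (q r\<^sub>4 k))"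
    unfolding V_def by (rule trilinear_le[OF all_pairs_le[OF np]]) (auto simp: g_def r4_le)
  also have "\<dots> \<le> 2 ^ 27 * root 3 (real n ^ 4) * (c * L)\<^sup>2 * (c * L)"
    by (intro mult_mono power_mono roots roots_g order.refl) (auto intro!: sum_nonneg simp: c0 L1 order.trans[OF zero_le_one L1])
  also have "\<dots> = 2 ^ 27 * root 3 (real n ^ 4) * (c ^ 3 * L ^ 3)"
    by (simp add: power2_eq_square power3_eq_cube)
  also have "\<dots> = T * (2 ^ 69 * (root 3 (real n ^ 4) * real n ^ 3) * H ^ 3 * L ^ 3)"
    unfolding c3 by simp
  finally have V_le: "V \<le> T * (2 ^ 69 * (root 3 (real n ^ 4) * real n ^ 3) * H ^ 3 * L ^ 3)" .
  have "T\<^sup>2 * T = 4 * ((T / 2)\<^sup>2 * T)" by (simp add: power2_eq_square)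
  also have "\<dots> \<le> 4 * ((real n * real W)\<^sup>2 * T)"
    using nW(1) T0 by (intro mult_left_mono mult_right_mono power_mono) auto
  also have "\<dots> \<le> 4 * ((real n)\<^sup>2 * ((real n)\<^sup>2 * (D + V)))"
    using mult_left_mono[OF ineq, of "(real n)\<^sup>2"] by (simp add: power_mult_distrib mult.assoc)
  also have "\<dots> = 4 * (real n ^ 3 * (real n * D) + real n ^ 4 * V)"
    by (simp add: power_numeral_reduce algebra_simps)
  also have "\<dots> \<le> 4 * (real n ^ 3 * ((real energy)\<^sup>2 * T) + real n ^ 4 * (T * (2 ^ 69 * (root 3 (real n ^ 4) * real n ^ 3) * H ^ 3 * L ^ 3)))"
    by (intro mult_left_mono add_mono D_le V_le) auto
  also have "\<dots> = (4 * real n ^ 3 * (real energy)\<^sup>2 + 2 ^ 71 * (real n ^ 4 * (root 3 (real n ^ 4) * real n ^ 3)) * H ^ 3 * L ^ 3) * T"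
    by (simp add: algebra_simps)
  also have "real n ^ 4 * (root 3 (real n ^ 4) * real n ^ 3) = root 3 (real n ^ 25)"
  proof -
    define r where "r = root 3 (real n)"
    have r: "root 3 (real n ^ m) = r ^ m" "real n ^ m = r ^ (3 * m)" for m
      by (simp_all add: r_def real_root_power power_mult)
    show ?thesis unfolding r(1) unfolding r(2) by (simp flip: power_add)
  qed
  finally have "T\<^sup>2 \<le> 4 * real n ^ 3 * (real energy)\<^sup>2 + 2 ^ 71 * root 3 (real n ^ 25) * H ^ 3 * L ^ 3"
    using T0 by (simp only: mult_le_cancel_right_pos)
  then show ?thesis by (simp add: T_def H_def L_def)
qed auto

text \<open>For the number Q of cosets at height k, the geometric mean of k Q \<le> n^3 and of the
  bound for k^3 Q controls k^2 Q. Each height then contributes a constant over k, and the point 0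
  contributes the square of the energy.\<close>

theorem T4_bound:
  assumes np: "n\<^sup>2 \<le> p" and T3: "n ^ 4 \<le> T\<^sub>3"
  shows "real T\<^sub>4 \<le> (real energy)\<^sup>2 + 2 ^ 22 * real n ^ 4 * sqrt (real T\<^sub>3 * harm (n\<^sup>2) ^ 3) * harm (n ^ 4)"
proof -
  define H :: real where "H = harm (n\<^sup>2)"
  have H1: "1 \<le> H" unfolding H_def by (rule harm_ge_1) (use n_pos in simp)
  have sq: "(real k)\<^sup>2 \<le> (\<Sum>j\<in>{0<..k}. 2 * real j)" for k
  proof (induction k)
    case (Suc k)
    have "{0<..Suc k} = insert (Suc k) {0<..k}" by auto
    then show ?case using Suc by (simp add: power2_eq_square algebra_simps)
  qed simp
  have lev: "2 * real k * real (card {x \<in> - {0}. k \<le> r\<^sub>4 x}) \<le> 2 ^ 22 * real n ^ 4 * sqrt (real T\<^sub>3 * H ^ 3) * (1 / real k)"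
    if k: "k \<in> {0<..n ^ 4}" for k
  proof -
    define Q where "Q = real (q r\<^sub>4 k)"
    have "{a \<in> - {0}. k \<le> r\<^sub>4 a} = {x. x \<noteq> 0 \<and> k \<le> r\<^sub>4 x}" by auto
    then have c: "real (card {a \<in> - {0}. k \<le> r\<^sub>4 a}) = real n * Q"
      by (simp add: n_times_q[OF invariant_r4, symmetric] Q_def)
    have "n * (k * q r\<^sub>4 k) \<le> n * n ^ 3"
      using q_le_first_moment[OF invariant_r4, of k] unfolding sum_r4 by (simp add: power_numeral_reduce)
    then have "k * q r\<^sub>4 k \<le> n ^ 3" using n_pos by simp
    then have "real (k * q r\<^sub>4 k) \<le> real (n ^ 3)" by (simp only: of_nat_le_iff)
    then have kQ: "real k * Q \<le> real n ^ 3" by (simp add: Q_def)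
    have k3: "real k ^ 3 * Q \<le> 2 ^ 42 * real n ^ 3 * real T\<^sub>3 * H ^ 3"
      unfolding Q_def H_def using q_r4_le[OF np T3] k by simp
    have "(real k * (real k * Q))\<^sup>2 = (real k * Q) * (real k ^ 3 * Q)"
      by (simp add: power2_eq_square power3_eq_cube)
    also have "\<dots> \<le> real n ^ 3 * (2 ^ 42 * real n ^ 3 * real T\<^sub>3 * H ^ 3)"
      by (rule mult_mono[OF kQ k3]) (auto simp: Q_def)
    also have "\<dots> = (2 ^ 21 * real n ^ 3)\<^sup>2 * (real T\<^sub>3 * H ^ 3)"
      by (simp add: power_mult_distrib power2_eq_square)
    finally have "real k * (real k * Q) \<le> sqrt ((2 ^ 21 * real n ^ 3)\<^sup>2 * (real T\<^sub>3 * H ^ 3))"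
      by (rule real_le_rsqrt)
    also have "\<dots> = 2 ^ 21 * real n ^ 3 * sqrt (real T\<^sub>3 * H ^ 3)"
      by (simp only: real_sqrt_mult[of "_\<^sup>2"] real_sqrt_abs) (simp add: abs_mult)
    finally have "2 * real n * (real k * (real k * Q)) \<le> 2 * real n * (2 ^ 21 * real n ^ 3 * sqrt (real T\<^sub>3 * H ^ 3))"
      by (rule mult_left_mono) simp
    then show ?thesis unfolding c using k by (simp add: field_simps power_numeral_reduce)
  qed
  have insert_eq_UNIV: "insert 0 (- {0}) = (UNIV :: 'a set)" by auto
  have "real T\<^sub>4 = (\<Sum>x\<in>insert 0 (- {0}). (real (r\<^sub>4 x))\<^sup>2)"
    unfolding T\<^sub>4_def by (simp add: insert_eq_UNIV)
  also have "\<dots> = (real energy)\<^sup>2 + (\<Sum>x\<in>- {0}. (real (r\<^sub>4 x))\<^sup>2)"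
    by (subst sum.insert) (auto simp: r4_0)
  also have "(\<Sum>x\<in>- {0}. (real (r\<^sub>4 x))\<^sup>2) \<le> (\<Sum>x\<in>- {0}. \<Sum>j\<in>{0<..r\<^sub>4 x}. 2 * real j)"
    by (intro sum_mono sq)
  also have "\<dots> = (\<Sum>k\<in>{0<..n ^ 4}. 2 * real k * card {x \<in> - {0}. k \<le> r\<^sub>4 x})"
    by (rule layer_cake) (auto simp: r4_le)
  also have "\<dots> \<le> (\<Sum>k\<in>{0<..n ^ 4}. 2 ^ 22 * real n ^ 4 * sqrt (real T\<^sub>3 * H ^ 3) * (1 / real k))"
    by (rule sum_mono) (rule lev)
  also have "\<dots> = 2 ^ 22 * real n ^ 4 * sqrt (real T\<^sub>3 * H ^ 3) * harm (n ^ 4)"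
    unfolding harm_eq sum_distrib_left[symmetric]
    by (intro arg_cong2[where f = "(*)"] sum.cong) auto
  finally show ?thesis by (simp add: H_def)
qed

end

section \<open>Passage to residue rings\<close>

lemma card_equal_image_pairs:
  fixes f :: "'b \<Rightarrow> 'c::finite"
  assumes "finite A"
  shows "card {(a, a'). a \<in> A \<and> a' \<in> A \<and> f a = f a'} = (\<Sum>x\<in>UNIV. (card {a \<in> A. f a = x})\<^sup>2)"
proof -
  have "{(a, a'). a \<in> A \<and> a' \<in> A \<and> f a = f a'} = (\<Union>x\<in>UNIV. {a \<in> A. f a = x} \<times> {a \<in> A. f a = x})"
    by auto
  also have "card \<dots> = (\<Sum>x\<in>UNIV. card ({a \<in> A. f a = x} \<times> {a \<in> A. f a = x}))"
    by (rule card_UN_disjoint) (use assms in auto)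
  finally show ?thesis by (simp add: card_cartesian_product power2_eq_square)
qed

text \<open>All facts proved over a field type, reduced to statements about natural numbers. Neither
  the transfer to residue rings nor the asymptotic analysis has to mention the type again.\<close>

definition subgroup_bounds :: "nat \<Rightarrow> nat \<Rightarrow> nat \<Rightarrow> (nat \<Rightarrow> nat) \<Rightarrow> bool" where
  "subgroup_bounds p n E T \<longleftrightarrow>
    (n ^ 3 \<le> p\<^sup>2 \<longrightarrow> real E ^ 3 \<le> 2 ^ 63 * harm n * (root 3 (real n ^ 22) + real n ^ 9 / real p)) \<and>
    real E \<le> real n ^ 4 / real p + real n * real p \<and>
    T 2 = E \<and> (\<forall>k. T (Suc k) \<le> n\<^sup>2 * T k) \<and>
    (n\<^sup>2 \<le> p \<longrightarrow> T 3 \<le> n ^ 4 \<or> T 3 \<le> 2 * n * E \<or>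
      (real (T 3))\<^sup>2 \<le> 4 * real n ^ 3 * (real E)\<^sup>2 + 2 ^ 71 * root 3 (real n ^ 25) * harm (n\<^sup>2) ^ 3 * harm (n ^ 4) ^ 3) \<and>
    (n\<^sup>2 \<le> p \<longrightarrow> n ^ 4 \<le> T 3 \<longrightarrow>
      real (T 4) \<le> (real E)\<^sup>2 + 2 ^ 22 * real n ^ 4 * sqrt (real (T 3) * harm (n\<^sup>2) ^ 3) * harm (n ^ 4))"

section \<open>Moments as counts of tuples\<close>

context power_subgroup
begin

primrec reps :: "nat \<Rightarrow> 'a \<Rightarrow> nat" where
  "reps 0 = (\<lambda>x. if x = 0 then 1 else 0)"
| "reps (Suc k) = conv (reps k)"

definition moment :: "nat \<Rightarrow> nat" where "moment k = (\<Sum>x\<in>UNIV. (reps k x)\<^sup>2)"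

lemma moment_Suc: "moment (Suc k) = corr (spread (reps k)) 0"
  by (simp add: moment_def flip: corr_0 corr_conv)

lemma reps_1: "reps (Suc 0) = ind"
proof
  fix x :: 'a
  have "x - b = 0 \<longleftrightarrow> b = x" for b by auto
  then have "reps (Suc 0) x = (\<Sum>b\<in>G. if b = x then 1 else 0)" by (simp only: reps.simps conv_def)
  then show "reps (Suc 0) x = ind x" by (simp add: ind_def)
qed

lemma moment_2: "moment 2 = energy"
  unfolding numeral_2_eq_2 moment_Suc reps_1 corr_0 spread_ind energy_def ..

lemma moment_3: "moment 3 = T\<^sub>3"
  unfolding numeral_3_eq_3 moment_Suc reps.simps(2)[of "Suc 0"] reps_1 corr_0 T\<^sub>3_def ..

text \<open>The second moment of \<open>spread\<close> of a function depends on that function only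
  through its autocorrelation, and by \<open>corr_conv\<close> the functions
  \<open>conv r\<^sub>2\<close> and \<open>r\<^sub>3\<close> share theirs.\<close>

lemma moment_4: "moment 4 = T\<^sub>4"
proof -
  have "moment 4 = (\<Sum>x\<in>UNIV. (spread (conv r\<^sub>2) x)\<^sup>2)"
    using moment_Suc[of "Suc (Suc (Suc 0))"] unfolding reps.simps(2)[of "Suc (Suc 0)"] reps.simps(2)[of "Suc 0"] reps_1
    by (simp add: corr_0 eval_nat_numeral)
  also have "\<dots> = (\<Sum>x\<in>UNIV. (spread r\<^sub>3 x)\<^sup>2)"
    by (simp only: sum_spread_squares corr_conv)
  finally show ?thesis by (simp add: T\<^sub>4_def r4_eq)
qed

lemma moment_Suc_le: "moment (Suc k) \<le> n\<^sup>2 * moment k"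
  unfolding moment_Suc corr_0 moment_def[of k] by (rule spread_second_moment_le)

lemma moment_bounds: "subgroup_bounds p n energy moment"
  unfolding subgroup_bounds_def moment_2 moment_3 moment_4
  using energy_bound energy_variance_bound moment_Suc_le T3_bound T4_bound by simp

lemma reps_eq_card: "reps k x = card {a \<in> {..<k} \<rightarrow>\<^sub>E G. (\<Sum>i<k. a i) = x}"
proof (induction k arbitrary: x)
  case 0
  have "{a \<in> {..<0::nat} \<rightarrow>\<^sub>E G. (\<Sum>i<0. a i) = x} = (if x = 0 then {\<lambda>_. undefined} else {})" by auto
  then show ?case by simp
next
  case (Suc k)
  have "reps (Suc k) x = (\<Sum>b\<in>G. card {a \<in> {..<k} \<rightarrow>\<^sub>E G. (\<Sum>i<k. a i) = x - b})"
    by (simp add: conv_def Suc)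
  also have "\<dots> = card (SIGMA b:G. {a \<in> {..<k} \<rightarrow>\<^sub>E G. (\<Sum>i<k. a i) = x - b})"
  proof -
    have "finite ({..<k} \<rightarrow>\<^sub>E G)" by (simp add: finite_PiE)
    then show ?thesis by (subst card_SigmaI) auto
  qed
  also have "\<dots> = card {a \<in> {..<Suc k} \<rightarrow>\<^sub>E G. (\<Sum>i<Suc k. a i) = x}"
  proof (rule bij_betw_same_card[of "\<lambda>(b, a). a(k := b)"],
         rule bij_betw_byWitness[where f' = "\<lambda>a. (a k, restrict a {..<k})"])
    show "\<forall>ba\<in>SIGMA b:G. {a \<in> {..<k} \<rightarrow>\<^sub>E G. (\<Sum>i<k. a i) = x - b}.
       (((\<lambda>(b, a). a(k := b)) ba) k, restrict ((\<lambda>(b, a). a(k := b)) ba) {..<k}) = ba"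
      by (auto simp: fun_eq_iff restrict_def PiE_def extensional_def)
    show "\<forall>a\<in>{a \<in> {..<Suc k} \<rightarrow>\<^sub>E G. (\<Sum>i<Suc k. a i) = x}. (\<lambda>(b, a). a(k := b)) (a k, restrict a {..<k}) = a"
      by (auto simp: fun_eq_iff restrict_def PiE_def extensional_def)
    show "(\<lambda>(b, a). a(k := b)) ` (SIGMA b:G. {a \<in> {..<k} \<rightarrow>\<^sub>E G. (\<Sum>i<k. a i) = x - b})
       \<subseteq> {a \<in> {..<Suc k} \<rightarrow>\<^sub>E G. (\<Sum>i<Suc k. a i) = x}"
      by (auto simp: PiE_def extensional_def Pi_def less_Suc_eq)
    show "(\<lambda>a. (a k, restrict a {..<k})) ` {a \<in> {..<Suc k} \<rightarrow>\<^sub>E G. (\<Sum>i<Suc k. a i) = x}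
       \<subseteq> (SIGMA b:G. {a \<in> {..<k} \<rightarrow>\<^sub>E G. (\<Sum>i<k. a i) = x - b})"
      by (auto simp: PiE_def extensional_def Pi_def)
  qed
  finally show ?case .
qed

lemma moment_eq_card:
  "moment k = card {(a, a'). a \<in> {..<k} \<rightarrow>\<^sub>E G \<and> a' \<in> {..<k} \<rightarrow>\<^sub>E G \<and> (\<Sum>i<k. a i) = (\<Sum>i<k. a' i)}"
  unfolding moment_def reps_eq_card by (rule card_equal_image_pairs[symmetric]) (simp add: finite_PiE)

lemma energy_eq_card:
  "energy = card {(a1, a2, a3, a4). a1 \<in> G \<and> a2 \<in> G \<and> a3 \<in> G \<and> a4 \<in> G \<and> a1 + a2 = a3 + a4}"
proof -
  have r2: "r\<^sub>2 x = card {ab \<in> G \<times> G. fst ab + snd ab = x}" for x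
  proof -
    have "r\<^sub>2 x = card {b \<in> G. x - b \<in> G}" by (simp add: conv_def ind_def sum.If_cases Int_def)
    also have "\<dots> = card {ab \<in> G \<times> G. fst ab + snd ab = x}"
      by (rule bij_betw_same_card[of "\<lambda>b. (x - b, b)"], rule bij_betw_byWitness[where f' = snd]) auto
    finally show ?thesis .
  qed
  have "energy = (\<Sum>x\<in>UNIV. (r\<^sub>2 x)\<^sup>2)" using r4_0 by (simp add: corr_0)
  also have "\<dots> = card {(ab, ab'). ab \<in> G \<times> G \<and> ab' \<in> G \<times> G \<and> fst ab + snd ab = fst ab' + snd ab'}"
    unfolding r2 by (rule card_equal_image_pairs[symmetric]) simp
  also have "\<dots> = card {(a1, a2, a3, a4). a1 \<in> G \<and> a2 \<in> G \<and> a3 \<in> G \<and> a4 \<in> G \<and> a1 + a2 = a3 + a4}"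
    by (rule bij_betw_same_card[of "\<lambda>((a, b), c, d). (a, b, c, d)"],
        rule bij_betw_byWitness[where f' = "\<lambda>(a, b, c, d). ((a, b), c, d)"]) auto
  finally show ?thesis .
qed

end

text \<open>Multiplication by g permutes the finite set, so comparing products over it gives g^n =
  1. Conversely, X^n - 1 has at most n roots, and the set already supplies n of them.\<close>

lemma finite_multiplicative_set_eq_roots:
  fixes G :: "'a::field set"
  assumes fin: "finite G" and ne: "1 \<in> G" and nz: "0 \<notin> G" and mult: "\<And>x y. x \<in> G \<Longrightarrow> y \<in> G \<Longrightarrow> x * y \<in> G"
  shows "G = {x. x ^ card G = 1}"
proof -
  define n where "n = card G"
  have n: "0 < n" using fin ne by (auto simp: n_def card_gt_0_iff)
  have sub: "G \<subseteq> {x. x ^ n = 1}"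
  proof
    fix g assume g: "g \<in> G"
    then have g0: "g \<noteq> 0" using nz by auto
    have inj: "inj_on (\<lambda>x. g * x) G" using g0 by (auto simp: inj_on_def)
    have "(\<lambda>x. g * x) ` G = G"
      by (rule card_subset_eq[OF fin]) (use g mult card_image[OF inj] in auto)
    then have "(\<Prod>x\<in>G. x) = (\<Prod>x\<in>G. g * x)" using prod.reindex[OF inj, of "\<lambda>x. x"] by simp
    also have "\<dots> = g ^ n * (\<Prod>x\<in>G. x)" by (simp add: prod.distrib n_def)
    finally have "g ^ n = 1" using fin nz by auto
    then show "g \<in> {x. x ^ n = 1}" by simp
  qed
  define P where "P = monom 1 n - (1 :: 'a poly)"
  have cn: "coeff P n = 1" using n by (simp add: P_def)
  then have P0: "P \<noteq> 0" by auto
  have degP: "degree P \<le> n" unfolding P_def by (rule degree_diff_le) (simp_all add: degree_monom_le)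
  have roots: "{x. x ^ n = 1} = {x. poly P x = 0}" by (simp add: P_def poly_monom)
  have "finite {x. x ^ n = (1::'a)}" unfolding roots by (rule poly_roots_finite[OF P0])
  moreover have "card {x. x ^ n = (1::'a)} \<le> n"
    unfolding roots using card_poly_roots_bound[OF P0] degP by simp
  ultimately have "G = {x. x ^ n = 1}" using card_seteq[OF _ sub] by (simp add: n_def)
  then show ?thesis by (simp add: n_def)
qed

definition bounds_hold :: "nat \<Rightarrow> bool" where
  "bounds_hold p \<longleftrightarrow> (\<forall>\<Gamma>. subgroup \<Gamma> (mult_of (residue_ring (int p))) \<longrightarrow>
     subgroup_bounds p (card \<Gamma>) (additive_energy (residue_ring (int p)) \<Gamma>)
       (\<lambda>k. higher_energy (residue_ring (int p)) k \<Gamma>))"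

text \<open>
  A type cannot depend on the prime bound in the theorem. Since the bounds above are explicit, it
  suffices to refute one counterexample, and this one prime gives a closed type of residues, over
  which the type-class library of polynomials is available.
\<close>

definition critical_prime :: nat where
  "critical_prime = (SOME p. prime p \<and> ((\<exists>p'. prime p' \<and> \<not> bounds_hold p') \<longrightarrow> \<not> bounds_hold p))"

lemma critical_prime:
  "prime critical_prime" "\<exists>p. prime p \<and> \<not> bounds_hold p \<Longrightarrow> \<not> bounds_hold critical_prime"
proof -
  have "\<exists>p::nat. prime p \<and> ((\<exists>p'. prime p' \<and> \<not> bounds_hold p') \<longrightarrow> \<not> bounds_hold p)"
    using two_is_prime_nat by blast
  from someI_ex[OF this] show "prime critical_prime"
    "\<exists>p. prime p \<and> \<not> bounds_hold p \<Longrightarrow> \<not> bounds_hold critical_prime"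
    unfolding critical_prime_def by blast+
qed

lemma critical_prime_gt_1: "1 < int critical_prime"
  using prime_gt_1_nat[OF critical_prime(1)] by simp

section \<open>The prime field as a type, and transfer of the bounds\<close>

typedef residue = "{0..<int critical_prime}"
  using critical_prime_gt_1 by (intro exI[of _ 0]) simp

setup_lifting type_definition_residue

lemma residue_inverse_exists:
  assumes "x \<in> {0..<int critical_prime}" "x \<noteq> 0"
  shows "\<exists>y. y \<in> {0..<int critical_prime} \<and> (x * y) mod int critical_prime = 1"
proof -
  have "\<not> int critical_prime dvd x" using assms zdvd_not_zless by fastforce
  moreover have "prime (int critical_prime)" using critical_prime(1) by simp
  ultimately have "coprime x (int critical_prime)"
    using prime_imp_coprime coprime_commute by blast
  then obtain y where "[x * y = 1] (mod int critical_prime)" using cong_solve_coprime_int by blast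
  then have "(x * (y mod int critical_prime)) mod int critical_prime = 1"
    using critical_prime_gt_1 by (simp add: cong_def mod_mult_right_eq)
  then show ?thesis using critical_prime_gt_1 by (intro exI[of _ "y mod int critical_prime"]) simp
qed

instantiation residue :: field
begin

lift_definition zero_residue :: residue is 0 using critical_prime_gt_1 by simp
lift_definition one_residue :: residue is 1 using critical_prime_gt_1 by simp
lift_definition plus_residue :: "residue \<Rightarrow> residue \<Rightarrow> residue" is "\<lambda>x y. (x + y) mod int critical_prime"
  using critical_prime_gt_1 by simp
lift_definition minus_residue :: "residue \<Rightarrow> residue \<Rightarrow> residue" is "\<lambda>x y. (x - y) mod int critical_prime"
  using critical_prime_gt_1 by simp
lift_definition uminus_residue :: "residue \<Rightarrow> residue" is "\<lambda>x. (- x) mod int critical_prime"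
  using critical_prime_gt_1 by simp
lift_definition times_residue :: "residue \<Rightarrow> residue \<Rightarrow> residue" is "\<lambda>x y. (x * y) mod int critical_prime"
  using critical_prime_gt_1 by simp
lift_definition inverse_residue :: "residue \<Rightarrow> residue" is
  "\<lambda>x. if x = 0 then 0 else (SOME y. y \<in> {0..<int critical_prime} \<and> (x * y) mod int critical_prime = 1)"
  using someI_ex[OF residue_inverse_exists] critical_prime_gt_1 by auto

definition divide_residue :: "residue \<Rightarrow> residue \<Rightarrow> residue" where "divide_residue x y = x * inverse y"

instance
proof
  fix a b c :: residue
  show "a + b + c = a + (b + c)" by transfer (simp add: mod_simps add.assoc)
  show "a + b = b + a" by transfer (simp add: add.commute)
  show "0 + a = a" by transfer simp
  show "- a + a = 0" by transfer (simp add: mod_simps)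
  show "a - b = a + - b" by transfer (simp add: mod_simps)
  show "a * b * c = a * (b * c)" by transfer (simp add: mod_simps mult.assoc)
  show "a * b = b * a" by transfer (simp add: mult.commute)
  show "1 * a = a" by transfer simp
  show "(a + b) * c = a * c + b * c" by transfer (simp add: mod_simps distrib_right)
  show "(0 :: residue) \<noteq> 1" by transfer simp
  show "inverse (0 :: residue) = 0" by transfer simp
  show "a div b = a * inverse b" by (rule divide_residue_def)
  show "a \<noteq> 0 \<Longrightarrow> inverse a * a = 1"
  proof transfer
    fix a assume a: "a \<in> {0..<int critical_prime}" "a \<noteq> 0"
    from someI_ex[OF residue_inverse_exists[OF this]] a(2)
    show "(if a = 0 then 0 else SOME y. y \<in> {0..<int critical_prime} \<and> a * y mod int critical_prime = 1) * a mod
       int critical_prime = 1"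
      by (simp add: mult.commute)
  qed
qed

end

lemma bij_Abs_residue: "bij_betw Abs_residue {0..<int critical_prime} UNIV"
  by (rule bij_betw_byWitness[where f' = Rep_residue])
     (use Rep_residue in \<open>auto simp: Abs_residue_inverse Rep_residue_inverse\<close>)

instance residue :: finite
  by standard (use bij_betw_finite[OF bij_Abs_residue] in simp)

lemma card_residue: "CARD(residue) = critical_prime"
  using bij_betw_same_card[OF bij_Abs_residue] by simp

lemma Rep_of_int: "Rep_residue (of_int k) = k mod int critical_prime"
proof -
  have nat: "Rep_residue (of_nat m) = int m mod int critical_prime" for m
    by (induction m) (simp_all add: zero_residue.rep_eq plus_residue.rep_eq one_residue.rep_eq mod_simps)
  show ?thesis
  proof (cases k rule: int_cases2)
    case (nonneg m)
    then show ?thesis using nat[of m] by simp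
  next
    case (nonpos m)
    then show ?thesis using nat[of m] by (simp add: uminus_residue.rep_eq mod_simps)
  qed
qed

lemma of_int_residue_eq_iff:
  "(of_int i :: residue) = of_int j \<longleftrightarrow> i mod int critical_prime = j mod int critical_prime"
  by (simp only: Rep_residue_inject[symmetric] Rep_of_int)

lemma of_int_mod_residue [simp]: "(of_int (i mod int critical_prime) :: residue) = of_int i"
  by (simp add: of_int_residue_eq_iff)

text \<open>The map \<open>of_int\<close> is injective on canonical representatives and respects
  sums and products modulo the prime. Thus the image of the subgroup satisfies the locale, and the
  tuples counted by both energies correspond componentwise.\<close>

lemma bounds_hold_critical: "bounds_hold critical_prime"
  unfolding bounds_hold_def
proof (intro allI impI)
  define q where "q = critical_prime"
  fix \<Gamma> assume sg: "subgroup \<Gamma> (mult_of (residue_ring (int critical_prime)))"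
  define e :: "int \<Rightarrow> residue" where "e = of_int"
  interpret R: residues_prime q "residue_ring (int q)"
    by unfold_locales (simp add: q_def critical_prime)
  note sg = sg[folded q_def]
  have sub: "\<Gamma> \<subseteq> {0..<int q}" "0 \<notin> \<Gamma>"
    using subgroup.subset[OF sg] by (auto simp: R.res_carrier_eq R.zero_cong)
  have one: "1 \<in> \<Gamma>" using subgroup.one_closed[OF sg] by (simp add: R.res_one_eq)
  have mult: "x * y mod int q \<in> \<Gamma>" if "x \<in> \<Gamma>" "y \<in> \<Gamma>" for x y
    using subgroup.m_closed[OF sg that] by (simp add: R.res_mult_eq)
  have e_eq: "e x = e y \<longleftrightarrow> x mod int q = y mod int q" for x y
    by (simp add: e_def of_int_residue_eq_iff q_def)
  have inj: "inj_on e {0..<int q}" by (auto simp: inj_on_def e_eq)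
  have inj\<Gamma>: "inj_on e \<Gamma>" by (rule inj_on_subset[OF inj sub(1)])
  have fin: "finite \<Gamma>" using sub by (rule_tac finite_subset) auto
  define G where "G = e ` \<Gamma>"
  have e_mod: "e (x mod int q) = e x" for x by (simp add: e_def q_def)
  have "G = {x. x ^ card G = 1}"
  proof (rule finite_multiplicative_set_eq_roots)
    show "1 \<in> G" unfolding G_def using one by (rule image_eqI[rotated]) (simp add: e_def)
    show "0 \<notin> G"
    proof
      assume "0 \<in> G"
      then obtain x where "x \<in> \<Gamma>" "e x = e 0" by (auto simp: G_def e_def)
      then show False using sub inj_onD[OF inj, of x 0] by (metis critical_prime_gt_1 atLeastLessThan_iff order.refl q_def subset_iff zero_less_one order.strict_trans)
    qed
    show "x * y \<in> G" if "x \<in> G" "y \<in> G" for x y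
    proof -
      from that obtain a b where "a \<in> \<Gamma>" "b \<in> \<Gamma>" "x = e a" "y = e b" by (auto simp: G_def)
      then show ?thesis using mult[of a b] unfolding G_def
        by (intro image_eqI[of _ _ "a * b mod int q"]) (auto simp: e_mod, simp add: e_def)
    qed
  qed (simp add: G_def fin)
  moreover have cG: "card G = card \<Gamma>" unfolding G_def by (rule card_image[OF inj\<Gamma>])
  ultimately have G: "G = {x. x ^ card \<Gamma> = 1}" by simp
  interpret S: power_subgroup G "card \<Gamma>" q
  proof
    show "q = CARD(residue)" by (simp add: card_residue q_def)
    show "(of_nat k :: residue) \<noteq> 0" if "0 < k" "k < q" for k
      using that of_int_residue_eq_iff[of "int k" 0] by (simp add: q_def)
    show "0 < card \<Gamma>" using one fin by (auto simp: card_gt_0_iff)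
  qed (use G cG in auto)
  have add: "x \<oplus>\<^bsub>residue_ring (int q)\<^esub> y = (x + y) mod int q" for x y by (simp add: R.res_add_eq)
  have "additive_energy (residue_ring (int q)) \<Gamma> = S.energy"
    unfolding additive_energy_def S.energy_eq_card
  proof (rule bij_betw_same_card[of "\<lambda>(a, b, c, d). (e a, e b, e c, e d)"], unfold bij_betw_def, intro conjI)
    show "inj_on (\<lambda>(a, b, c, d). (e a, e b, e c, e d)) {(a1, a2, a3, a4). a1 \<in> \<Gamma> \<and> a2 \<in> \<Gamma> \<and> a3 \<in> \<Gamma> \<and> a4 \<in> \<Gamma> \<and>
         a1 \<oplus>\<^bsub>residue_ring (int q)\<^esub> a2 = a3 \<oplus>\<^bsub>residue_ring (int q)\<^esub> a4}"
      by (rule inj_onI) (auto dest: inj_onD[OF inj\<Gamma>])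
    show "(\<lambda>(a, b, c, d). (e a, e b, e c, e d)) ` {(a1, a2, a3, a4). a1 \<in> \<Gamma> \<and> a2 \<in> \<Gamma> \<and> a3 \<in> \<Gamma> \<and> a4 \<in> \<Gamma> \<and>
         a1 \<oplus>\<^bsub>residue_ring (int q)\<^esub> a2 = a3 \<oplus>\<^bsub>residue_ring (int q)\<^esub> a4}
      = {(a1, a2, a3, a4). a1 \<in> G \<and> a2 \<in> G \<and> a3 \<in> G \<and> a4 \<in> G \<and> a1 + a2 = a3 + a4}"
    proof -
      have eq: "a \<oplus>\<^bsub>residue_ring (int q)\<^esub> b = c \<oplus>\<^bsub>residue_ring (int q)\<^esub> d \<longleftrightarrow> e a + e b = e c + e d" for a b c d
        using e_eq[of "a + b" "c + d"] by (simp add: add e_def)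
      show ?thesis unfolding eq
      proof (intro equalityI subsetI)
        fix t assume "t \<in> {(a1, a2, a3, a4). a1 \<in> G \<and> a2 \<in> G \<and> a3 \<in> G \<and> a4 \<in> G \<and> a1 + a2 = a3 + a4}"
        then obtain a b c d where "t = (e a, e b, e c, e d)" "a \<in> \<Gamma>" "b \<in> \<Gamma>" "c \<in> \<Gamma>" "d \<in> \<Gamma>" "e a + e b = e c + e d"
          by (auto simp: G_def)
        then show "t \<in> (\<lambda>(a, b, c, d). (e a, e b, e c, e d)) `
            {(a1, a2, a3, a4). a1 \<in> \<Gamma> \<and> a2 \<in> \<Gamma> \<and> a3 \<in> \<Gamma> \<and> a4 \<in> \<Gamma> \<and> e a1 + e a2 = e a3 + e a4}"
          by (intro image_eqI[of _ _ "(a, b, c, d)"]) auto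
      qed (auto simp: G_def)
    qed
  qed
  moreover have "higher_energy (residue_ring (int q)) k \<Gamma> = S.moment k" for k
    unfolding higher_energy_def S.moment_eq_card
  proof (rule bij_betw_same_card[of "\<lambda>(a, a'). (restrict (e \<circ> a) {..<k}, restrict (e \<circ> a') {..<k})"],
         unfold bij_betw_def, intro conjI)
    define A where "A = {..<k} \<rightarrow>\<^sub>E \<Gamma>"
    define B where "B = {..<k} \<rightarrow>\<^sub>E G"
    define h where "h a = restrict (e \<circ> a) {..<k}" for a
    have bij: "bij_betw h A B"
    proof (rule bij_betw_byWitness[where f' = "\<lambda>b. restrict (inv_into \<Gamma> e \<circ> b) {..<k}"])
      show "\<forall>a\<in>A. restrict (inv_into \<Gamma> e \<circ> h a) {..<k} = a"
        by (auto simp: A_def h_def fun_eq_iff restrict_def PiE_def extensional_def Pi_def inv_into_f_f[OF inj\<Gamma>])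
      show "\<forall>b\<in>B. h (restrict (inv_into \<Gamma> e \<circ> b) {..<k}) = b"
        by (auto simp: B_def G_def h_def fun_eq_iff restrict_def PiE_def extensional_def Pi_def f_inv_into_f)
      show "h ` A \<subseteq> B" by (auto simp: A_def B_def G_def h_def)
      show "(\<lambda>b. restrict (inv_into \<Gamma> e \<circ> b) {..<k}) ` B \<subseteq> A"
      proof (rule image_subsetI)
        fix b assume "b \<in> B"
        then have "b i \<in> e ` \<Gamma>" if "i \<in> {..<k}" for i using that unfolding B_def G_def by (rule PiE_mem)
        then show "restrict (inv_into \<Gamma> e \<circ> b) {..<k} \<in> A"
          unfolding A_def by (intro PiE_I) (simp_all add: inv_into_into)
      qed
    qed
    \<comment> \<open>A finite sum in the residue ring is the integer sum reduced modulo q, and the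
      field type identifies exactly the integers congruent modulo q.\<close>
    have sum_eq: "((\<Oplus>\<^bsub>residue_ring (int q)\<^esub>i\<in>{..<k}. a i) = (\<Oplus>\<^bsub>residue_ring (int q)\<^esub>i\<in>{..<k}. a' i))
       \<longleftrightarrow> (\<Sum>i<k. h a i) = (\<Sum>i<k. h a' i)" if "a \<in> A" "a' \<in> A" for a a'
    proof -
      have fs: "(\<Oplus>\<^bsub>residue_ring (int q)\<^esub>i\<in>{..<k}. a i) = (\<Sum>i<k. a i) mod int q" if "a \<in> A" for a
      proof -
        have r: "a i \<in> {0..<int q}" if "i \<in> {..<k}" for i
          using that \<open>a \<in> A\<close> sub by (auto simp: A_def dest: PiE_mem)
        have "(\<Oplus>\<^bsub>residue_ring (int q)\<^esub>i\<in>{..<k}. a i) = (\<Oplus>\<^bsub>residue_ring (int q)\<^esub>i\<in>{..<k}. a i mod int q)"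
          by (rule R.finsum_cong') (use r in \<open>auto simp: R.res_carrier_eq\<close>)
        also have "\<dots> = (\<Sum>i<k. a i) mod int q" by (rule R.sum_cong) simp
        finally show ?thesis .
      qed
      have es: "(\<Sum>i<k. h a i) = e (\<Sum>i<k. a i)" for a by (simp add: h_def e_def)
      show ?thesis unfolding fs[OF that(1)] fs[OF that(2)] es e_eq ..
    qed
    show "inj_on (\<lambda>(a, a'). (restrict (e \<circ> a) {..<k}, restrict (e \<circ> a') {..<k}))
      {(a, a'). a \<in> {..<k} \<rightarrow>\<^sub>E \<Gamma> \<and> a' \<in> {..<k} \<rightarrow>\<^sub>E \<Gamma> \<and>
       (\<Oplus>\<^bsub>residue_ring (int q)\<^esub>i\<in>{..<k}. a i) = (\<Oplus>\<^bsub>residue_ring (int q)\<^esub>i\<in>{..<k}. a' i)}"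
      unfolding A_def[symmetric] h_def[symmetric]
      using bij by (auto simp: inj_on_def bij_betw_def)
    show "(\<lambda>(a, a'). (restrict (e \<circ> a) {..<k}, restrict (e \<circ> a') {..<k})) `
      {(a, a'). a \<in> {..<k} \<rightarrow>\<^sub>E \<Gamma> \<and> a' \<in> {..<k} \<rightarrow>\<^sub>E \<Gamma> \<and>
       (\<Oplus>\<^bsub>residue_ring (int q)\<^esub>i\<in>{..<k}. a i) = (\<Oplus>\<^bsub>residue_ring (int q)\<^esub>i\<in>{..<k}. a' i)}
      = {(a, a'). a \<in> {..<k} \<rightarrow>\<^sub>E G \<and> a' \<in> {..<k} \<rightarrow>\<^sub>E G \<and> (\<Sum>i<k. a i) = (\<Sum>i<k. a' i)}"
      unfolding A_def[symmetric] B_def[symmetric] h_def[symmetric]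
    proof (intro equalityI subsetI)
      fix bb assume "bb \<in> {(a, a'). a \<in> B \<and> a' \<in> B \<and> (\<Sum>i<k. a i) = (\<Sum>i<k. a' i)}"
      then obtain b b' where b: "bb = (b, b')" "b \<in> B" "b' \<in> B" "(\<Sum>i<k. b i) = (\<Sum>i<k. b' i)" by auto
      then obtain a a' where "a \<in> A" "a' \<in> A" "b = h a" "b' = h a'" using bij by (auto simp: bij_betw_def)
      then show "bb \<in> (\<lambda>(a, a'). (h a, h a')) ` {(a, a'). a \<in> A \<and> a' \<in> A \<and>
        (\<Oplus>\<^bsub>residue_ring (int q)\<^esub>i\<in>{..<k}. a i) = (\<Oplus>\<^bsub>residue_ring (int q)\<^esub>i\<in>{..<k}. a' i)}"
        using b sum_eq by auto
    qed (use bij sum_eq in \<open>auto simp: bij_betw_def\<close>)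
  qed
  ultimately show "subgroup_bounds critical_prime (card \<Gamma>) (additive_energy (residue_ring (int critical_prime)) \<Gamma>)
       (\<lambda>k. higher_energy (residue_ring (int critical_prime)) k \<Gamma>)"
    using S.moment_bounds by (simp add: q_def)
qed

text \<open>If the bounds failed for any prime, they would fail for
  \<open>critical_prime\<close>.\<close>

theorem subgroup_bounds:
  assumes "prime p" "subgroup \<Gamma> (mult_of (residue_ring (int p)))"
  shows "subgroup_bounds p (card \<Gamma>) (additive_energy (residue_ring (int p)) \<Gamma>)
       (\<lambda>k. higher_energy (residue_ring (int p)) k \<Gamma>)"
  using critical_prime(2) bounds_hold_critical assms unfolding bounds_hold_def by blast

section \<open>Asymptotic form of the bounds\<close>

lemma harm_power_le:
  assumes "2 \<le> n" "0 < j"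
  shows "harm (n ^ j) \<le> (real j + 1) * log 2 (real n)"
proof -
  have h: "harm m \<le> 1 + ln (real m)" if m: "0 < m" for m
  proof -
    obtain k where "m = Suc k" using m by (cases m) auto
    then show ?thesis using decseqD[OF decseq_harm_diff_ln, of 0 k] by (simp add: harm_expand)
  qed
  have L: "1 \<le> log 2 (real n)" using assms(1) by (simp add: le_log_iff)
  have "ln (real n) = ln 2 * log 2 (real n)" by (simp add: log_def)
  also have "\<dots> \<le> 1 * log 2 (real n)" using L ln_2_less_1 by (intro mult_right_mono) auto
  finally have ln: "ln (real n) \<le> log 2 (real n)" by simp
  have "harm (n ^ j) \<le> 1 + real j * ln (real n)"
    using h[of "n ^ j"] assms(1) by (simp add: ln_realpow)
  also have "\<dots> \<le> log 2 (real n) + real j * log 2 (real n)"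
    using L ln by (intro add_mono mult_left_mono) auto
  finally show ?thesis by (simp add: algebra_simps)
qed

lemma log_power_le_powr:
  assumes "0 < \<epsilon>"
  shows "\<exists>K>0. \<forall>n::nat. 2 \<le> n \<longrightarrow> log 2 (real n) ^ a \<le> K * real n powr \<epsilon>"
proof -
  define d where "d = \<epsilon> / (real a + 1)"
  have d: "0 < d" using assms by (simp add: d_def)
  have "log 2 (real n) ^ a \<le> (1 / (d * ln 2)) ^ a * real n powr \<epsilon>" if n: "2 \<le> n" for n :: nat
  proof -
    have "log 2 (real n) \<le> real n powr d / d / ln 2"
      unfolding log_def using n ln_powr_bound[of "real n" d] d by (intro divide_right_mono) auto
    also have "\<dots> = 1 / (d * ln 2) * real n powr d" by simp
    finally have "log 2 (real n) ^ a \<le> (1 / (d * ln 2) * real n powr d) ^ a"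
      using n by (intro power_mono) auto
    also have "\<dots> = (1 / (d * ln 2)) ^ a * real n powr (real a * d)"
      unfolding power_mult_distrib using n by (simp add: powr_power mult.commute)
    also have "\<dots> \<le> (1 / (d * ln 2)) ^ a * real n powr \<epsilon>"
      using n d assms by (intro mult_left_mono powr_mono) (auto simp: d_def field_simps)
    finally show ?thesis .
  qed
  moreover have "0 < (1 / (d * ln 2)) ^ a" using d by simp
  ultimately show ?thesis by blast
qed

lemma root_3_power: "0 < x \<Longrightarrow> root 3 (x ^ m) = x powr (real m / 3)"
  by (simp add: root_powr_inverse powr_powr powr_realpow[symmetric])

lemma le_of_cube_le:
  fixes x y K :: real
  assumes "x ^ 3 \<le> K * y ^ 3" "1 \<le> K" "0 \<le> y"
  shows "x \<le> K * y"
proof -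
  have "K * y ^ 3 \<le> K ^ 3 * y ^ 3"
    using assms self_le_power[of K 3] by (intro mult_right_mono) auto
  then have "x ^ 3 \<le> (K * y) ^ 3" using assms(1) by (simp add: power_mult_distrib)
  then show ?thesis using assms power_le_imp_le_base[of x 2 "K * y"] by (simp add: numeral_3_eq_3 numeral_2_eq_2)
qed

lemma energy_cube_le:
  assumes sb: "subgroup_bounds p n E T" and n: "2 \<le> n" and np: "n ^ 3 \<le> p\<^sup>2"
  shows "real E ^ 3 \<le> 2 ^ 64 * log 2 (real n) * (real n powr (22/3) + real n ^ 9 / real p)"
proof -
  have "real E ^ 3 \<le> 2 ^ 63 * harm n * (root 3 (real n ^ 22) + real n ^ 9 / real p)"
    using sb np by (simp add: subgroup_bounds_def)
  also have "root 3 (real n ^ 22) = real n powr (22/3)" using n root_3_power[of "real n" 22] by simp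
  also have "2 ^ 63 * harm n * (real n powr (22/3) + real n ^ 9 / real p) \<le>
     2 ^ 63 * (2 * log 2 (real n)) * (real n powr (22/3) + real n ^ 9 / real p)"
    using harm_power_le[OF n, of 1] by (intro mult_right_mono mult_left_mono) auto
  finally show ?thesis by simp
qed

lemma log_ge_1: "2 \<le> n \<Longrightarrow> 1 \<le> log 2 (real n)"
  by (simp add: le_log_iff)

text \<open>For n^3 \<le> p^2 this is the cube root of \<open>energy_bound\<close>. Otherwise the
  variance bound takes over: the size hypothesis puts n^4 / p below c times the second term, and p^2
  \<le> n^3 puts n p below it.\<close>

lemma energy_general_bound:
  assumes c: "0 < c" and sb: "subgroup_bounds p n E T" and n: "2 \<le> n" and p: "0 < p"
    and size: "real n \<le> c * (real p powr (2/3) * log 2 (real n) powr (4/3))"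
  shows "real E \<le> (2 ^ 65 + c + 1) * max (real n powr (22/9) * log 2 (real n))
                    (real n ^ 3 * real p powr (-1/3) * log 2 (real n) powr (4/3))"
proof -
  define L where "L = log 2 (real n)"
  define A where "A = real n powr (22/9) * L"
  define B where "B = real n ^ 3 * real p powr (-1/3) * L powr (4/3)"
  have L: "1 \<le> L" unfolding L_def by (rule log_ge_1[OF n])
  have Lp: "1 \<le> L powr (4/3)" using L by (simp add: ge_one_powr_ge_zero)
  have M0: "0 \<le> max A B" using L by (simp add: A_def le_max_iff_disj)
  have "real E \<le> (2 ^ 65 + c + 1) * max A B"
  proof (cases "n ^ 3 \<le> p\<^sup>2")
    case True
    have A3: "L * real n powr (22/3) \<le> A ^ 3"
    proof -
      have "A ^ 3 = real n powr (22/3) * L ^ 3" using n by (simp add: A_def power_mult_distrib powr_power)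
      moreover have "L \<le> L ^ 3" using L by (simp add: self_le_power)
      ultimately show ?thesis by (simp only: mult.commute[of L]) (intro mult_left_mono, auto)
    qed
    have B3: "L * (real n ^ 9 / real p) \<le> B ^ 3"
    proof -
      have "(real p powr (-1/3)) ^ 3 = 1 / real p"
        by (subst powr_power) (use p in \<open>simp_all add: powr_minus_divide\<close>)
      moreover have "(L powr (4/3)) ^ 3 = L ^ 4" using L by (simp add: powr_power)
      ultimately have "B ^ 3 = (real n ^ 3) ^ 3 * (1 / real p) * L ^ 4" by (simp only: B_def power_mult_distrib)
      then have "B ^ 3 = (real n ^ 9 / real p) * L ^ 4" by (simp flip: power_mult)
      moreover have "L \<le> L ^ 4" using L by (simp add: self_le_power)
      ultimately show ?thesis by (simp only: mult.commute[of L]) (intro mult_left_mono, auto)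
    qed
    have "real E ^ 3 \<le> 2 ^ 64 * (L * real n powr (22/3) + L * (real n ^ 9 / real p))"
      using energy_cube_le[OF sb n True] by (simp add: L_def algebra_simps)
    also have "\<dots> \<le> 2 ^ 64 * (max A B ^ 3 + max A B ^ 3)"
    proof (intro mult_left_mono add_mono)
      show "L * real n powr (22/3) \<le> max A B ^ 3"
        using L by (intro order.trans[OF A3] power_mono) (auto simp: A_def)
      show "L * (real n ^ 9 / real p) \<le> max A B ^ 3"
        using L by (intro order.trans[OF B3] power_mono) (auto simp: B_def)
    qed simp
    also have "2 ^ 64 * (X + X) = 2 ^ 65 * X" for X :: real by simp
    finally have "real E \<le> 2 ^ 65 * max A B" by (rule le_of_cube_le[OF _ _ M0]) simp
    also have "\<dots> \<le> (2 ^ 65 + c + 1) * max A B" using c M0 by (intro mult_right_mono) auto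
    finally show ?thesis .
  next
    case False
    have e1: "real n ^ 4 / real p \<le> c * B"
    proof -
      have "real n ^ 4 / real p = real n ^ 3 * real n / real p" by (simp add: power_numeral_reduce)
      also have "\<dots> \<le> real n ^ 3 * (c * (real p powr (2/3) * L powr (4/3))) / real p"
        using size by (intro divide_right_mono mult_left_mono) (auto simp: L_def)
      also have "\<dots> = c * (real n ^ 3 * (real p powr (2/3) / real p powr 1) * L powr (4/3))"
        using p by simp
      also have "\<dots> = c * B" by (simp only: B_def flip: powr_diff) simp
      finally show ?thesis .
    qed
    have e2: "real n * real p \<le> B"
    proof -
      have "real (p\<^sup>2) \<le> real (n ^ 3)" using False by (simp only: of_nat_le_iff)
      then have "real p powr 2 \<le> real n powr 3" using n p by (simp add: powr_numeral)
      then have "(real p powr 2) powr (2/3) \<le> (real n powr 3) powr (2/3)" by (intro powr_mono2) auto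
      then have "real p powr (4/3) \<le> real n powr 2" unfolding powr_powr by simp
      then have "real p powr (4/3) \<le> (real n)\<^sup>2" using n by (simp add: powr_numeral)
      then have "real n * (real p powr (4/3) * real p powr (-1/3)) \<le> real n * ((real n)\<^sup>2 * real p powr (-1/3))"
        by (intro mult_left_mono mult_right_mono) auto
      also have "real p powr (4/3) * real p powr (-1/3) = real p" using p by (simp flip: powr_add)
      also have "real n * ((real n)\<^sup>2 * real p powr (-1/3)) = real n ^ 3 * real p powr (-1/3) * 1"
        by (simp add: power2_eq_square power3_eq_cube)
      also have "\<dots> \<le> B" unfolding B_def using Lp by (intro mult_left_mono) auto
      finally show ?thesis .
    qed
    have "real E \<le> real n ^ 4 / real p + real n * real p" using sb by (simp add: subgroup_bounds_def)
    also have "\<dots> \<le> c * B + B" using e1 e2 by (rule add_mono)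
    also have "\<dots> = (c + 1) * B" by (simp add: algebra_simps)
    also have "\<dots> \<le> (2 ^ 65 + c + 1) * max A B" using c by (intro mult_mono) (auto simp: B_def)
    finally show ?thesis .
  qed
  then show ?thesis by (simp only: A_def B_def L_def)
qed

text \<open>The size hypothesis gives n \<le> c p^(3/5), and raising this to the power 5/3 makes n^9
  / p at most c^(5/3) n^(22/3). The range n^3 > p^2 would need p^(2/3) \<le> c p^(3/5), so there p
  and n are bounded in terms of c alone.\<close>

lemma energy_medium_bound:
  assumes c: "0 < c" and sb: "subgroup_bounds p n E T" and n: "2 \<le> n" and p: "2 \<le> p"
    and size: "real n \<le> c * (real p powr (3/5) * log 2 (real p) powr (-6/5))"
  shows "real E \<le> (2 ^ 64 * (1 + c powr (5/3)) + c ^ 40 + c ^ 25) * (real n powr (22/9) * log 2 (real n) powr (2/3))"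
proof -
  define L where "L = log 2 (real n)"
  define Y where "Y = real n powr (22/9) * L powr (2/3)"
  have L: "1 \<le> L" unfolding L_def by (rule log_ge_1[OF n])
  have Y1: "1 \<le> Y"
    unfolding Y_def using n L mult_mono[of 1 "real n powr (22/9)" 1 "L powr (2/3)"] by (simp add: ge_one_powr_ge_zero)
  have c53: "0 \<le> c powr (5/3)" by simp
  have "log 2 (real p) powr (-6/5) \<le> 1 powr (-6/5)"
    by (intro powr_mono2') (use log_ge_1[OF p] in auto)
  then have "c * (real p powr (3/5) * log 2 (real p) powr (-6/5)) \<le> c * (real p powr (3/5) * 1)"
    using c by (intro mult_left_mono) auto
  then have size': "real n \<le> c * real p powr (3/5)" using size by simp
  have "real E \<le> (2 ^ 64 * (1 + c powr (5/3)) + c ^ 40 + c ^ 25) * Y"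
  proof (cases "n ^ 3 \<le> p\<^sup>2")
    case True
    have "real n powr (5/3) \<le> (c * real p powr (3/5)) powr (5/3)" using size' by (intro powr_mono2) auto
    also have "\<dots> = c powr (5/3) * real p" using c p by (simp add: powr_mult powr_powr)
    finally have "real n powr (22/3) * real n powr (5/3) \<le> real n powr (22/3) * (c powr (5/3) * real p)"
      by (intro mult_left_mono) auto
    moreover have "real n powr (22/3) * real n powr (5/3) = real n ^ 9"
      using n by (simp add: powr_numeral flip: powr_add)
    ultimately have p9: "real n ^ 9 / real p \<le> c powr (5/3) * real n powr (22/3)"
      using p by (simp add: divide_le_eq mult_ac)
    have "real E ^ 3 \<le> 2 ^ 64 * L * (real n powr (22/3) + real n ^ 9 / real p)"
      unfolding L_def by (rule energy_cube_le[OF sb n True])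
    also have "\<dots> \<le> 2 ^ 64 * L\<^sup>2 * (real n powr (22/3) + c powr (5/3) * real n powr (22/3))"
      using p9 L self_le_power[of L 2] by (intro mult_mono add_mono) auto
    also have "\<dots> = 2 ^ 64 * (1 + c powr (5/3)) * (real n powr (22/3) * L\<^sup>2)" by (simp add: algebra_simps)
    also have "real n powr (22/3) * L\<^sup>2 = Y ^ 3"
      using n L by (simp add: Y_def power_mult_distrib powr_power powr_numeral)
    finally have "real E \<le> 2 ^ 64 * (1 + c powr (5/3)) * Y"
      by (rule le_of_cube_le) (use Y1 c53 in auto)
    also have "\<dots> \<le> (2 ^ 64 * (1 + c powr (5/3)) + c ^ 40 + c ^ 25) * Y"
      using Y1 c by (intro mult_right_mono) auto
    finally show ?thesis .
  next
    case False
    have "real (p\<^sup>2) \<le> real (n ^ 3)" using False by (simp only: of_nat_le_iff)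
    then have "real p powr 2 \<le> real n powr 3" using n p by (simp add: powr_numeral)
    then have "(real p powr 2) powr (1/3) \<le> (real n powr 3) powr (1/3)" by (intro powr_mono2) auto
    then have "real p powr (2/3) \<le> real n" unfolding powr_powr using n by simp
    then have "real p powr (2/3) \<le> c * real p powr (3/5)" using size' by linarith
    then have "real p powr (1/15) * real p powr (3/5) \<le> c * real p powr (3/5)" by (simp flip: powr_add)
    then have "real p powr (1/15) \<le> c" using p by simp
    \<comment> \<open>The exponent 1/15 is 2/3 - 3/5. Hence p \<le> c^15 and n \<le> c^10, and n^4 /
      p + n p is at most c^40 + c^25, the last two summands of the constant.\<close>
    then have "(real p powr (1/15)) ^ 15 \<le> c ^ 15" by (rule power_mono) simp
    then have pc: "real p \<le> c ^ 15" using p by (simp add: powr_power)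
    have "real p powr (3/5) \<le> (c ^ 15) powr (3/5)" using pc by (intro powr_mono2) auto
    also have "\<dots> = (c powr real 15) powr (3/5)" by (simp only: powr_realpow[OF c])
    also have "\<dots> = c powr real 9" unfolding powr_powr by simp
    also have "\<dots> = c ^ 9" by (rule powr_realpow[OF c])
    finally have "c * real p powr (3/5) \<le> c * c ^ 9" using c by (intro mult_left_mono) auto
    then have nc: "real n \<le> c ^ 10" using size' by (simp add: power_numeral_reduce)
    have "real E \<le> real n ^ 4 / real p + real n * real p" using sb by (simp add: subgroup_bounds_def)
    also have "\<dots> \<le> (c ^ 10) ^ 4 + c ^ 10 * c ^ 15"
    proof (rule add_mono)
      have "real n ^ 4 / real p \<le> real n ^ 4 / 1" using p by (intro divide_left_mono) auto
      also have "\<dots> \<le> (c ^ 10) ^ 4" unfolding div_by_1 using nc by (rule power_mono) simp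
      finally show "real n ^ 4 / real p \<le> (c ^ 10) ^ 4" .
      show "real n * real p \<le> c ^ 10 * c ^ 15" using nc pc c by (intro mult_mono) auto
    qed
    also have "\<dots> = (c ^ 40 + c ^ 25) * 1" by (simp flip: power_mult power_add)
    also have "\<dots> \<le> (2 ^ 64 * (1 + c powr (5/3)) + c ^ 40 + c ^ 25) * Y"
      using Y1 c by (intro mult_mono) auto
    finally show ?thesis .
  qed
  then show ?thesis by (simp only: Y_def L_def)
qed

lemma small_subgroup_energy_bound:
  assumes sb: "subgroup_bounds p n E T" and n: "2 \<le> n" and np: "n\<^sup>2 \<le> p"
  shows "real E \<le> 2 ^ 65 * (real n powr (22/9) * log 2 (real n) powr (1/3))"
proof -
  define L where "L = log 2 (real n)"
  have L: "1 \<le> L" unfolding L_def by (rule log_ge_1[OF n])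
  have p: "0 < p" using n np by (intro Nat.gr0I) auto
  have np3: "n ^ 3 \<le> p\<^sup>2" using n np by (intro cube_le_square) auto
  have "real n ^ 9 / real p \<le> real n powr (22/3)"
  proof -
    have "real (n\<^sup>2) \<le> real p" using np by (simp only: of_nat_le_iff)
    then have "real n ^ 9 / real p \<le> real n ^ 9 / (real n)\<^sup>2" using n p by (intro divide_left_mono) auto
    also have "\<dots> = real n powr 7" using n by (simp add: powr_numeral power_numeral_reduce)
    also have "\<dots> \<le> real n powr (22/3)" using n by (intro powr_mono) auto
    finally show ?thesis .
  qed
  then have "2 ^ 64 * L * (real n powr (22/3) + real n ^ 9 / real p) \<le> 2 ^ 64 * L * (real n powr (22/3) + real n powr (22/3))"
    using L by (intro mult_left_mono add_left_mono) auto
  then have "real E ^ 3 \<le> 2 ^ 64 * L * (real n powr (22/3) + real n powr (22/3))"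
    using energy_cube_le[OF sb n np3] by (simp add: L_def)
  also have "\<dots> = 2 ^ 65 * (real n powr (22/9) * L powr (1/3)) ^ 3"
    using n L by (simp add: power_mult_distrib powr_power)
  finally show ?thesis unfolding L_def[symmetric] by (rule le_of_cube_le) (use n L in auto)
qed

text \<open>The target exponent 151/36 exceeds the exponent 25/6 = 150/36 from
  \<open>T3_bound\<close> by 1/36. On the level of squares this leaves n^(2/36), which absorbs the
  six logarithms; the other alternatives have more room.\<close>

lemma T3_asymptotic:
  "\<exists>C>0. \<forall>p n E T. subgroup_bounds p n E T \<longrightarrow> 2 \<le> n \<longrightarrow> n\<^sup>2 \<le> p \<longrightarrow> real (T 3) \<le> C * real n powr (151/36)"
proof -
  obtain K1 where K1: "0 < K1" "\<And>n::nat. 2 \<le> n \<Longrightarrow> log 2 (real n) ^ 1 \<le> K1 * real n powr (1/36)"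
    using log_power_le_powr[of "1/36" 1] by auto
  obtain K6 where K6: "0 < K6" "\<And>n::nat. 2 \<le> n \<Longrightarrow> log 2 (real n) ^ 6 \<le> K6 * real n powr (2/36)"
    using log_power_le_powr[of "2/36" 6] by auto
  define K where "K = 2 ^ 65 * K1"
  define C where "C = 1 + 2 * K + 4 * K\<^sup>2 + 2 ^ 71 * 3375 * K6"
  have K0: "0 < K" using K1 by (simp add: K_def)
  have C1: "1 \<le> C" using K0 K6(1) by (simp add: C_def)
  have "real (T 3) \<le> C * real n powr (151/36)"
    if sb: "subgroup_bounds p n E T" and n: "2 \<le> n" and np: "n\<^sup>2 \<le> p" for p n E T
  proof -
    define x where "x = real n"
    define L where "L = log 2 x"
    have x: "2 \<le> x" using n by (simp add: x_def)
    have L: "1 \<le> L" unfolding L_def x_def by (rule log_ge_1[OF n])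
    have E: "real E \<le> K * x powr (89/36)"
    proof -
      have "L powr (1/3) \<le> L powr 1" using L by (intro powr_mono) auto
      also have "\<dots> \<le> K1 * x powr (1/36)" using K1(2)[OF n] L by (simp add: L_def x_def)
      finally have "2 ^ 65 * (x powr (22/9) * L powr (1/3)) \<le> 2 ^ 65 * (x powr (22/9) * (K1 * x powr (1/36)))"
        by (intro mult_left_mono) auto
      also have "\<dots> = K * (x powr (22/9) * x powr (1/36))" by (simp add: K_def)
      also have "x powr (22/9) * x powr (1/36) = x powr (89/36)" by (simp flip: powr_add)
      finally show ?thesis using small_subgroup_energy_bound[OF sb n np] by (simp add: x_def L_def)
    qed
    have "T 3 \<le> n ^ 4 \<or> T 3 \<le> 2 * n * E \<or>
      (real (T 3))\<^sup>2 \<le> 4 * x ^ 3 * (real E)\<^sup>2 + 2 ^ 71 * root 3 (x ^ 25) * harm (n\<^sup>2) ^ 3 * harm (n ^ 4) ^ 3"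
      using sb np unfolding subgroup_bounds_def x_def by blast
    then consider "T 3 \<le> n ^ 4" | "T 3 \<le> 2 * n * E" |
      "(real (T 3))\<^sup>2 \<le> 4 * x ^ 3 * (real E)\<^sup>2 + 2 ^ 71 * root 3 (x ^ 25) * harm (n\<^sup>2) ^ 3 * harm (n ^ 4) ^ 3"
      by blast
    then have "real (T 3) \<le> C * x powr (151/36)"
    proof cases
      case 1
      then have "real (T 3) \<le> real (n ^ 4)" by (simp only: of_nat_le_iff)
      also have "\<dots> = 1 * x powr 4" using x by (simp add: x_def powr_numeral)
      also have "\<dots> \<le> C * x powr (151/36)" using C1 x by (intro mult_mono powr_mono) auto
      finally show ?thesis .
    next
      case 2
      then have "real (T 3) \<le> real (2 * n * E)" by (simp only: of_nat_le_iff)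
      also have "\<dots> = 2 * x * real E" by (simp add: x_def)
      also have "\<dots> \<le> 2 * x * (K * x powr (89/36))" using E x by (intro mult_left_mono) auto
      also have "\<dots> = 2 * K * (x powr 1 * x powr (89/36))" using x by simp
      also have "x powr 1 * x powr (89/36) = x powr (125/36)" by (subst powr_add[symmetric]) simp
      also have "2 * K * x powr (125/36) \<le> C * x powr (151/36)"
        using K0 K6(1) x by (intro mult_mono powr_mono) (auto simp: C_def)
      finally show ?thesis .
    next
      case 3
      have h: "harm (n\<^sup>2) ^ 3 * harm (n ^ 4) ^ 3 \<le> 3375 * L ^ 6"
      proof -
        have "harm (n\<^sup>2) ^ 3 * harm (n ^ 4) ^ 3 \<le> (3 * L) ^ 3 * (5 * L) ^ 3"
          using harm_power_le[OF n, of 2] harm_power_le[OF n, of 4] L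
          by (intro mult_mono power_mono) (auto simp: L_def x_def harm_nonneg)
        then show ?thesis by (simp add: power_mult_distrib flip: power_add)
      qed
      have a: "4 * x ^ 3 * (real E)\<^sup>2 \<le> 4 * K\<^sup>2 * x powr (151/18)"
      proof -
        have "(real E)\<^sup>2 \<le> (K * x powr (89/36))\<^sup>2" using E by (intro power_mono) auto
        also have "\<dots> = K\<^sup>2 * x powr (89/18)" using x by (simp add: power_mult_distrib powr_power)
        finally have "4 * x ^ 3 * (real E)\<^sup>2 \<le> 4 * x ^ 3 * (K\<^sup>2 * x powr (89/18))"
          using x by (intro mult_left_mono) auto
        also have "\<dots> = 4 * K\<^sup>2 * (x powr 3 * x powr (89/18))" using x by (simp add: powr_numeral)
        also have "\<dots> = 4 * K\<^sup>2 * x powr (143/18)" by (simp flip: powr_add)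
        also have "\<dots> \<le> 4 * K\<^sup>2 * x powr (151/18)" using x by (intro mult_left_mono powr_mono) auto
        finally show ?thesis .
      qed
      have b: "2 ^ 71 * root 3 (x ^ 25) * harm (n\<^sup>2) ^ 3 * harm (n ^ 4) ^ 3 \<le> 2 ^ 71 * 3375 * K6 * x powr (151/18)"
      proof -
        have "L ^ 6 \<le> K6 * x powr (2/36)" using K6(2)[OF n] by (simp add: L_def x_def)
        then have "harm (n\<^sup>2) ^ 3 * harm (n ^ 4) ^ 3 \<le> 3375 * (K6 * x powr (1/18))" using h by simp
        then have "2 ^ 71 * x powr (25/3) * (harm (n\<^sup>2) ^ 3 * harm (n ^ 4) ^ 3) \<le> 2 ^ 71 * x powr (25/3) * (3375 * (K6 * x powr (1/18)))"
          by (intro mult_left_mono) auto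
        also have "\<dots> = 2 ^ 71 * 3375 * K6 * (x powr (25/3) * x powr (1/18))" by simp
        also have "x powr (25/3) * x powr (1/18) = x powr (151/18)" by (simp flip: powr_add)
        finally show ?thesis using x root_3_power[of x 25] by (simp add: mult.assoc)
      qed
      have "(real (T 3))\<^sup>2 \<le> (4 * K\<^sup>2 + 2 ^ 71 * 3375 * K6) * x powr (151/18)"
        using order.trans[OF 3 add_mono[OF a b]] by (simp only: distrib_right)
      also have "\<dots> \<le> C\<^sup>2 * x powr (151/18)"
      proof (intro mult_right_mono)
        have "4 * K\<^sup>2 + 2 ^ 71 * 3375 * K6 \<le> C" using K0 by (simp add: C_def)
        also have "\<dots> \<le> C\<^sup>2" using C1 by (simp add: self_le_power)
        finally show "4 * K\<^sup>2 + 2 ^ 71 * 3375 * K6 \<le> C\<^sup>2" .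
      qed simp
      also have "\<dots> = (C * x powr (151/36))\<^sup>2" using x by (simp add: power_mult_distrib powr_power)
      finally show ?thesis using C1 by (intro power2_le_imp_le[of "real (T 3)"]) auto
    qed
    then show ?thesis by (simp add: x_def)
  qed
  then show ?thesis using C1 by (intro exI[of _ C]) auto
qed

text \<open>With 151/36 for the threefold sums, \<open>T4_bound\<close> gives 4 + 151/72 apart from
  logarithms. The gap to 55/9 is 1/72, spent in equal parts on the logarithms under the square root
  and on the one outside.\<close>

lemma T4_asymptotic:
  "\<exists>C>0. \<forall>p n E T. subgroup_bounds p n E T \<longrightarrow> 2 \<le> n \<longrightarrow> n\<^sup>2 \<le> p \<longrightarrow> real (T 4) \<le> C * real n powr (55/9)"
proof -
  obtain C3 where C3: "0 < C3" "\<And>p n E T. subgroup_bounds p n E T \<Longrightarrow> 2 \<le> n \<Longrightarrow> n\<^sup>2 \<le> p \<Longrightarrow> real (T 3) \<le> C3 * real n powr (151/36)"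
    using T3_asymptotic by blast
  obtain K1 where K1: "0 < K1" "\<And>n::nat. 2 \<le> n \<Longrightarrow> log 2 (real n) ^ 1 \<le> K1 * real n powr (1/144)"
    using log_power_le_powr[of "1/144" 1] by auto
  obtain K3 where K3: "0 < K3" "\<And>n::nat. 2 \<le> n \<Longrightarrow> log 2 (real n) ^ 3 \<le> K3 * real n powr (1/72)"
    using log_power_le_powr[of "1/72" 3] by auto
  define S where "S = sqrt (C3 * (27 * K3))"
  define C where "C = 1 + (2 ^ 65 * K1)\<^sup>2 + 2 ^ 22 * S * (5 * K1)"
  have S0: "0 \<le> S" using C3 K3 by (simp add: S_def)
  have C1: "1 \<le> C" using S0 K1(1) by (simp add: C_def)
  have "real (T 4) \<le> C * real n powr (55/9)"
    if sb: "subgroup_bounds p n E T" and n: "2 \<le> n" and np: "n\<^sup>2 \<le> p" for p n E T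
  proof -
    define x where "x = real n"
    define L where "L = log 2 x"
    have x: "2 \<le> x" using n by (simp add: x_def)
    have L: "1 \<le> L" unfolding L_def x_def by (rule log_ge_1[OF n])
    have LK: "L \<le> K1 * x powr (1/144)" using K1(2)[OF n] by (simp add: L_def x_def)
    have "real (T 4) \<le> C * x powr (55/9)"
    proof (cases "n ^ 4 \<le> T 3")
      case False
      have "T (Suc 3) \<le> n\<^sup>2 * T 3" using sb unfolding subgroup_bounds_def by blast
      then have "T 4 \<le> n\<^sup>2 * T 3" by (simp add: eval_nat_numeral)
      also have "\<dots> \<le> n\<^sup>2 * n ^ 4" using False by (intro mult_le_mono2) simp
      finally have "real (T 4) \<le> real (n\<^sup>2 * n ^ 4)" by (simp only: of_nat_le_iff)
      also have "\<dots> = 1 * x powr 6" using x by (simp add: x_def powr_numeral flip: power_add)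
      also have "\<dots> \<le> C * x powr (55/9)" using C1 x by (intro mult_mono powr_mono) auto
      finally show ?thesis .
    next
      case True
      have "real (T 4) \<le> (real E)\<^sup>2 + 2 ^ 22 * x ^ 4 * sqrt (real (T 3) * harm (n\<^sup>2) ^ 3) * harm (n ^ 4)"
        using sb np True unfolding subgroup_bounds_def x_def by blast
      also have "(real E)\<^sup>2 \<le> (2 ^ 65 * K1)\<^sup>2 * x powr (55/9)"
      proof -
        have "L powr (1/3) \<le> L powr 1" using L by (intro powr_mono) auto
        also have "\<dots> \<le> K1 * x powr (1/144)" using LK L by simp
        finally have "2 ^ 65 * (x powr (22/9) * L powr (1/3)) \<le> 2 ^ 65 * (x powr (22/9) * (K1 * x powr (1/144)))"
          by (intro mult_left_mono) auto
        also have "\<dots> = 2 ^ 65 * K1 * (x powr (22/9) * x powr (1/144))" by simp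
        also have "\<dots> \<le> 2 ^ 65 * K1 * x powr (55/18)"
          using x K1(1) by (intro mult_left_mono) (auto simp flip: powr_add)
        finally have "real E \<le> 2 ^ 65 * K1 * x powr (55/18)"
          using small_subgroup_energy_bound[OF sb n np] by (simp add: x_def L_def)
        then have "(real E)\<^sup>2 \<le> (2 ^ 65 * K1 * x powr (55/18))\<^sup>2" by (intro power_mono) auto
        also have "\<dots> = (2 ^ 65 * K1)\<^sup>2 * x powr (55/9)" using x by (simp add: power_mult_distrib powr_power)
        finally show ?thesis .
      qed
      also have "2 ^ 22 * x ^ 4 * sqrt (real (T 3) * harm (n\<^sup>2) ^ 3) * harm (n ^ 4)
        \<le> 2 ^ 22 * S * (5 * K1) * x powr (55/9)"
      proof -
        have "harm (n\<^sup>2) ^ 3 \<le> (3 * L) ^ 3"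
          using harm_power_le[OF n, of 2] L by (intro power_mono) (auto simp: L_def x_def harm_nonneg)
        also have "\<dots> \<le> 27 * (K3 * x powr (1/72))"
          using K3(2)[OF n] by (simp add: L_def x_def power_mult_distrib)
        finally have "real (T 3) * harm (n\<^sup>2) ^ 3 \<le> (C3 * x powr (151/36)) * (27 * (K3 * x powr (1/72)))"
          using C3(2)[OF sb n np] C3(1) by (intro mult_mono) (auto simp: x_def harm_nonneg)
        also have "\<dots> = C3 * (27 * K3) * (x powr (151/36) * x powr (1/72))" by simp
        also have "x powr (151/36) * x powr (1/72) = (x powr (303/144))\<^sup>2"
          using x by (simp add: powr_power flip: powr_add)
        finally have "sqrt (real (T 3) * harm (n\<^sup>2) ^ 3) \<le> sqrt (C3 * (27 * K3) * (x powr (303/144))\<^sup>2)" by simp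
        also have "\<dots> = S * x powr (303/144)" by (simp add: real_sqrt_mult S_def)
        finally have s: "sqrt (real (T 3) * harm (n\<^sup>2) ^ 3) \<le> S * x powr (303/144)" .
        have h: "harm (n ^ 4) \<le> 5 * (K1 * x powr (1/144))"
          using harm_power_le[OF n, of 4] LK by (simp add: L_def x_def)
        have "2 ^ 22 * x ^ 4 * sqrt (real (T 3) * harm (n\<^sup>2) ^ 3) * harm (n ^ 4)
          \<le> 2 ^ 22 * x ^ 4 * (S * x powr (303/144)) * (5 * (K1 * x powr (1/144)))"
          using s h S0 x by (intro mult_mono) (auto simp: harm_nonneg)
        also have "\<dots> = 2 ^ 22 * S * (5 * K1) * (x powr 4 * x powr (303/144) * x powr (1/144))"
          using x by (simp add: powr_numeral)
        also have "x powr 4 * x powr (303/144) * x powr (1/144) = x powr (55/9)" by (simp flip: powr_add)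
        finally show ?thesis .
      qed
      finally have "real (T 4) \<le> ((2 ^ 65 * K1)\<^sup>2 + 2 ^ 22 * S * (5 * K1)) * x powr (55/9)"
        by (simp add: distrib_right)
      also have "\<dots> \<le> C * x powr (55/9)" by (intro mult_right_mono) (auto simp: C_def)
      finally show ?thesis .
    qed
    then show ?thesis by (simp add: x_def)
  qed
  then show ?thesis using C1 by (intro exI[of _ C]) auto
qed

text \<open>At k = 2 and k = 3 the exponent evaluates to 22/9 and 151/36. From k = 4 on, the
  positive summand 16/3 * 2^(-2 k) is given away: 2 k - 17/9 equals 55/9 at k = 4 and grows by 2 per
  step, just as the trivial recursion does.\<close>

lemma higher_moment_asymptotic:
  assumes k: "2 \<le> k"
  shows "\<exists>C>0. \<forall>p n E T. subgroup_bounds p n E T \<longrightarrow> 2 \<le> n \<longrightarrow> n\<^sup>2 \<le> p \<longrightarrow>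
    real (T k) \<le> C * (real n powr (2 * real k - 17/9 + 16/3 * 2 powr (- 2 * real k)) * log 2 (real n) powr (2/3))"
proof -
  have Lp: "1 \<le> log 2 (real n) powr (2/3)" if "2 \<le> n" for n
    using log_ge_1[OF that] by (simp add: ge_one_powr_ge_zero)
  consider "k = 2" | "k = 3" | "4 \<le> k" using k by linarith
  then show ?thesis
  proof cases
    case 1
    have ex: "2 * real k - 17/9 + 16/3 * 2 powr (- 2 * real k) = 22/9"
      by (simp add: 1 powr_minus powr_numeral)
    have "real (T k) \<le> 2 ^ 65 * (real n powr (22/9) * log 2 (real n) powr (2/3))"
      if sb: "subgroup_bounds p n E T" and n: "2 \<le> n" and np: "n\<^sup>2 \<le> p" for p n E T
    proof -
      have "T k = E" using sb by (simp add: subgroup_bounds_def 1)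
      then have "real (T k) \<le> 2 ^ 65 * (real n powr (22/9) * log 2 (real n) powr (1/3))"
        using small_subgroup_energy_bound[OF sb n np] by simp
      also have "\<dots> \<le> 2 ^ 65 * (real n powr (22/9) * log 2 (real n) powr (2/3))"
        using log_ge_1[OF n] by (intro mult_left_mono powr_mono) auto
      finally show ?thesis .
    qed
    then show ?thesis unfolding ex by (intro exI[of _ "2 ^ 65"]) auto
  next
    case 2
    have ex: "2 * real k - 17/9 + 16/3 * 2 powr (- 2 * real k) = 151/36"
      by (simp add: 2 powr_minus powr_numeral)
    obtain C where C: "0 < C" "\<And>p n E T. subgroup_bounds p n E T \<Longrightarrow> 2 \<le> n \<Longrightarrow> n\<^sup>2 \<le> p \<Longrightarrow> real (T 3) \<le> C * real n powr (151/36)"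
      using T3_asymptotic by blast
    have "real (T k) \<le> C * (real n powr (151/36) * log 2 (real n) powr (2/3))"
      if sb: "subgroup_bounds p n E T" and n: "2 \<le> n" and np: "n\<^sup>2 \<le> p" for p n E T
    proof -
      have "real (T k) \<le> C * (real n powr (151/36) * 1)" using C(2)[OF sb n np] by (simp add: 2)
      also have "\<dots> \<le> C * (real n powr (151/36) * log 2 (real n) powr (2/3))"
        using Lp[OF n] C(1) by (intro mult_left_mono) auto
      finally show ?thesis .
    qed
    then show ?thesis unfolding ex using C(1) by blast
  next
    case 3
    obtain C where C: "0 < C" "\<And>p n E T. subgroup_bounds p n E T \<Longrightarrow> 2 \<le> n \<Longrightarrow> n\<^sup>2 \<le> p \<Longrightarrow> real (T 4) \<le> C * real n powr (55/9)"
      using T4_asymptotic by blast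
    have "real (T k) \<le> C * (real n powr (2 * real k - 17/9 + 16/3 * 2 powr (- 2 * real k)) * log 2 (real n) powr (2/3))"
      if sb: "subgroup_bounds p n E T" and n: "2 \<le> n" and np: "n\<^sup>2 \<le> p" for p n E T
    proof -
      have step: "T (Suc j) \<le> n\<^sup>2 * T j" for j using sb unfolding subgroup_bounds_def by blast
      \<comment> \<open>Each further summand costs a factor of at most n^2, so everything beyond k =
        4 is inherited from the fourfold sums.\<close>
      have "T (4 + d) \<le> (n\<^sup>2) ^ d * T 4" for d
      proof (induction d)
        case (Suc d)
        have "T (4 + Suc d) \<le> n\<^sup>2 * T (4 + d)" using step[of "4 + d"] by simp
        also have "\<dots> \<le> n\<^sup>2 * ((n\<^sup>2) ^ d * T 4)" using Suc by (rule mult_le_mono2)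
        finally show ?case by simp
      qed simp
      from this[of "k - 4"] 3 have "T k \<le> (n\<^sup>2) ^ (k - 4) * T 4" by simp
      then have "real (T k) \<le> real ((n\<^sup>2) ^ (k - 4) * T 4)" by (simp only: of_nat_le_iff)
      also have "\<dots> = real n powr (2 * real k - 8) * real (T 4)"
      proof -
        have "real ((n\<^sup>2) ^ (k - 4)) = real n ^ (2 * (k - 4))" by (simp add: power_mult)
        also have "\<dots> = real n powr real (2 * (k - 4))" using n by (intro powr_realpow[symmetric]) simp
        also have "real (2 * (k - 4)) = 2 * real k - 8" using 3 by (simp add: of_nat_diff)
        finally show ?thesis by simp
      qed
      also have "\<dots> \<le> real n powr (2 * real k - 8) * (C * real n powr (55/9))"
        by (intro mult_left_mono C(2)[OF sb n np]) auto
      also have "\<dots> = C * (real n powr (2 * real k - 8 + 55/9))" unfolding powr_add by simp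
      also have "\<dots> \<le> C * (real n powr (2 * real k - 17/9 + 16/3 * 2 powr (- 2 * real k)) * log 2 (real n) powr (2/3))"
      proof (intro mult_left_mono)
        have "real n powr (2 * real k - 8 + 55/9) * 1 \<le>
          real n powr (2 * real k - 17/9 + 16/3 * 2 powr (- 2 * real k)) * log 2 (real n) powr (2/3)"
          using n Lp[OF n] by (intro mult_mono powr_mono) auto
        then show "real n powr (2 * real k - 8 + 55/9) \<le>
          real n powr (2 * real k - 17/9 + 16/3 * 2 powr (- 2 * real k)) * log 2 (real n) powr (2/3)" by simp
      qed (use C(1) in simp)
      finally show ?thesis .
    qed
    then show ?thesis using C(1) by blast
  qed
qed

theorem theorem34:
  shows
    "(\<forall>c>0. \<exists>C>0. \<forall>(p::nat) (\<Gamma>::int set).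
        prime p \<longrightarrow> subgroup \<Gamma> (mult_of (residue_ring (int p))) \<longrightarrow> 1 < card \<Gamma> \<longrightarrow>
        real (card \<Gamma>) \<le> c * (real p powr (2/3) * log 2 (real (card \<Gamma>)) powr (4/3)) \<longrightarrow>
        real (additive_energy (residue_ring (int p)) \<Gamma>)
          \<le> C * max (real (card \<Gamma>) powr (22/9) * log 2 (real (card \<Gamma>)))
                    (real (card \<Gamma>) ^ 3 * real p powr (-1/3) * log 2 (real (card \<Gamma>)) powr (4/3)))
   \<and> (\<forall>c>0. \<exists>C>0. \<forall>(p::nat) (\<Gamma>::int set).
        prime p \<longrightarrow> subgroup \<Gamma> (mult_of (residue_ring (int p))) \<longrightarrow> 1 < card \<Gamma> \<longrightarrow>
        real (card \<Gamma>) \<le> c * (real p powr (3/5) * log 2 (real p) powr (-6/5)) \<longrightarrow>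
        real (additive_energy (residue_ring (int p)) \<Gamma>)
          \<le> C * (real (card \<Gamma>) powr (22/9) * log 2 (real (card \<Gamma>)) powr (2/3)))
   \<and> (\<forall>k\<ge>2. \<exists>C>0. \<forall>(p::nat) (\<Gamma>::int set).
        prime p \<longrightarrow> subgroup \<Gamma> (mult_of (residue_ring (int p))) \<longrightarrow> 1 < card \<Gamma> \<longrightarrow>
        real (card \<Gamma>) < sqrt (real p) \<longrightarrow>
        real (higher_energy (residue_ring (int p)) k \<Gamma>)
          \<le> C * (real (card \<Gamma>) powr (2 * real k - 17/9 + 16/3 * 2 powr (- 2 * real k))
                 * log 2 (real (card \<Gamma>)) powr (2/3)))"
proof (intro conjI allI impI)
  fix c :: real assume c: "0 < c"
  show "\<exists>C>0. \<forall>(p::nat) (\<Gamma>::int set).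
        prime p \<longrightarrow> subgroup \<Gamma> (mult_of (residue_ring (int p))) \<longrightarrow> 1 < card \<Gamma> \<longrightarrow>
        real (card \<Gamma>) \<le> c * (real p powr (2/3) * log 2 (real (card \<Gamma>)) powr (4/3)) \<longrightarrow>
        real (additive_energy (residue_ring (int p)) \<Gamma>)
          \<le> C * max (real (card \<Gamma>) powr (22/9) * log 2 (real (card \<Gamma>)))
                    (real (card \<Gamma>) ^ 3 * real p powr (-1/3) * log 2 (real (card \<Gamma>)) powr (4/3))"
  proof (intro exI[of _ "2 ^ 65 + c + 1"] conjI allI impI)
    fix p :: nat and \<Gamma> :: "int set"
    assume A: "prime p" "subgroup \<Gamma> (mult_of (residue_ring (int p)))" "1 < card \<Gamma>"
      "real (card \<Gamma>) \<le> c * (real p powr (2/3) * log 2 (real (card \<Gamma>)) powr (4/3))"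
    show "real (additive_energy (residue_ring (int p)) \<Gamma>)
          \<le> (2 ^ 65 + c + 1) * max (real (card \<Gamma>) powr (22/9) * log 2 (real (card \<Gamma>)))
                    (real (card \<Gamma>) ^ 3 * real p powr (-1/3) * log 2 (real (card \<Gamma>)) powr (4/3))"
      by (rule energy_general_bound[OF c subgroup_bounds[OF A(1,2)] _ _ A(4)])
         (use A prime_gt_0_nat in auto)
  qed (use c in simp)
  show "\<exists>C>0. \<forall>(p::nat) (\<Gamma>::int set).
        prime p \<longrightarrow> subgroup \<Gamma> (mult_of (residue_ring (int p))) \<longrightarrow> 1 < card \<Gamma> \<longrightarrow>
        real (card \<Gamma>) \<le> c * (real p powr (3/5) * log 2 (real p) powr (-6/5)) \<longrightarrow>
        real (additive_energy (residue_ring (int p)) \<Gamma>)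
          \<le> C * (real (card \<Gamma>) powr (22/9) * log 2 (real (card \<Gamma>)) powr (2/3))"
  proof (intro exI[of _ "2 ^ 64 * (1 + c powr (5/3)) + c ^ 40 + c ^ 25"] conjI allI impI)
    show "0 < 2 ^ 64 * (1 + c powr (5/3)) + c ^ 40 + c ^ 25"
      using c by (intro add_pos_pos mult_pos_pos) auto
    fix p :: nat and \<Gamma> :: "int set"
    assume A: "prime p" "subgroup \<Gamma> (mult_of (residue_ring (int p)))" "1 < card \<Gamma>"
      "real (card \<Gamma>) \<le> c * (real p powr (3/5) * log 2 (real p) powr (-6/5))"
    show "real (additive_energy (residue_ring (int p)) \<Gamma>)
          \<le> (2 ^ 64 * (1 + c powr (5/3)) + c ^ 40 + c ^ 25) * (real (card \<Gamma>) powr (22/9) * log 2 (real (card \<Gamma>)) powr (2/3))"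
      by (rule energy_medium_bound[OF c subgroup_bounds[OF A(1,2)] _ _ A(4)])
         (use A prime_ge_2_nat in auto)
  qed
next
  fix k :: nat assume "2 \<le> k"
  then obtain C where C: "0 < C" "\<And>p n E T. subgroup_bounds p n E T \<Longrightarrow> 2 \<le> n \<Longrightarrow> n\<^sup>2 \<le> p \<Longrightarrow>
    real (T k) \<le> C * (real n powr (2 * real k - 17/9 + 16/3 * 2 powr (- 2 * real k)) * log 2 (real n) powr (2/3))"
    using higher_moment_asymptotic by meson
  show "\<exists>C>0. \<forall>(p::nat) (\<Gamma>::int set).
        prime p \<longrightarrow> subgroup \<Gamma> (mult_of (residue_ring (int p))) \<longrightarrow> 1 < card \<Gamma> \<longrightarrow>
        real (card \<Gamma>) < sqrt (real p) \<longrightarrow>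
        real (higher_energy (residue_ring (int p)) k \<Gamma>)
          \<le> C * (real (card \<Gamma>) powr (2 * real k - 17/9 + 16/3 * 2 powr (- 2 * real k))
                 * log 2 (real (card \<Gamma>)) powr (2/3))"
  proof (intro exI[of _ C] conjI allI impI C(1))
    fix p :: nat and \<Gamma> :: "int set"
    assume A: "prime p" "subgroup \<Gamma> (mult_of (residue_ring (int p)))" "1 < card \<Gamma>" "real (card \<Gamma>) < sqrt (real p)"
    have "(real (card \<Gamma>))\<^sup>2 \<le> (sqrt (real p))\<^sup>2" using A(4) by (intro power_mono) auto
    then have "real ((card \<Gamma>)\<^sup>2) \<le> real p" by simp
    then have "(card \<Gamma>)\<^sup>2 \<le> p" by (simp only: of_nat_le_iff)
    then show "real (higher_energy (residue_ring (int p)) k \<Gamma>)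
          \<le> C * (real (card \<Gamma>) powr (2 * real k - 17/9 + 16/3 * 2 powr (- 2 * real k))
                 * log 2 (real (card \<Gamma>)) powr (2/3))"
      using C(2)[OF subgroup_bounds[OF A(1,2)]] A(3) by simp
  qed
qed

end
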